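(* Let $(\rho_{\sigma,\tau})_{0\le\sigma\le\tau}$ be a dynamic risk measure on $(\Omega,\mathcal F_\infty,(\mathcal F_t)_{t\in\mathbb R^+},P)$ that is continuous from above. Let $\nu\le\sigma\le\tau$ be stopping times. The following three conditions are equivalent: (i) (time consistency) $\rho_{\nu,\tau}(X)=\rho_{\nu,\sigma}(-\rho_{\sigma,\tau}(X))$ for all $X\in L^\infty(\Omega,\mathcal F_\tau,P)$; (ii) for every probability measure $Q$ on $(\Omega,\mathcal F_\tau)$ absolutely continuous with respect to $P$, $\mathcal A_{\nu,\tau}(Q)=\mathcal A_{\nu,\sigma}(Q)+\mathcal A_{\sigma,\tau}$; (iii) for every probability measure $Q$ on $(\Omega,\mathcal F_\tau)$ absolutely continuous with respect to $P$, the minimal penalty function satisfies the cocycle condition $$\alpha^m_{\nu,\tau}(Q)=\alpha^m_{\nu,\sigma}(Q)+E_Q(\alpha^m_{\sigma,\tau}(Q)\mid\mathcal F_\nu)\quad Q\text{-a.s.}$$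
   Context: Setting: $(\Omega,\mathcal F_\infty,(\mathcal F_t)_{t\in\mathbb R^+},P)$ is a filtered probability space; the filtration is right continuous and $\mathcal F_0$ is the $\sigma$-algebra generated by the $P$-null sets of $\mathcal F_\infty$. Stopping times may take the value $\infty$; $\mathcal F_\tau=\{A\in\mathcal F_\infty: A\cap\{\tau\le t\}\in\mathcal F_t\ \forall t\in\mathbb R^+\}$. Functions are identified with their classes in $L^\infty(\mathcal F_\tau)=L^\infty(\Omega,\mathcal F_\tau,P)$. Dynamic risk measure: a family of maps $\rho_{\sigma,\tau}:L^\infty(\mathcal F_\tau)\to L^\infty(\mathcal F_\sigma)$, indexed by pairs of stopping times $0\le\sigma\le\tau$, each satisfying ($P$-a.s.): monotonicity ($X\le Y\Rightarrow\rho_{\sigma,\tau}(X)\ge\rho_{\sigma,\tau}(Y)$); translation invariance ($\rho_{\sigma,\tau}(X+Z)=\rho_{\sigma,\tau}(X)-Z$ for $Z\in L^\infty(\mathcal F_\sigma)$); convexity ($\rho_{\sigma,\tau}(\lambda X+(1-\lambda)Y)\le\lambda\rho_{\sigma,\tau}(X)+(1-\lambda)\rho_{\sigma,\tau}(Y)$ for $\lambda\in[0,1]$). It is not assumed that $\rho_{\sigma,\tau}(0)=0$. Continuous from above: for all $\sigma\le\tau$ and every decreasing sequence $X_n$ in $L^\infty(\mathcal F_\tau)$ with a.s. limit $X\in L^\infty(\mathcal F_\tau)$, the increasing sequence $\rho_{\sigma,\tau}(X_n)$ has limit $\rho_{\sigma,\tau}(X)$ a.s. For $Q\ll P$: the $Q$-acceptance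 set is $\mathcal A_{\sigma,\tau}(Q)=\{Y\in L^\infty(\Omega,\mathcal F_\tau,P):\rho_{\sigma,\tau}(Y)\le0\ Q\text{-a.s.}\}$, and $\mathcal A_{\sigma,\tau}=\mathcal A_{\sigma,\tau}(P)$. The sum of two sets is $A+B=\{a+b:a\in A,b\in B\}$. The minimal penalty is $$\alpha^m_{\sigma,\tau}(Q)=Q\text{-}\operatorname{ess\,sup}_{X\in L^\infty(\Omega,\mathcal F_\tau,P)}\big(E_Q(-X\mid\mathcal F_\sigma)-\rho_{\sigma,\tau}(X)\big),$$ which equals both $Q\text{-}\operatorname{ess\,sup}_{Y\in\mathcal A_{\sigma,\tau}(Q)}E_Q(-Y\mid\mathcal F_\sigma)$ and $Q\text{-}\operatorname{ess\,sup}_{Y\in\mathcal A_{\sigma,\tau}}E_Q(-Y\mid\mathcal F_\sigma)$. It depends only on the restriction of $Q$ to $\mathcal F_\tau$, may take the value $+\infty$, and is bounded below (by $-\rho_{\sigma,\tau}(0)$), so the conditional expectation in (iii) is well defined with values in $(-\infty,+\infty]$. *)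

theory Defs
  imports "HOL-Probability.Probability"
begin

section \<open>Filtered probability space\<close>

text \<open>
  The time axis is \<open>[0,\<infinity>]\<close>, i.e. the type \<^typ>\<open>ennreal\<close>, and the value of \<open>F\<close> at \<open>\<top>\<close> is the
  terminal sigma-algebra \<open>F\<^sub>\<infinity>\<close>, the one that carries \<open>P\<close>. With this index set
  \<^const>\<open>stopping_time\<close> is the usual notion for stopping times that may take the value infinity (the
  condition at \<open>t = \<top>\<close> is void), and \<^const>\<open>filtration.pre_sigma\<close> consists of the \<open>A\<close> in \<open>F\<^sub>\<infinity>\<close> (the
  condition at \<open>t = \<top>\<close>) such that \<open>A \<inter> {\<tau> \<le> t}\<close> is in \<open>F\<^sub>t\<close> for all finite \<open>t\<close>. Only the
  sigma-algebra of each \<open>F t\<close> matters, not its \<^const>\<open>emeasure\<close>.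
\<close>

locale filtered_prob_space = prob_space P + filtration "space P" F
  for P :: "'a measure" and F :: "ennreal \<Rightarrow> 'a measure" +
  assumes sets_F_top: "sets (F \<top>) = sets P"
    and right_continuous: "\<And>t. t < \<top> \<Longrightarrow> sets (F t) = (\<Inter>s\<in>{t<..}. sets (F s))"
    and sets_F_0: "sets (F 0) = sigma_sets (space P) (null_sets P)"

abbreviation stopped_sigma :: "'a measure \<Rightarrow> (ennreal \<Rightarrow> 'a measure) \<Rightarrow> ('a \<Rightarrow> ennreal) \<Rightarrow> 'a measure"
  where "stopped_sigma P F \<tau> \<equiv> filtration.pre_sigma (space P) F \<tau>"

definition ordered_stopping_times ::
  "'a measure \<Rightarrow> (ennreal \<Rightarrow> 'a measure) \<Rightarrow> ('a \<Rightarrow> ennreal) \<Rightarrow> ('a \<Rightarrow> ennreal) \<Rightarrow> bool"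
  where "ordered_stopping_times P F \<sigma> \<tau> \<longleftrightarrow>
    stopping_time F \<sigma> \<and> stopping_time F \<tau> \<and> (\<forall>\<omega>\<in>space P. \<sigma> \<omega> \<le> \<tau> \<omega>)"

text \<open>
  Elements of \<open>L\<^sup>\<infinity>\<close> are given by representatives; all relations between them are stated almost
  surely. Since \<open>F\<^sub>0\<close> contains the null sets, \<open>Linf\<close> is closed under modification of a function on a
  \<open>P\<close>-null set.
\<close>

definition Linf :: "'a measure \<Rightarrow> (ennreal \<Rightarrow> 'a measure) \<Rightarrow> ('a \<Rightarrow> ennreal) \<Rightarrow> ('a \<Rightarrow> real) set"
  where "Linf P F \<tau> =
    {X \<in> borel_measurable (stopped_sigma P F \<tau>). \<exists>C. AE \<omega> in P. \<bar>X \<omega>\<bar> \<le> C}"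


section \<open>Dynamic risk measures\<close>

type_synonym 'a risk_family =
  "('a \<Rightarrow> ennreal) \<Rightarrow> ('a \<Rightarrow> ennreal) \<Rightarrow> ('a \<Rightarrow> real) \<Rightarrow> ('a \<Rightarrow> real)"

text \<open>
  Compatibility of \<open>\<rho> \<sigma> \<tau>\<close> with almost sure equality, i.e. the fact that it is a map between classes
  of functions, is the case of \<open>X \<le> Y\<close> and \<open>Y \<le> X\<close> in the monotonicity axiom.
\<close>

definition dynamic_risk_measure ::
  "'a measure \<Rightarrow> (ennreal \<Rightarrow> 'a measure) \<Rightarrow> 'a risk_family \<Rightarrow> bool"
  where "dynamic_risk_measure P F \<rho> \<longleftrightarrow>
    (\<forall>\<sigma> \<tau>. ordered_stopping_times P F \<sigma> \<tau> \<longrightarrow>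
      (\<forall>X \<in> Linf P F \<tau>. \<rho> \<sigma> \<tau> X \<in> Linf P F \<sigma>) \<and>
      (\<forall>X \<in> Linf P F \<tau>. \<forall>Y \<in> Linf P F \<tau>.
        (AE \<omega> in P. X \<omega> \<le> Y \<omega>) \<longrightarrow> (AE \<omega> in P. \<rho> \<sigma> \<tau> X \<omega> \<ge> \<rho> \<sigma> \<tau> Y \<omega>)) \<and>
      (\<forall>X \<in> Linf P F \<tau>. \<forall>Z \<in> Linf P F \<sigma>.
        AE \<omega> in P. \<rho> \<sigma> \<tau> (\<lambda>\<omega>. X \<omega> + Z \<omega>) \<omega> = \<rho> \<sigma> \<tau> X \<omega> - Z \<omega>) \<and>
      (\<forall>X \<in> Linf P F \<tau>. \<forall>Y \<in> Linf P F \<tau>. \<forall>l \<in> {0..1::real}.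
        AE \<omega> in P. \<rho> \<sigma> \<tau> (\<lambda>\<omega>. l * X \<omega> + (1 - l) * Y \<omega>) \<omega>
          \<le> l * \<rho> \<sigma> \<tau> X \<omega> + (1 - l) * \<rho> \<sigma> \<tau> Y \<omega>))"

definition continuous_from_above ::
  "'a measure \<Rightarrow> (ennreal \<Rightarrow> 'a measure) \<Rightarrow> 'a risk_family \<Rightarrow> bool"
  where "continuous_from_above P F \<rho> \<longleftrightarrow>
    (\<forall>\<sigma> \<tau>. ordered_stopping_times P F \<sigma> \<tau> \<longrightarrow>
      (\<forall>X :: nat \<Rightarrow> 'a \<Rightarrow> real. \<forall>Y \<in> Linf P F \<tau>.
        (\<forall>n. X n \<in> Linf P F \<tau>) \<longrightarrow>
        (\<forall>n. AE \<omega> in P. X (Suc n) \<omega> \<le> X n \<omega>) \<longrightarrow>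
        (AE \<omega> in P. (\<lambda>n. X n \<omega>) \<longlonglongrightarrow> Y \<omega>) \<longrightarrow>
        (AE \<omega> in P. (\<lambda>n. \<rho> \<sigma> \<tau> (X n) \<omega>) \<longlonglongrightarrow> \<rho> \<sigma> \<tau> Y \<omega>)))"

definition ac_prob_measures ::
  "'a measure \<Rightarrow> (ennreal \<Rightarrow> 'a measure) \<Rightarrow> ('a \<Rightarrow> ennreal) \<Rightarrow> 'a measure set"
  where "ac_prob_measures P F \<tau> =
    {Q. prob_space Q \<and> sets Q = sets (stopped_sigma P F \<tau>) \<and>
        absolutely_continuous (restr_to_subalg P (stopped_sigma P F \<tau>)) Q}"

definition acceptance_set ::
  "'a measure \<Rightarrow> (ennreal \<Rightarrow> 'a measure) \<Rightarrow> 'a risk_family \<Rightarrow>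
    ('a \<Rightarrow> ennreal) \<Rightarrow> ('a \<Rightarrow> ennreal) \<Rightarrow> 'a measure \<Rightarrow> ('a \<Rightarrow> real) set"
  where "acceptance_set P F \<rho> \<sigma> \<tau> Q = {Y \<in> Linf P F \<tau>. AE \<omega> in Q. \<rho> \<sigma> \<tau> Y \<omega> \<le> 0}"


section \<open>Essential supremum of a family of functions\<close>

text \<open>
  This is the essential supremum of a possibly uncountable family, which is again a function; it is
  not the number \<^const>\<open>esssup\<close>.
\<close>

definition is_ess_sup :: "'a measure \<Rightarrow> ('a \<Rightarrow> ereal) set \<Rightarrow> ('a \<Rightarrow> ereal) \<Rightarrow> bool"
  where "is_ess_sup M \<Phi> Z \<longleftrightarrow>
    Z \<in> borel_measurable M \<and>
    (\<forall>X\<in>\<Phi>. AE \<omega> in M. X \<omega> \<le> Z \<omega>) \<and>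
    (\<forall>W\<in>borel_measurable M. (\<forall>X\<in>\<Phi>. AE \<omega> in M. X \<omega> \<le> W \<omega>) \<longrightarrow> (AE \<omega> in M. Z \<omega> \<le> W \<omega>))"

definition ess_sup :: "'a measure \<Rightarrow> ('a \<Rightarrow> ereal) set \<Rightarrow> 'a \<Rightarrow> ereal"
  where "ess_sup M \<Phi> = (SOME Z. is_ess_sup M \<Phi> Z)"

lemma is_ess_sup_unique:
  assumes "is_ess_sup M \<Phi> Z" "is_ess_sup M \<Phi> Z'"
  shows "AE \<omega> in M. Z \<omega> = Z' \<omega>"
proof -
  have "AE \<omega> in M. Z \<omega> \<le> Z' \<omega>" "AE \<omega> in M. Z' \<omega> \<le> Z \<omega>"
    using assms unfolding is_ess_sup_def by blast+
  then show ?thesis by eventually_elim auto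
qed

lemma (in finite_measure) is_ess_sup_exists:
  assumes \<Phi>: "\<Phi> \<subseteq> borel_measurable M"
  shows "\<exists>Z. is_ess_sup M \<Phi> Z"
proof -
  define S :: "('a \<Rightarrow> ereal) set \<Rightarrow> 'a \<Rightarrow> ereal" where "S C = (\<lambda>\<omega>. SUP X\<in>C. X \<omega>)" for C
  define \<C> where "\<C> = {C. C \<subseteq> \<Phi> \<and> countable C}"
  define m where "m q C = measure M {\<omega>\<in>space M. S C \<omega> > ereal (of_rat q)}" for q C
  have S_meas: "S C \<in> borel_measurable M" if "C \<in> \<C>" for C
    unfolding S_def using that \<Phi> by (intro borel_measurable_SUP) (auto simp: \<C>_def)
  have S_mono: "S C \<omega> \<le> S D \<omega>" if "C \<subseteq> D" for C D \<omega>
    unfolding S_def by (rule SUP_subset_mono[OF that]) simp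
  have m_mono: "m q C \<le> m q D" if "C \<subseteq> D" "D \<in> \<C>" for q C D
  proof -
    have [measurable]: "S D \<in> borel_measurable M" using S_meas[OF that(2)] .
    show ?thesis
      unfolding m_def using S_mono[OF that(1)]
      by (intro finite_measure_mono) (auto intro: less_le_trans)
  qed
  have "\<exists>C\<in>\<C>. \<forall>D\<in>\<C>. m q D \<le> m q C" for q
  proof -
    let ?s = "SUP D\<in>\<C>. m q D"
    have bdd: "bdd_above (m q ` \<C>)"
      unfolding m_def by (intro bdd_aboveI2[where M = "measure M (space M)"] bounded_measure)
    have ne: "\<C> \<noteq> {}" by (auto simp: \<C>_def)
    have "\<exists>D\<in>\<C>. ?s - 1 / real (Suc n) < m q D" for n
      using less_cSUP_iff[OF ne bdd, of "?s - 1 / real (Suc n)"] by simp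
    then obtain D where D: "\<And>n. D n \<in> \<C>" "\<And>n. ?s - 1 / real (Suc n) < m q (D n)" by metis
    have UD: "(\<Union>n. D n) \<in> \<C>" using D(1) by (auto simp: \<C>_def)
    have "?s - 1 / real (Suc n) \<le> m q (\<Union>n. D n)" for n
      using D(2)[of n] m_mono[of "D n" "\<Union>n. D n" q] UD by (force intro: order_trans less_imp_le)
    moreover have "(\<lambda>n. ?s - 1 / real (Suc n)) \<longlonglongrightarrow> ?s - 0"
      by (intro tendsto_diff tendsto_const LIMSEQ_Suc[OF lim_1_over_n])
    ultimately have "?s \<le> m q (\<Union>n. D n)" by (auto intro: LIMSEQ_le_const2)
    then show ?thesis using UD cSUP_upper[OF _ bdd] by (meson order_trans)
  qed
  then obtain c where c: "\<And>q. c q \<in> \<C>" "\<And>q D. D \<in> \<C> \<Longrightarrow> m q D \<le> m q (c q)" by metis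
  define C where "C = (\<Union>q. c q)"
  have C: "C \<in> \<C>" using c(1) by (auto simp: \<C>_def C_def)
  have CM[measurable]: "S C \<in> borel_measurable M" by (rule S_meas[OF C])
  have "AE \<omega> in M. X \<omega> \<le> S C \<omega>" if X: "X \<in> \<Phi>" for X
  proof -
    let ?D = "insert X C"
    have D: "?D \<in> \<C>" using C X by (auto simp: \<C>_def)
    have DM[measurable]: "S ?D \<in> borel_measurable M" by (rule S_meas[OF D])
    have XD: "X \<omega> \<le> S ?D \<omega>" for \<omega> unfolding S_def by (rule SUP_upper) simp
    have "AE \<omega> in M. S ?D \<omega> > ereal (of_rat q) \<longrightarrow> S C \<omega> > ereal (of_rat q)" for q
    proof -
      let ?A = "{\<omega>\<in>space M. S C \<omega> > ereal (of_rat q)}"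
      let ?B = "{\<omega>\<in>space M. S ?D \<omega> > ereal (of_rat q)}"
      have "?A \<subseteq> ?B" using S_mono[of C ?D] by (auto intro: less_le_trans)
      moreover have "m q ?D \<le> m q C"
      proof (rule order_trans[OF c(2)[OF D]])
        show "m q (c q) \<le> m q C" by (rule m_mono[OF _ C]) (auto simp: C_def)
      qed
      ultimately have "measure M (?B - ?A) \<le> 0"
        by (subst finite_measure_Diff) (auto simp: m_def)
      then have "measure M (?B - ?A) = 0" by (simp add: measure_le_0_iff)
      then have "?B - ?A \<in> null_sets M" by (auto simp: null_sets_def emeasure_eq_measure)
      from AE_not_in[OF this] show ?thesis by (auto elim!: AE_mp)
    qed
    then have "AE \<omega> in M. \<forall>q. S ?D \<omega> > ereal (of_rat q) \<longrightarrow> S C \<omega> > ereal (of_rat q)"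
      by (simp add: AE_all_countable)
    then show ?thesis
    proof eventually_elim
      case (elim \<omega>)
      show ?case
      proof (rule ccontr)
        assume "\<not> X \<omega> \<le> S C \<omega>"
        then have "S C \<omega> < S ?D \<omega>" using XD[of \<omega>] by auto
        then obtain a b where "S C \<omega> < ereal a" "ereal a < ereal b" "ereal b < S ?D \<omega>"
          by (metis ereal_dense2)
        moreover then obtain q where "a < of_rat q" "of_rat q < b" using of_rat_dense by auto
        ultimately have "S C \<omega> < ereal (of_rat q)" "ereal (of_rat q) < S ?D \<omega>"
          using less_trans[of "S C \<omega>" "ereal a" "ereal (of_rat q)"]
            less_trans[of "ereal (of_rat q)" "ereal b" "S ?D \<omega>"] by simp_all
        then show False using elim by (auto dest: less_asym)
      qed
    qed
  qed
  moreover have "AE \<omega> in M. S C \<omega> \<le> W \<omega>" if "\<forall>X\<in>\<Phi>. AE \<omega> in M. X \<omega> \<le> W \<omega>" for W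
  proof -
    have "AE \<omega> in M. \<forall>X\<in>C. X \<omega> \<le> W \<omega>"
      using that C by (subst AE_ball_countable) (auto simp: \<C>_def)
    then show ?thesis by eventually_elim (auto simp: S_def intro: SUP_least)
  qed
  ultimately show ?thesis using CM unfolding is_ess_sup_def by blast
qed


section \<open>Minimal penalty\<close>

definition min_penalty ::
  "'a measure \<Rightarrow> (ennreal \<Rightarrow> 'a measure) \<Rightarrow> 'a risk_family \<Rightarrow>
    ('a \<Rightarrow> ennreal) \<Rightarrow> ('a \<Rightarrow> ennreal) \<Rightarrow> 'a measure \<Rightarrow> 'a \<Rightarrow> ereal"
  where "min_penalty P F \<rho> \<sigma> \<tau> Q = ess_sup Q
    {\<lambda>\<omega>. ereal (real_cond_exp Q (stopped_sigma P F \<sigma>) (\<lambda>\<omega>. - X \<omega>) \<omega> - \<rho> \<sigma> \<tau> X \<omega>) | X. X \<in> Linf P F \<tau>}"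

text \<open>
  Conditional expectation of an extended real function \<open>Z\<close> as the difference of those of its positive
  and negative parts (\<^const>\<open>e2ennreal\<close> truncates at \<open>0\<close>), as in \<^const>\<open>real_cond_exp\<close>. If \<open>Z\<close> is
  bounded below almost surely, the subtrahend is almost surely finite and the result has values in
  \<open>(-\<infinity>,\<infinity>]\<close>.
\<close>

definition ereal_cond_exp :: "'a measure \<Rightarrow> 'a measure \<Rightarrow> ('a \<Rightarrow> ereal) \<Rightarrow> 'a \<Rightarrow> ereal"
  where "ereal_cond_exp M G Z = (\<lambda>\<omega>.
    enn2ereal (nn_cond_exp M G (\<lambda>\<omega>. e2ennreal (Z \<omega>)) \<omega>)
    - enn2ereal (nn_cond_exp M G (\<lambda>\<omega>. e2ennreal (- Z \<omega>)) \<omega>))"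


section \<open>The three conditions\<close>

definition time_consistent ::
  "'a measure \<Rightarrow> (ennreal \<Rightarrow> 'a measure) \<Rightarrow> 'a risk_family \<Rightarrow>
    ('a \<Rightarrow> ennreal) \<Rightarrow> ('a \<Rightarrow> ennreal) \<Rightarrow> ('a \<Rightarrow> ennreal) \<Rightarrow> bool"
  where "time_consistent P F \<rho> \<nu> \<sigma> \<tau> \<longleftrightarrow>
    (\<forall>X \<in> Linf P F \<tau>. AE \<omega> in P. \<rho> \<nu> \<tau> X \<omega> = \<rho> \<nu> \<sigma> (\<lambda>\<omega>. - \<rho> \<sigma> \<tau> X \<omega>) \<omega>)"

definition acceptance_decomposition ::
  "'a measure \<Rightarrow> (ennreal \<Rightarrow> 'a measure) \<Rightarrow> 'a risk_family \<Rightarrow>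
    ('a \<Rightarrow> ennreal) \<Rightarrow> ('a \<Rightarrow> ennreal) \<Rightarrow> ('a \<Rightarrow> ennreal) \<Rightarrow> bool"
  where "acceptance_decomposition P F \<rho> \<nu> \<sigma> \<tau> \<longleftrightarrow>
    (\<forall>Q \<in> ac_prob_measures P F \<tau>.
      acceptance_set P F \<rho> \<nu> \<tau> Q =
        {\<lambda>\<omega>. Y \<omega> + Z \<omega> | Y Z. Y \<in> acceptance_set P F \<rho> \<nu> \<sigma> Q \<and> Z \<in> acceptance_set P F \<rho> \<sigma> \<tau> P})"

definition cocycle_condition ::
  "'a measure \<Rightarrow> (ennreal \<Rightarrow> 'a measure) \<Rightarrow> 'a risk_family \<Rightarrow>
    ('a \<Rightarrow> ennreal) \<Rightarrow> ('a \<Rightarrow> ennreal) \<Rightarrow> ('a \<Rightarrow> ennreal) \<Rightarrow> bool"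
  where "cocycle_condition P F \<rho> \<nu> \<sigma> \<tau> \<longleftrightarrow>
    (\<forall>Q \<in> ac_prob_measures P F \<tau>. AE \<omega> in Q.
      min_penalty P F \<rho> \<nu> \<tau> Q \<omega> =
        min_penalty P F \<rho> \<nu> \<sigma> Q \<omega>
        + ereal_cond_exp Q (stopped_sigma P F \<nu>) (min_penalty P F \<rho> \<sigma> \<tau> Q) \<omega>)"

end

theory Submission
  imports Defs
begin

text \<open>
  Translation invariance splits \<open>X\<close> as \<open>- \<rho> \<sigma> \<tau> X\<close> plus the acceptable position \<open>X + \<rho> \<sigma> \<tau> X\<close>, which gives
  (i) \<open>\<longleftrightarrow>\<close> (ii); the converse only uses \<open>Q = P\<close>. The family defining the minimal penalty is directed
  upwards, since risk measures are local, so the penalty is an increasing limit and conditional monotone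
  convergence gives the cocycle formula for \<open>\<lambda>X. \<rho> \<nu> \<sigma> (- \<rho> \<sigma> \<tau> X)\<close>, whether or not (i) holds. Thus (iii)
  says that this composition and \<open>\<rho> \<nu> \<tau>\<close> have the same penalties, and it remains to see that the
  penalties determine a risk measure that is continuous from above: a position outside the acceptance
  set is separated from it by a measure \<open>Q\<close> absolutely continuous with respect to \<open>P\<close>.

  The separation replaces the Krein-Smulian and Hahn-Banach theorems by projections in \<open>L\<^sup>2\<close>. Acceptance
  sets increase with the order, so one first separates the nonnegative displacements bounded by
  \<open>k * 2 ^ n\<close>, one \<open>n\<close> after the other; the \<open>n\<close>-th correction of the functional has \<open>L\<^sup>1\<close>-norm at most
  \<open>1 / (k * 2 ^ n)\<close>, so the corrections add up to some integrable \<open>f\<close>. The set is then bounded away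
  from \<open>0\<close> in \<open>L\<^sup>2(f P)\<close>, and the element of least norm of its closure there is the functional sought.
\<close>

section \<open>Square integrable functions\<close>

text \<open>The obstacle is that the functional has to be an L^1 density. The set to be separated
  from 0 is closed only under uniformly bounded almost sure convergence, and its closure in L^2(P)
  may contain 0: for f \<ge> 0 integrable but not square integrable, this happens with the bounded V
  such that \<integral> f V \<ge> 1. Projecting in L^2(P) then yields nothing, hence the new weight
  f. In L^2(f P) the shortest element W is a limit only; it may be unbounded and lie outside the
  set, and the density obtained is f W.

  The separation is not conditional. A strict gap between Q-expectations suffices: penalties are
  increasing limits of integrable terms, so two penalties that agree Q-a.s. leave no room for a gap
  between the expectations of their terms. The measure Q comes from the position and need not be
  equivalent to P, and this is how the quantifier over all Q in (iii) enters.\<close>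

definition sq_integrable :: "'a measure \<Rightarrow> ('a \<Rightarrow> real) \<Rightarrow> bool"
  where "sq_integrable M f \<longleftrightarrow> f \<in> borel_measurable M \<and> integrable M (\<lambda>x. (f x)\<^sup>2)"

lemma sq_integrable_measurable [measurable_dest]: "sq_integrable M f \<Longrightarrow> f \<in> borel_measurable M"
  by (simp add: sq_integrable_def)

lemma sq_integrable_prod:
  assumes "sq_integrable M f" "sq_integrable M g"
  shows "integrable M (\<lambda>x. f x * g x)"
proof (rule Bochner_Integration.integrable_bound)
  show "integrable M (\<lambda>x. (f x)\<^sup>2 + (g x)\<^sup>2)"
    using assms by (auto simp: sq_integrable_def)
  show "(\<lambda>x. f x * g x) \<in> borel_measurable M"
    using assms by (auto simp: sq_integrable_def)
  have "\<bar>a * b\<bar> \<le> a\<^sup>2 + b\<^sup>2" for a b :: real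
  proof -
    have "0 \<le> (a + b)\<^sup>2" "0 \<le> (a - b)\<^sup>2" "0 \<le> a\<^sup>2" "0 \<le> b\<^sup>2" by auto
    then show ?thesis by (simp add: power2_sum power2_diff abs_le_iff)
  qed
  then show "AE x in M. norm (f x * g x) \<le> norm ((f x)\<^sup>2 + (g x)\<^sup>2)"
    by (auto simp del: abs_mult)
qed

lemma sq_integrable_lincomb:
  assumes "sq_integrable M f" "sq_integrable M g"
  shows "sq_integrable M (\<lambda>x. a * f x + b * g x)"
proof -
  have "integrable M (\<lambda>x. a\<^sup>2 * (f x)\<^sup>2 + b\<^sup>2 * (g x)\<^sup>2 + (2 * a * b) * (f x * g x))"
    using assms sq_integrable_prod[OF assms]
    by (intro Bochner_Integration.integrable_add integrable_mult_right)
      (auto simp: sq_integrable_def)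
  also have "(\<lambda>x. a\<^sup>2 * (f x)\<^sup>2 + b\<^sup>2 * (g x)\<^sup>2 + (2 * a * b) * (f x * g x)) = (\<lambda>x. (a * f x + b * g x)\<^sup>2)"
    by (auto simp: power2_sum power_mult_distrib)
  finally have "integrable M (\<lambda>x. (a * f x + b * g x)\<^sup>2)" .
  then show ?thesis using assms by (auto simp: sq_integrable_def)
qed

lemma sq_integrable_diff:
  "sq_integrable M f \<Longrightarrow> sq_integrable M g \<Longrightarrow> sq_integrable M (\<lambda>x. f x - g x)"
  using sq_integrable_lincomb[of M f g 1 "-1"] by simp

lemma integral_sq_lincomb:
  assumes "sq_integrable M f" "sq_integrable M g"
  shows "(\<integral>x. (a * f x + b * g x)\<^sup>2 \<partial>M)
    = a\<^sup>2 * (\<integral>x. (f x)\<^sup>2 \<partial>M) + b\<^sup>2 * (\<integral>x. (g x)\<^sup>2 \<partial>M) + 2 * a * b * (\<integral>x. f x * g x \<partial>M)"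
proof -
  have "(\<integral>x. (a * f x + b * g x)\<^sup>2 \<partial>M)
    = (\<integral>x. a\<^sup>2 * (f x)\<^sup>2 + b\<^sup>2 * (g x)\<^sup>2 + (2 * a * b) * (f x * g x) \<partial>M)"
    by (rule Bochner_Integration.integral_cong) (auto simp: power2_sum power_mult_distrib)
  also have "\<dots> = a\<^sup>2 * (\<integral>x. (f x)\<^sup>2 \<partial>M) + b\<^sup>2 * (\<integral>x. (g x)\<^sup>2 \<partial>M) + 2 * a * b * (\<integral>x. f x * g x \<partial>M)"
    using assms sq_integrable_prod[OF assms] by (auto simp: sq_integrable_def)
  finally show ?thesis .
qed

text \<open>Integrate \<open>(s * f - g)\<^sup>2 \<ge> 0\<close> and divide by \<open>s\<close>.
  With \<open>s\<close> tending to 0 this does the work of the triangle inequality while only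
  squared norms occur.\<close>

lemma integral_sq_add_le:
  assumes "sq_integrable M f" "sq_integrable M g" "0 < s"
  shows "(\<integral>x. (f x + g x)\<^sup>2 \<partial>M) \<le> (1 + s) * (\<integral>x. (f x)\<^sup>2 \<partial>M) + (1 + 1 / s) * (\<integral>x. (g x)\<^sup>2 \<partial>M)"
proof -
  have "0 \<le> (\<integral>x. (s * f x + (- 1) * g x)\<^sup>2 \<partial>M) / s"
    using assms(3) by simp
  also have "\<dots> = s * (\<integral>x. (f x)\<^sup>2 \<partial>M) + (\<integral>x. (g x)\<^sup>2 \<partial>M) / s - 2 * (\<integral>x. f x * g x \<partial>M)"
    using assms(3) by (subst integral_sq_lincomb[OF assms(1,2)]) (simp add: field_simps power2_eq_square)
  finally show ?thesis
    using integral_sq_lincomb[OF assms(1,2), of 1 1] by (simp add: algebra_simps)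
qed

text \<open>The order of the limits matters: for fixed \<open>s\<close> the errors vanish as
  \<open>n\<close> grows, and only then can \<open>s\<close> tend to 0, since the factor
  \<open>1 / s\<close> is unbounded.\<close>

lemma le_of_le_one_plus:
  fixes a b :: real and d e :: "nat \<Rightarrow> real"
  assumes "\<And>n s. 0 < s \<Longrightarrow> a \<le> (1 + s) * (b + d n) + (1 + 1 / s) * e n"
    and "d \<longlonglongrightarrow> 0" "e \<longlonglongrightarrow> 0"
  shows "a \<le> b"
proof -
  have *: "a \<le> (1 + s) * b" if "0 < s" for s
  proof -
    have "(\<lambda>n. (1 + s) * (b + d n) + (1 + 1 / s) * e n) \<longlonglongrightarrow> (1 + s) * (b + 0) + (1 + 1 / s) * 0"
      by (intro tendsto_intros assms)
    then show ?thesis using assms(1)[OF that] by (auto intro: LIMSEQ_le_const)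
  qed
  have "(\<lambda>n. (1 + 1 / real (Suc n)) * b) \<longlonglongrightarrow> (1 + 0) * b"
    by (intro tendsto_intros LIMSEQ_Suc[OF lim_1_over_n])
  then show ?thesis using * by (auto intro: LIMSEQ_le_const)
qed

text \<open>The variational inequality of a projection: \<open>W\<close> is shortest on the segment
  towards \<open>V\<close>, so the squared norm has nonnegative derivative at \<open>t = 0\<close>.
  After expanding, divide by \<open>t\<close> and let \<open>t = 1 / (n + 2)\<close> tend to
  0.\<close>

lemma first_order_condition:
  assumes W: "sq_integrable M W" and V: "sq_integrable M V"
    and le: "\<And>t. 0 < t \<Longrightarrow> t < 1 \<Longrightarrow> (\<integral>x. (W x)\<^sup>2 \<partial>M) \<le> (\<integral>x. ((1 - t) * W x + t * V x)\<^sup>2 \<partial>M)"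
  shows "(\<integral>x. (W x)\<^sup>2 \<partial>M) \<le> (\<integral>x. W x * V x \<partial>M)"
proof -
  let ?a = "\<integral>x. (W x)\<^sup>2 \<partial>M" and ?b = "\<integral>x. W x * V x \<partial>M" and ?c = "\<integral>x. (V x)\<^sup>2 \<partial>M"
  have "2 * ?a \<le> 2 * ?b + t * (?a + ?c - 2 * ?b)" if t: "0 < t" "t < 1" for t
  proof -
    have "?a \<le> (1 - t)\<^sup>2 * ?a + t\<^sup>2 * ?c + 2 * (1 - t) * t * ?b"
      using le[OF t] by (simp add: integral_sq_lincomb[OF W V])
    then have "t * (2 * ?a) \<le> t * (2 * ?b + t * (?a + ?c - 2 * ?b))"
      by (simp add: power2_eq_square algebra_simps)
    then show ?thesis using t by (simp del: mult.assoc)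
  qed
  from this[of "1 / real (n + 2)" for n]
  have *: "2 * ?a \<le> 2 * ?b + (1 / real (n + 2)) * (?a + ?c - 2 * ?b)" for n
    by simp
  have "(\<lambda>n. 1 / real (n + 2)) \<longlonglongrightarrow> 0"
    using LIMSEQ_ignore_initial_segment[OF lim_1_over_n, of 2] by simp
  then have "(\<lambda>n. 2 * ?b + (1 / real (n + 2)) * (?a + ?c - 2 * ?b)) \<longlonglongrightarrow> 2 * ?b + 0 * (?a + ?c - 2 * ?b)"
    by (intro tendsto_intros)
  then have "2 * ?a \<le> 2 * ?b + 0 * (?a + ?c - 2 * ?b)" using * by (intro LIMSEQ_le_const) auto
  then show ?thesis by simp
qed

section \<open>Completeness of L^2 and shortest elements of nested convex sets\<close>

lemma (in finite_measure) L2_complete: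
  fixes V :: "nat \<Rightarrow> 'a \<Rightarrow> real"
  assumes V: "\<And>n. sq_integrable M (V n)"
    and Cauchy: "\<And>n m. n \<le> m \<Longrightarrow> (\<integral>x. (V n x - V m x)\<^sup>2 \<partial>M) \<le> (1/4) ^ n"
  shows "\<exists>W. sq_integrable M W \<and> (AE x in M. (\<lambda>n. V n x) \<longlonglongrightarrow> W x) \<and>
    (\<forall>n. (\<integral>x. (V n x - W x)\<^sup>2 \<partial>M) \<le> (1/4) ^ n)"
proof -
  note [measurable] = sq_integrable_measurable[OF V]
  have int_sq: "integrable M (\<lambda>x. (V n x - V m x)\<^sup>2)" for n m
    using sq_integrable_diff[OF V V] by (auto simp: sq_integrable_def)
  define B where "B = 1 + measure M (space M)"
  have abs_le: "(\<integral>\<^sup>+x. ennreal \<bar>V n x - V (Suc n) x\<bar> \<partial>M) \<le> ennreal (B * (1/2) ^ n)" for n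
  proof -
    have p: "2 ^ n * (1/4) ^ n = (1/2 :: real) ^ n" by (simp flip: power_mult_distrib)
    \<comment> \<open>This replaces Cauchy-Schwarz. The weight \<open>2 ^ n\<close> is chosen so
      that the Cauchy bound \<open>(1/4) ^ n\<close> becomes \<open>(1/2) ^ n\<close>, and the
      L^1-distances of consecutive terms are summable.\<close>
    have "\<bar>d\<bar> \<le> 2 ^ n * d\<^sup>2 + (1/2) ^ n" for d :: real
    proof (cases "\<bar>d\<bar> \<le> (1/2) ^ n")
      case False
      then have "1 * \<bar>d\<bar> \<le> (2 ^ n * \<bar>d\<bar>) * \<bar>d\<bar>"
        by (intro mult_right_mono) (auto simp: field_simps power_one_over)
      then show ?thesis by (simp add: power2_eq_square add_increasing2 mult.assoc)
    qed (simp add: add_increasing)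
    then have "(\<integral>\<^sup>+x. ennreal \<bar>V n x - V (Suc n) x\<bar> \<partial>M)
      \<le> (\<integral>\<^sup>+x. ennreal (2 ^ n * (V n x - V (Suc n) x)\<^sup>2 + (1/2) ^ n) \<partial>M)"
      by (intro nn_integral_mono ennreal_leI)
    also have "\<dots> = ennreal (2 ^ n * (\<integral>x. (V n x - V (Suc n) x)\<^sup>2 \<partial>M) + (1/2) ^ n * measure M (space M))"
      using int_sq by (subst nn_integral_eq_integral) (auto simp: mult.commute)
    also have "\<dots> \<le> ennreal (2 ^ n * (1/4) ^ n + (1/2) ^ n * measure M (space M))"
      by (intro ennreal_leI add_right_mono mult_left_mono Cauchy) auto
    also have "\<dots> = ennreal (B * (1/2) ^ n)"
      unfolding p by (simp add: B_def algebra_simps)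
    finally show ?thesis .
  qed
  have "(\<integral>\<^sup>+x. (\<Sum>n. ennreal \<bar>V n x - V (Suc n) x\<bar>) \<partial>M) = (\<Sum>n. \<integral>\<^sup>+x. ennreal \<bar>V n x - V (Suc n) x\<bar> \<partial>M)"
    by (rule nn_integral_suminf) auto
  also have "\<dots> \<le> (\<Sum>n. ennreal (B * (1/2) ^ n))"
    by (intro suminf_le abs_le) auto
  also have "\<dots> = ennreal (\<Sum>n. B * (1/2) ^ n)"
    by (intro suminf_ennreal2) (auto simp: B_def intro!: summable_mult summable_geometric)
  also have "\<dots> < \<infinity>" by simp
  finally have "AE x in M. (\<Sum>n. ennreal \<bar>V n x - V (Suc n) x\<bar>) \<noteq> \<infinity>"
    by (intro nn_integral_PInf_AE) auto
  then have conv: "AE x in M. (\<lambda>n. V n x) \<longlonglongrightarrow> lim (\<lambda>n. V n x)"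
  proof eventually_elim
    case (elim x)
    then have "summable (\<lambda>n. \<bar>V n x - V (Suc n) x\<bar>)"
      by (intro summable_suminf_not_top) auto
    then have "summable (\<lambda>n. V n x - V (Suc n) x)"
      by (rule summable_rabs_cancel)
    then have "convergent (\<lambda>n. \<Sum>i<n. V i x - V (Suc i) x)"
      by (simp add: summable_iff_convergent)
    then have "convergent (\<lambda>n. V 0 x - V n x)"
      by (subst (asm) sum_lessThan_telescope'[where f = "\<lambda>i. V i x"])
    from convergent_diff[OF convergent_const[of "V 0 x"] this]
    show ?case by (simp add: convergent_LIMSEQ_iff)
  qed
  define W where "W x = lim (\<lambda>n. V n x)" for x
  have [measurable]: "W \<in> borel_measurable M" unfolding W_def by measurable
  have le: "(\<integral>\<^sup>+x. ennreal ((V n x - W x)\<^sup>2) \<partial>M) \<le> ennreal ((1/4) ^ n)" for n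
  proof -
    \<comment> \<open>Fatou's lemma in \<open>m\<close> turns the Cauchy bound into a bound on the
      distance to the limit.\<close>
    have "(\<integral>\<^sup>+x. ennreal ((V n x - W x)\<^sup>2) \<partial>M) = (\<integral>\<^sup>+x. liminf (\<lambda>m. ennreal ((V n x - V m x)\<^sup>2)) \<partial>M)"
    proof (rule nn_integral_cong_AE)
      show "AE x in M. ennreal ((V n x - W x)\<^sup>2) = liminf (\<lambda>m. ennreal ((V n x - V m x)\<^sup>2))"
        using conv
      proof eventually_elim
        case (elim x)
        then have "(\<lambda>m. ennreal ((V n x - V m x)\<^sup>2)) \<longlonglongrightarrow> ennreal ((V n x - W x)\<^sup>2)"
          unfolding W_def by (intro tendsto_intros tendsto_ennrealI)
        from lim_imp_Liminf[OF sequentially_bot this] show ?case by simp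
      qed
    qed
    also have "\<dots> \<le> liminf (\<lambda>m. \<integral>\<^sup>+x. ennreal ((V n x - V m x)\<^sup>2) \<partial>M)"
      by (rule nn_integral_liminf) auto
    also have "\<dots> \<le> liminf (\<lambda>m. ennreal ((1/4) ^ n))"
    proof (rule Liminf_mono)
      show "\<forall>\<^sub>F m in sequentially. (\<integral>\<^sup>+x. ennreal ((V n x - V m x)\<^sup>2) \<partial>M) \<le> ennreal ((1/4) ^ n)"
        using eventually_ge_at_top[of n]
        by eventually_elim (use int_sq Cauchy in \<open>auto simp: nn_integral_eq_integral intro!: ennreal_leI\<close>)
    qed
    also have "\<dots> = ennreal ((1/4) ^ n)" by (simp add: Liminf_const)
    finally show ?thesis .
  qed
  have int: "integrable M (\<lambda>x. (V n x - W x)\<^sup>2)" for n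
  proof (rule integrableI_nonneg)
    show "(\<integral>\<^sup>+x. ennreal ((V n x - W x)\<^sup>2) \<partial>M) < \<infinity>"
      using le[of n] by (rule le_less_trans) simp
  qed auto
  have "(\<integral>x. (V n x - W x)\<^sup>2 \<partial>M) \<le> (1/4) ^ n" for n
    using le[of n] int[of n] by (simp add: nn_integral_eq_integral)
  moreover have "sq_integrable M (\<lambda>x. V 0 x - (V 0 x - W x))"
    by (rule sq_integrable_diff[OF V]) (use int in \<open>auto simp: sq_integrable_def\<close>)
  ultimately show ?thesis using conv by (auto simp: W_def)
qed

text \<open>The infima of the squared norm over the decreasing sets increase to a finite limit
  \<open>s\<close>, and the parallelogram identity, which involves midpoints only, makes
  near-minimisers Cauchy. The \<open>C n\<close> need not be closed, so \<open>W\<close> is not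
  claimed to belong to them.\<close>

lemma (in finite_measure) nested_convex_limit:
  fixes C :: "nat \<Rightarrow> ('a \<Rightarrow> real) set"
  assumes sq: "\<And>v n. v \<in> C n \<Longrightarrow> sq_integrable M v"
    and dec: "decseq C"
    and mid: "\<And>n u v. u \<in> C n \<Longrightarrow> v \<in> C n \<Longrightarrow> (\<lambda>x. (1/2) * u x + (1/2) * v x) \<in> C n"
    and bdd: "\<And>n. \<exists>v\<in>C n. (\<integral>x. (v x)\<^sup>2 \<partial>M) \<le> B"
  shows "\<exists>V W. (\<forall>n. V n \<in> C n) \<and> sq_integrable M W \<and> (AE x in M. (\<lambda>n. V n x) \<longlonglongrightarrow> W x) \<and>
    (\<forall>n. (\<integral>x. (V n x - W x)\<^sup>2 \<partial>M) \<le> (1/4) ^ n)"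
proof -
  define I where "I v = (\<integral>x. (v x)\<^sup>2 \<partial>M)" for v :: "'a \<Rightarrow> real"
  define i where "i n = Inf (I ` C n)" for n
  have ne: "C n \<noteq> {}" for n using bdd by blast
  have bb: "bdd_below (I ` C n)" for n by (intro bdd_belowI[of _ 0]) (auto simp: I_def)
  have i_le: "i n \<le> I v" if "v \<in> C n" for n v
    unfolding i_def using that bb by (auto intro: cInf_lower)
  have i_mono: "i n \<le> i m" if "n \<le> m" for n m
    unfolding i_def using decseqD[OF dec that] ne bb by (intro cInf_superset_mono) auto
  have i_B: "i n \<le> B" for n using bdd[of n] i_le[of _ n] by (force simp: I_def)
  define s where "s = (SUP n. i n)"
  have bdi: "bdd_above (range i)" using i_B by (auto intro: bdd_aboveI[where M = B])
  have i_s: "i n \<le> s" for n unfolding s_def by (intro cSUP_upper bdi) auto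
  \<comment> \<open>The parallelogram estimate below costs \<open>6 * d n + 2 * d m\<close>, which
    is at most \<open>8 * d n\<close> for \<open>n \<le> m\<close>; hence the 8.\<close>
  define d :: "nat \<Rightarrow> real" where "d n = (1/4) ^ n / 8" for n
  have d: "0 < d n" for n by (simp add: d_def)
  have "\<exists>N. s - d n < i N" for n
    using less_cSUP_iff[of UNIV i "s - d n"] bdi d[of n] by (simp add: s_def)
  then obtain N where N: "\<And>n. s - d n < i (N n)" by metis
  \<comment> \<open>An increasing index above both \<open>m\<close> and \<open>N m\<close>. Thus
    \<open>V m\<close> is in \<open>C (K n)\<close> whenever \<open>n \<le> m\<close>, and so is the
    midpoint of \<open>V n\<close> and \<open>V m\<close>.\<close>
  define K where "K m = m + (\<Sum>j\<le>m. N j)" for m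
  have K: "m \<le> K m" "N m \<le> K m" for m
    unfolding K_def using member_le_sum[of m "{..m}" N] by auto
  have K_mono: "K n \<le> K m" if "n \<le> m" for n m
    unfolding K_def using that by (intro add_mono sum_mono2) auto
  have "\<exists>v\<in>C (K n). I v < s + d n" for n
  proof -
    have "Inf (I ` C (K n)) < s + d n" using i_s[of "K n"] d[of n] by (simp add: i_def)
    then show ?thesis using cInf_lessD[of "I ` C (K n)"] ne by blast
  qed
  then obtain V where V: "\<And>n. V n \<in> C (K n)" "\<And>n. I (V n) < s + d n" by metis
  have VC: "V m \<in> C (K n)" if "n \<le> m" for n m
    using V(1)[of m] decseqD[OF dec K_mono[OF that]] by auto
  have Vsq: "sq_integrable M (V n)" for n using sq V(1) by blast
  have Cauchy: "(\<integral>x. (V n x - V m x)\<^sup>2 \<partial>M) \<le> (1/4) ^ n" if nm: "n \<le> m" for n m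
  proof -
    have "s - d n < i (K n)" using N[of n] i_mono[OF K(2)] by (rule less_le_trans)
    also have "\<dots> \<le> I (\<lambda>x. (1/2) * V n x + (1/2) * V m x)"
      by (intro i_le mid VC nm) simp
    also have "\<dots> = (1/4) * I (V n) + (1/4) * I (V m) + (1/2) * (\<integral>x. V n x * V m x \<partial>M)"
      unfolding I_def by (subst integral_sq_lincomb[OF Vsq Vsq]) (simp add: power2_eq_square)
    finally have 1: "s - d n < (1/4) * I (V n) + (1/4) * I (V m) + (1/2) * (\<integral>x. V n x * V m x \<partial>M)" .
    have 2: "(\<integral>x. (V n x - V m x)\<^sup>2 \<partial>M) = I (V n) + I (V m) - 2 * (\<integral>x. V n x * V m x \<partial>M)"
      using integral_sq_lincomb[OF Vsq[of n] Vsq[of m], of 1 "-1"] by (simp add: I_def)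
    have 3: "d m \<le> d n" unfolding d_def using nm by (simp add: power_decreasing)
    have "(\<integral>x. (V n x - V m x)\<^sup>2 \<partial>M) \<le> 8 * d n"
      using 1 2 3 V(2)[of n] V(2)[of m] by linarith
    then show ?thesis by (simp add: d_def)
  qed
  have "V n \<in> C n" for n using V(1)[of n] decseqD[OF dec K(1)] by auto
  then show ?thesis using L2_complete[OF Vsq Cauchy] by blast
qed

section \<open>Separation from a weak-star closed convex set\<close>

text \<open>The arguments have different roles: \<open>M\<close> supplies the null sets and
  \<open>H\<close> the measurability, so the bounded functions of every sub-sigma-algebra are
  functions on one measure space.\<close>

definition Linfty :: "'a measure \<Rightarrow> 'a measure \<Rightarrow> ('a \<Rightarrow> real) set"
  where "Linfty M H = {X \<in> borel_measurable H. \<exists>C. AE x in M. \<bar>X x\<bar> \<le> C}"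

lemma LinftyI: "X \<in> borel_measurable H \<Longrightarrow> AE x in M. \<bar>X x\<bar> \<le> C \<Longrightarrow> X \<in> Linfty M H"
  by (auto simp: Linfty_def)

lemma Linfty_measurable [measurable_dest]: "X \<in> Linfty M H \<Longrightarrow> X \<in> borel_measurable H"
  by (simp add: Linfty_def)

lemma Linfty_bounded:
  assumes "X \<in> Linfty M H"
  obtains C where "0 \<le> C" "AE x in M. \<bar>X x\<bar> \<le> C"
proof -
  obtain C where C: "AE x in M. \<bar>X x\<bar> \<le> C" using assms by (auto simp: Linfty_def)
  then have "AE x in M. \<bar>X x\<bar> \<le> max C 0" by eventually_elim auto
  then show ?thesis using that[of "max C 0"] by simp
qed

lemma Linfty_const: "(\<lambda>_. c) \<in> Linfty M H"
  by (rule LinftyI[where C = "\<bar>c\<bar>"]) auto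

lemma Linfty_lincomb:
  assumes "X \<in> Linfty M H" "Y \<in> Linfty M H"
  shows "(\<lambda>x. a * X x + b * Y x) \<in> Linfty M H"
proof -
  obtain C where C: "AE x in M. \<bar>X x\<bar> \<le> C" "0 \<le> C" using Linfty_bounded[OF assms(1)] by blast
  obtain D where D: "AE x in M. \<bar>Y x\<bar> \<le> D" "0 \<le> D" using Linfty_bounded[OF assms(2)] by blast
  show ?thesis
  proof (rule LinftyI)
    show "AE x in M. \<bar>a * X x + b * Y x\<bar> \<le> \<bar>a\<bar> * C + \<bar>b\<bar> * D"
      using C(1) D(1)
    proof eventually_elim
      case (elim x)
      have "\<bar>a * X x + b * Y x\<bar> \<le> \<bar>a\<bar> * \<bar>X x\<bar> + \<bar>b\<bar> * \<bar>Y x\<bar>"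
        by (rule order_trans[OF abs_triangle_ineq]) (simp add: abs_mult)
      also have "\<dots> \<le> \<bar>a\<bar> * C + \<bar>b\<bar> * D" using elim by (intro add_mono mult_left_mono) auto
      finally show ?case .
    qed
  qed (use assms in measurable)
qed

lemma Linfty_add: "X \<in> Linfty M H \<Longrightarrow> Y \<in> Linfty M H \<Longrightarrow> (\<lambda>x. X x + Y x) \<in> Linfty M H"
  using Linfty_lincomb[of X M H Y 1 1] by simp

lemma Linfty_diff: "X \<in> Linfty M H \<Longrightarrow> Y \<in> Linfty M H \<Longrightarrow> (\<lambda>x. X x - Y x) \<in> Linfty M H"
  using Linfty_lincomb[of X M H Y 1 "-1"] by simp

lemma Linfty_minus: "X \<in> Linfty M H \<Longrightarrow> (\<lambda>x. - X x) \<in> Linfty M H"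
  using Linfty_lincomb[of X M H X "-1" 0] by simp

lemma Linfty_max:
  assumes "X \<in> Linfty M H" "Y \<in> Linfty M H"
  shows "(\<lambda>x. max (X x) (Y x)) \<in> Linfty M H"
proof -
  obtain C where C: "AE x in M. \<bar>X x\<bar> \<le> C" using Linfty_bounded[OF assms(1)] by blast
  obtain D where D: "AE x in M. \<bar>Y x\<bar> \<le> D" using Linfty_bounded[OF assms(2)] by blast
  show ?thesis
  proof (rule LinftyI)
    show "AE x in M. \<bar>max (X x) (Y x)\<bar> \<le> max C D"
      using C D by eventually_elim auto
  qed (use assms in measurable)
qed

lemma integrable_mult_Linfty:
  fixes f :: "'a \<Rightarrow> real"
  assumes f: "integrable M f" and V: "V \<in> Linfty M M"
  shows "integrable M (\<lambda>x. f x * V x)"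
proof -
  obtain C where C: "0 \<le> C" "AE x in M. \<bar>V x\<bar> \<le> C" using Linfty_bounded[OF V] by blast
  show ?thesis
  proof (rule Bochner_Integration.integrable_bound)
    show "integrable M (\<lambda>x. C * f x)" using f by simp
    show "(\<lambda>x. f x * V x) \<in> borel_measurable M" using f V by measurable
    show "AE x in M. norm (f x * V x) \<le> norm (C * f x)"
      using C(2) by eventually_elim (use C(1) in \<open>auto simp: abs_mult mult.commute[of "\<bar>f _\<bar>"] intro: mult_right_mono\<close>)
  qed
qed

lemma (in finite_measure) integrable_Linfty: "V \<in> Linfty M M \<Longrightarrow> integrable M V"
  using integrable_mult_Linfty[of M "\<lambda>_. 1" V] by simp

lemma (in finite_measure) sq_integrable_Linfty:
  assumes "V \<in> Linfty M M" shows "sq_integrable M V"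
  using integrable_mult_Linfty[OF integrable_Linfty[OF assms] assms] assms
  by (auto simp: sq_integrable_def power2_eq_square)

text \<open>Later \<open>S\<close> consists of the \<open>V\<close> for which \<open>X + V\<close>
  is acceptable. \<open>S_closed\<close> is the form of weak-star closedness that continuity from
  above delivers.\<close>

locale bounded_upset = prob_space M for M :: "'a measure" +
  fixes S :: "('a \<Rightarrow> real) set"
  assumes S_Linfty: "S \<subseteq> Linfty M M"
    and S_convex: "\<And>u v t. u \<in> S \<Longrightarrow> v \<in> S \<Longrightarrow> 0 \<le> t \<Longrightarrow> t \<le> 1 \<Longrightarrow> (\<lambda>x. (1 - t) * u x + t * v x) \<in> S"
    and S_up: "\<And>u v. u \<in> S \<Longrightarrow> v \<in> Linfty M M \<Longrightarrow> AE x in M. u x \<le> v x \<Longrightarrow> v \<in> S"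
    and S_closed: "\<And>V W C. (\<And>n. V n \<in> S) \<Longrightarrow> (\<And>n. AE x in M. \<bar>V n x\<bar> \<le> C) \<Longrightarrow>
      W \<in> borel_measurable M \<Longrightarrow> AE x in M. (\<lambda>n::nat. V n x) \<longlonglongrightarrow> W x \<Longrightarrow> W \<in> S"
    and zero_notin_S: "(\<lambda>_. 0) \<notin> S"
begin

text \<open>This gives the level \<open>k\<close> at which the doubling in
  \<open>separate_nonneg\<close> starts: an upset that misses the constant \<open>k\<close> has no
  element below \<open>k\<close>.\<close>

lemma small_const_notin: "\<exists>k>0. (\<lambda>_. k) \<notin> S"
proof (rule ccontr)
  assume *: "\<not> ?thesis"
  have "(\<lambda>_. 0) \<in> S"
  proof (rule S_closed)
    show "(\<lambda>_. 1 / real (Suc n)) \<in> S" for n using * by simp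
    show "AE x in M. \<bar>1 / real (Suc n)\<bar> \<le> 1" for n by simp
    show "AE x in M. (\<lambda>n. 1 / real (Suc n)) \<longlonglongrightarrow> 0"
      using LIMSEQ_Suc[OF lim_1_over_n] by simp
  qed simp
  then show False using zero_notin_S by simp
qed

text \<open>
  The functions \<open>V \<in> S\<close> with \<open>V \<le> 2 * k\<close> that are not yet separated from \<open>0\<close> by \<open>f\<close> form a closed
  convex set that does not meet \<open>{V. V \<le> k}\<close>. The shortest excess \<open>max 0 (V - k)\<close> then separates them
  from \<open>{V. V \<le> k}\<close>, at the price of an increment of \<open>L\<^sup>1\<close>-norm only \<open>1 / k\<close>.
\<close>

lemma separate_step:
  assumes f: "integrable M f" "\<And>x. 0 \<le> f x" and k: "0 < k"
    and sep: "\<And>V. V \<in> S \<Longrightarrow> AE x in M. 0 \<le> V x \<and> V x \<le> k \<Longrightarrow> 1 < (\<integral>x. f x * V x \<partial>M)"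
  shows "\<exists>g. integrable M g \<and> (\<forall>x. 0 \<le> g x) \<and> (\<integral>x. g x \<partial>M) \<le> 1 / k \<and>
    (\<forall>V\<in>S. (AE x in M. 0 \<le> V x \<and> V x \<le> 2 * k) \<longrightarrow> 1 < (\<integral>x. (f x + g x) * V x \<partial>M))"
proof -
  define C where "C = {V\<in>S. (AE x in M. 0 \<le> V x \<and> V x \<le> 2 * k) \<and> (\<integral>x. f x * V x \<partial>M) \<le> 1}"
  have CL: "V \<in> Linfty M M" if "V \<in> C" for V using that S_Linfty by (auto simp: C_def)
  have fV: "integrable M (\<lambda>x. f x * V x)" if "V \<in> Linfty M M" for V
    by (rule integrable_mult_Linfty[OF f(1) that])
  show ?thesis
  proof (cases "C = {}")
    case True
    have "1 < (\<integral>x. (f x + 0) * V x \<partial>M)" if "V \<in> S" "AE x in M. 0 \<le> V x \<and> V x \<le> 2 * k" for V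
      using True that by (auto simp: C_def)
    then show ?thesis using k by (intro exI[of _ "\<lambda>_. 0"]) simp
  next
    case False
    \<comment> \<open>\<open>J\<close> vanishes exactly on the \<open>V\<close> with
      \<open>V \<le> k\<close> almost surely. The square makes it differentiable, so that its
      minimiser yields a linear functional.\<close>
    define h where "h V = (\<lambda>x. max 0 (V x - k))" for V :: "'a \<Rightarrow> real"
    define J where "J V = (\<integral>x. (h V x)\<^sup>2 \<partial>M)" for V
    have hL: "h V \<in> Linfty M M" if "V \<in> Linfty M M" for V
      unfolding h_def using that by (intro Linfty_max Linfty_diff Linfty_const)
    have hsq: "integrable M (\<lambda>x. (h V x)\<^sup>2)" if "V \<in> Linfty M M" for V
      using sq_integrable_Linfty[OF hL[OF that]] by (simp add: sq_integrable_def)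
    have C_convex: "(\<lambda>x. (1 - t) * u x + t * v x) \<in> C" if uv: "u \<in> C" "v \<in> C" and t: "0 \<le> t" "t \<le> 1" for u v t
    proof -
      have "AE x in M. 0 \<le> u x \<and> u x \<le> 2 * k" "AE x in M. 0 \<le> v x \<and> v x \<le> 2 * k"
        using uv by (auto simp: C_def)
      then have "AE x in M. 0 \<le> (1 - t) * u x + t * v x \<and> (1 - t) * u x + t * v x \<le> 2 * k"
      proof eventually_elim
        case (elim x)
        have "(1 - t) * u x + t * v x \<le> (1 - t) * (2 * k) + t * (2 * k)"
          using elim t by (intro add_mono mult_left_mono) auto
        moreover have "0 \<le> (1 - t) * u x + t * v x"
          using elim t by (intro add_nonneg_nonneg mult_nonneg_nonneg) auto
        ultimately show ?case by (simp add: algebra_simps)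
      qed
      moreover have "(\<integral>x. f x * ((1 - t) * u x + t * v x) \<partial>M) = (1 - t) * (\<integral>x. f x * u x \<partial>M) + t * (\<integral>x. f x * v x \<partial>M)"
        using fV[OF CL[OF uv(1)]] fV[OF CL[OF uv(2)]]
        by (simp add: distrib_left mult.left_commute[of "f _"])
      moreover have "\<dots> \<le> (1 - t) * 1 + t * 1"
        using uv t by (intro add_mono mult_left_mono) (auto simp: C_def)
      ultimately show ?thesis using S_convex[of u v t] uv t by (simp add: C_def)
    qed
    have J_convex: "J (\<lambda>x. (1/2) * u x + (1/2) * v x) \<le> (1/2) * J u + (1/2) * J v"
      if uv: "u \<in> C" "v \<in> C" for u v
    proof -
      have *: "(max 0 ((1/2) * a + (1/2) * b - k))\<^sup>2 \<le> (1/2) * (max 0 (a - k))\<^sup>2 + (1/2) * (max 0 (b - k))\<^sup>2" for a b :: real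
      proof -
        have "max 0 ((1/2) * a + (1/2) * b - k) \<le> (1/2) * max 0 (a - k) + (1/2) * max 0 (b - k)"
          by (simp add: max_def field_simps)
        then have "(max 0 ((1/2) * a + (1/2) * b - k))\<^sup>2 \<le> ((1/2) * max 0 (a - k) + (1/2) * max 0 (b - k))\<^sup>2"
          by (intro power_mono) auto
        also have "\<dots> \<le> (1/2) * (max 0 (a - k))\<^sup>2 + (1/2) * (max 0 (b - k))\<^sup>2"
          using zero_le_power2[of "max 0 (a - k) - max 0 (b - k)"] by (simp add: power2_eq_square algebra_simps)
        finally show ?thesis .
      qed
      have "J (\<lambda>x. (1/2) * u x + (1/2) * v x) \<le> (\<integral>x. (1/2) * (h u x)\<^sup>2 + (1/2) * (h v x)\<^sup>2 \<partial>M)"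
        unfolding J_def
      proof (intro integral_mono hsq Linfty_lincomb CL uv)
        show "integrable M (\<lambda>x. (1/2) * (h u x)\<^sup>2 + (1/2) * (h v x)\<^sup>2)"
          using hsq[OF CL] uv by simp
      qed (unfold h_def, rule *)
      also have "\<dots> = (1/2) * J u + (1/2) * J v"
        using hsq[OF CL] uv by (simp add: J_def)
      finally show ?thesis .
    qed
    define d where "d = Inf (J ` C)"
    have d_le: "d \<le> J V" if "V \<in> C" for V
      unfolding d_def using that by (intro cInf_lower bdd_belowI[of _ 0]) (auto simp: J_def)
    \<comment> \<open>\<open>J\<close> is not strictly convex, so a minimising sequence for it need
      not converge. Elements of nearly least L^2-norm in its sublevel sets do.\<close>
    define Cn where "Cn n = {V\<in>C. J V \<le> d + 1 / real (Suc n)}" for n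
    have "\<exists>V W. (\<forall>n. V n \<in> Cn n) \<and> sq_integrable M W \<and> (AE x in M. (\<lambda>n. V n x) \<longlonglongrightarrow> W x) \<and>
      (\<forall>n. (\<integral>x. (V n x - W x)\<^sup>2 \<partial>M) \<le> (1/4) ^ n)"
    proof (rule nested_convex_limit[where B = "(2 * k)\<^sup>2"])
      show "sq_integrable M v" if "v \<in> Cn n" for v n
        using that by (intro sq_integrable_Linfty CL) (simp add: Cn_def)
      show "decseq Cn"
        unfolding decseq_def Cn_def by (auto elim!: order_trans simp: frac_le)
      show "(\<lambda>x. (1/2) * u x + (1/2) * v x) \<in> Cn n" if "u \<in> Cn n" "v \<in> Cn n" for u v n
        using that J_convex[of u v] C_convex[of u v "1/2"] by (auto simp: Cn_def)
      show "\<exists>v\<in>Cn n. (\<integral>x. (v x)\<^sup>2 \<partial>M) \<le> (2 * k)\<^sup>2" for n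
      proof -
        have "\<exists>a\<in>J ` C. a < d + 1 / real (Suc n)"
          using cInf_lessD[of "J ` C" "d + 1 / real (Suc n)"] False by (auto simp: d_def)
        then obtain v where v: "v \<in> C" "J v < d + 1 / real (Suc n)" by blast
        have "(\<integral>x. (v x)\<^sup>2 \<partial>M) \<le> (\<integral>x. (2 * k)\<^sup>2 \<partial>M)"
        proof (rule integral_mono_AE)
          show "integrable M (\<lambda>x. (v x)\<^sup>2)"
            using sq_integrable_Linfty[OF CL[OF v(1)]] by (simp add: sq_integrable_def)
          have "AE x in M. 0 \<le> v x \<and> v x \<le> 2 * k" using v(1) by (simp add: C_def)
          then show "AE x in M. (v x)\<^sup>2 \<le> (2 * k)\<^sup>2"
            by eventually_elim (intro power_mono, auto)
        qed simp
        then show ?thesis using v by (auto simp: Cn_def prob_space)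
      qed
    qed
    then obtain V W where V: "\<And>n. V n \<in> Cn n" and W: "sq_integrable M W"
      and lim: "AE x in M. (\<lambda>n. V n x) \<longlonglongrightarrow> W x" by blast
    have VC: "V n \<in> C" for n using V by (simp add: Cn_def)
    note [measurable] = sq_integrable_measurable[OF W]
    have [measurable]: "V n \<in> borel_measurable M" for n using CL[OF VC] by measurable
    have [measurable]: "f \<in> borel_measurable M" using f by measurable
    have Vb: "AE x in M. \<forall>n. 0 \<le> V n x \<and> V n x \<le> 2 * k"
      using VC by (simp add: C_def AE_all_countable)
    have Wb: "AE x in M. 0 \<le> W x \<and> W x \<le> 2 * k"
      using Vb lim by eventually_elim (auto intro: LIMSEQ_le_const LIMSEQ_le_const2)
    \<comment> \<open>Here the cap \<open>2 * k\<close> in \<open>C\<close> is essential: it makes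
      the sequence uniformly bounded, as \<open>S_closed\<close> demands. It also dominates the two
      integrals below, so \<open>W\<close> attains the infimum of \<open>J\<close> on
      \<open>C\<close>.\<close>
    have "W \<in> S"
    proof (rule S_closed[OF _ _ _ lim])
      show "V n \<in> S" for n using VC by (simp add: C_def)
      show "AE x in M. \<bar>V n x\<bar> \<le> 2 * k" for n using Vb by eventually_elim auto
    qed simp
    have "(\<lambda>n. \<integral>x. f x * V n x \<partial>M) \<longlonglongrightarrow> (\<integral>x. f x * W x \<partial>M)"
    proof (rule integral_dominated_convergence)
      show "integrable M (\<lambda>x. (2 * k) * f x)" using f by simp
      show "AE x in M. (\<lambda>n. f x * V n x) \<longlonglongrightarrow> f x * W x"
        using lim by eventually_elim (intro tendsto_intros)
      show "AE x in M. norm (f x * V n x) \<le> (2 * k) * f x" for n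
        using Vb by eventually_elim (use f(2) in \<open>auto simp: abs_mult mult.commute[of "f _"] intro: mult_right_mono\<close>)
    qed auto
    moreover have "(\<integral>x. f x * V n x \<partial>M) \<le> 1" for n using VC by (simp add: C_def)
    ultimately have "(\<integral>x. f x * W x \<partial>M) \<le> 1" by (auto intro: LIMSEQ_le_const2)
    with \<open>W \<in> S\<close> Wb have WC: "W \<in> C" by (simp add: C_def)
    have "(\<lambda>n. J (V n)) \<longlonglongrightarrow> J W"
      unfolding J_def
    proof (rule integral_dominated_convergence)
      show "integrable M (\<lambda>x. (2 * k)\<^sup>2)" by simp
      show "AE x in M. (\<lambda>n. (h (V n) x)\<^sup>2) \<longlonglongrightarrow> (h W x)\<^sup>2"
        using lim unfolding h_def by eventually_elim (intro tendsto_intros)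
      show "AE x in M. norm ((h (V n) x)\<^sup>2) \<le> (2 * k)\<^sup>2" for n
        using Vb unfolding h_def
      proof eventually_elim
        case (elim x)
        then have "0 \<le> V n x" "V n x \<le> 2 * k" by auto
        with k have "(max 0 (V n x - k))\<^sup>2 \<le> (2 * k)\<^sup>2" by (intro power_mono) auto
        then show ?case by simp
      qed
    qed (auto simp: h_def)
    then have JW: "J W \<le> d + 0"
    proof (rule LIMSEQ_le)
      show "(\<lambda>n. d + 1 / real (Suc n)) \<longlonglongrightarrow> d + 0"
        by (intro tendsto_intros LIMSEQ_Suc[OF lim_1_over_n])
      show "\<exists>N. \<forall>n\<ge>N. J (V n) \<le> d + 1 / real (Suc n)" using V by (simp add: Cn_def)
    qed
    define G where "G = h W"
    have GL: "G \<in> Linfty M M" unfolding G_def by (rule hL[OF CL[OF WC]])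
    have G0: "0 \<le> G x" for x by (simp add: G_def h_def)
    have [measurable]: "G \<in> borel_measurable M" using GL by measurable
    \<comment> \<open>The excess is not linear, but by convexity of the positive part the excess at
      \<open>(1 - t) * W + t * U\<close> is at most the absolute value of
      \<open>(1 - t) * G + t * (U - k)\<close>. Hence \<open>G\<close> is shortest on the segment
      towards \<open>U - k\<close>, although \<open>U - k\<close> can be negative.\<close>
    have key: "(\<integral>x. (G x)\<^sup>2 \<partial>M) \<le> (\<integral>x. G x * (U x - k) \<partial>M)" if U: "U \<in> C" for U
    proof (rule first_order_condition)
      show "sq_integrable M G" by (rule sq_integrable_Linfty[OF GL])
      show Uk: "sq_integrable M (\<lambda>x. U x - k)"
        by (intro sq_integrable_Linfty Linfty_diff Linfty_const CL U)
      fix t :: real assume t: "0 < t" "t < 1"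
      have C: "(\<lambda>x. (1 - t) * W x + t * U x) \<in> C" using t by (intro C_convex WC U) auto
      have "(\<integral>x. (G x)\<^sup>2 \<partial>M) \<le> J (\<lambda>x. (1 - t) * W x + t * U x)"
        using JW d_le[OF C] by (simp add: J_def G_def)
      also have "\<dots> \<le> (\<integral>x. ((1 - t) * G x + t * (U x - k))\<^sup>2 \<partial>M)"
        unfolding J_def
      proof (rule integral_mono)
        show "integrable M (\<lambda>x. ((1 - t) * G x + t * (U x - k))\<^sup>2)"
          using sq_integrable_lincomb[OF sq_integrable_Linfty[OF GL] Uk] by (simp add: sq_integrable_def)
        show "integrable M (\<lambda>x. (h (\<lambda>x. (1 - t) * W x + t * U x) x)\<^sup>2)" by (rule hsq[OF CL[OF C]])
        fix x
        have "(1 - t) * (W x - k) \<le> (1 - t) * G x"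
          using t by (intro mult_left_mono) (auto simp: G_def h_def)
        then have "(1 - t) * W x + t * U x - k \<le> (1 - t) * G x + t * (U x - k)"
          by (simp add: algebra_simps)
        then have "max 0 ((1 - t) * W x + t * U x - k) \<le> \<bar>(1 - t) * G x + t * (U x - k)\<bar>" by auto
        then have "(max 0 ((1 - t) * W x + t * U x - k))\<^sup>2 \<le> \<bar>(1 - t) * G x + t * (U x - k)\<bar>\<^sup>2"
          by (intro power_mono) auto
        then show "(h (\<lambda>x. (1 - t) * W x + t * U x) x)\<^sup>2 \<le> ((1 - t) * G x + t * (U x - k))\<^sup>2"
          by (simp add: h_def)
      qed
      finally show "(\<integral>x. (G x)\<^sup>2 \<partial>M) \<le> (\<integral>x. ((1 - t) * G x + t * (U x - k))\<^sup>2 \<partial>M)" .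
    qed
    \<comment> \<open>Otherwise \<open>W \<le> k\<close> almost surely; such functions are already
      separated by \<open>f\<close>, so \<open>W\<close> would not be in \<open>C\<close>.\<close>
    have Gnz: "\<not> (AE x in M. G x = 0)"
    proof
      assume "AE x in M. G x = 0"
      with Wb have "AE x in M. 0 \<le> W x \<and> W x \<le> k" by eventually_elim (auto simp: G_def h_def max_def split: if_splits)
      then have "1 < (\<integral>x. f x * W x \<partial>M)" by (rule sep[OF \<open>W \<in> S\<close>])
      then show False using WC by (simp add: C_def)
    qed
    have Gint: "integrable M G" by (rule integrable_Linfty[OF GL])
    have G2: "0 < (\<integral>x. (G x)\<^sup>2 \<partial>M)"
    proof -
      have "(\<integral>x. (G x)\<^sup>2 \<partial>M) \<noteq> 0"
        using Gnz hsq[OF CL[OF WC]] by (subst integral_nonneg_eq_0_iff_AE) (auto simp: G_def)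
      then show ?thesis by (simp add: less_le)
    qed
    have G1: "0 < (\<integral>x. G x \<partial>M)"
    proof -
      have "(\<integral>x. G x \<partial>M) \<noteq> 0"
        using Gnz Gint G0 by (subst integral_nonneg_eq_0_iff_AE) auto
      then show ?thesis using G0 by (simp add: less_le integral_nonneg)
    qed
    \<comment> \<open>With this normalisation \<open>g = G / c\<close> has integral exactly
      \<open>1 / k\<close>, while \<open>key\<close> gives \<integral> G U > k \<integral> G, that
      is, \<integral> g U > 1.\<close>
    define c where "c = k * (\<integral>x. G x \<partial>M)"
    have c: "0 < c" using k G1 by (simp add: c_def)
    define g where "g x = G x / c" for x
    have gint: "integrable M g" unfolding g_def using Gint by simp
    have g0: "0 \<le> g x" for x using G0 c by (simp add: g_def)
    have "1 < (\<integral>x. (f x + g x) * U x \<partial>M)" if U: "U \<in> S" "AE x in M. 0 \<le> U x \<and> U x \<le> 2 * k" for U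
    proof -
      have UL: "U \<in> Linfty M M" using U S_Linfty by auto
      have eq: "(\<integral>x. (f x + g x) * U x \<partial>M) = (\<integral>x. f x * U x \<partial>M) + (\<integral>x. g x * U x \<partial>M)"
        using fV[OF UL] integrable_mult_Linfty[OF gint UL] by (simp add: distrib_right)
      show ?thesis
      proof (cases "U \<in> C")
        case False
        then have "1 < (\<integral>x. f x * U x \<partial>M)" using U by (auto simp: C_def)
        moreover have "0 \<le> (\<integral>x. g x * U x \<partial>M)"
          using U(2) g0 by (intro integral_nonneg_AE) (auto elim: eventually_mono)
        ultimately show ?thesis by (simp add: eq)
      next
        case True
        have "c < (\<integral>x. (G x)\<^sup>2 \<partial>M) + c" using G2 by simp
        also have "\<dots> \<le> (\<integral>x. G x * (U x - k) \<partial>M) + c" using key[OF True] by simp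
        also have "(\<integral>x. G x * (U x - k) \<partial>M) = (\<integral>x. G x * U x \<partial>M) - (\<integral>x. G x \<partial>M) * k"
          using integrable_mult_Linfty[OF Gint UL] Gint by (simp add: right_diff_distrib)
        finally have "c < (\<integral>x. G x * U x \<partial>M)" by (simp add: c_def mult.commute)
        then have "1 < (\<integral>x. g x * U x \<partial>M)" using c by (simp add: g_def)
        moreover have "0 \<le> (\<integral>x. f x * U x \<partial>M)"
          using U(2) f(2) by (intro integral_nonneg_AE) (auto elim: eventually_mono)
        ultimately show ?thesis by (simp add: eq)
      qed
    qed
    moreover have "(\<integral>x. g x \<partial>M) \<le> 1 / k"
      using k G1 by (simp add: g_def c_def)
    ultimately show ?thesis using gint g0 by blast
  qed
qed

lemma separate_nonneg:
  "\<exists>f. integrable M f \<and> (\<forall>x. 0 \<le> f x) \<and> (\<forall>V\<in>S. (AE x in M. 0 \<le> V x) \<longrightarrow> 1 < (\<integral>x. f x * V x \<partial>M))"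
proof -
  obtain k where k: "0 < k" "(\<lambda>_. k) \<notin> S" using small_const_notin by blast
  \<comment> \<open>\<open>(2 - 2 / 2 ^ n) / k\<close> is the sum of \<open>1 / (k * 2 ^ i)\<close>
    over \<open>i < n\<close>, the total norm of the corrections so far.\<close>
  define Inv where "Inv n f \<longleftrightarrow> integrable M f \<and> (\<forall>x. 0 \<le> f x) \<and> (\<integral>x. f x \<partial>M) \<le> (2 - 2 / 2 ^ n) / k \<and>
    (\<forall>V\<in>S. (AE x in M. 0 \<le> V x \<and> V x \<le> k * 2 ^ n) \<longrightarrow> 1 < (\<integral>x. f x * V x \<partial>M))"
    for n :: nat and f :: "'a \<Rightarrow> real"
  have "\<exists>f. \<forall>n. Inv n (f n) \<and> (\<forall>x. f n x \<le> f (Suc n) x)"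
  proof (rule dependent_nat_choice)
    \<comment> \<open>At \<open>n = 0\<close> there is nothing to separate, so the zero function
      starts the recursion.\<close>
    have "V \<notin> S" if "AE x in M. 0 \<le> V x \<and> V x \<le> k" for V
    proof
      assume "V \<in> S"
      then have "(\<lambda>_. k) \<in> S" by (rule S_up[OF _ Linfty_const]) (use that in \<open>auto elim: eventually_mono\<close>)
      then show False using k by simp
    qed
    then show "\<exists>f. Inv 0 f" by (intro exI[of _ "\<lambda>_. 0"]) (auto simp: Inv_def)
  next
    fix f n assume f: "Inv n f"
    have "\<exists>g. integrable M g \<and> (\<forall>x. 0 \<le> g x) \<and> (\<integral>x. g x \<partial>M) \<le> 1 / (k * 2 ^ n) \<and>
      (\<forall>V\<in>S. (AE x in M. 0 \<le> V x \<and> V x \<le> 2 * (k * 2 ^ n)) \<longrightarrow> 1 < (\<integral>x. (f x + g x) * V x \<partial>M))"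
      by (rule separate_step) (use f k in \<open>auto simp: Inv_def\<close>)
    then obtain g where g: "integrable M g" "\<And>x. 0 \<le> g x" "(\<integral>x. g x \<partial>M) \<le> 1 / (k * 2 ^ n)"
      "\<And>V. V \<in> S \<Longrightarrow> AE x in M. 0 \<le> V x \<and> V x \<le> 2 * (k * 2 ^ n) \<Longrightarrow> 1 < (\<integral>x. (f x + g x) * V x \<partial>M)"
      by blast
    have "(\<integral>x. f x + g x \<partial>M) \<le> (2 - 2 / 2 ^ n) / k + 1 / (k * 2 ^ n)"
      using f g by (simp add: Inv_def)
    also have "\<dots> = (2 - 2 / 2 ^ Suc n) / k" using k by (simp add: field_simps)
    finally have "Inv (Suc n) (\<lambda>x. f x + g x)"
      using f g by (auto simp: Inv_def mult.left_commute)
    then show "\<exists>f'. Inv (Suc n) f' \<and> (\<forall>x. f x \<le> f' x)"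
      using g by (intro exI[of _ "\<lambda>x. f x + g x"]) auto
  qed
  then obtain f where f: "\<And>n. Inv n (f n)" and mono: "\<And>n x. f n x \<le> f (Suc n) x" by blast
  have fint: "integrable M (f n)" and f0: "0 \<le> f n x" for n x using f by (auto simp: Inv_def)
  have [measurable]: "f n \<in> borel_measurable M" for n using fint by measurable
  \<comment> \<open>The supremum is taken in \<open>ennreal\<close>: only the uniform bound
    \<open>2 / k\<close> on the integrals shows that it is finite almost everywhere.\<close>
  define F where "F x = (SUP n. ennreal (f n x))" for x
  have [measurable]: "F \<in> borel_measurable M" unfolding F_def by measurable
  have "(\<integral>\<^sup>+x. F x \<partial>M) = (SUP n. \<integral>\<^sup>+x. ennreal (f n x) \<partial>M)"
    unfolding F_def by (rule nn_integral_monotone_convergence_SUP) (auto simp: incseq_Suc_iff le_fun_def mono ennreal_leI)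
  also have "\<dots> \<le> ennreal (2 / k)"
  proof (rule SUP_least)
    fix n
    have "(\<integral>x. f n x \<partial>M) \<le> (2 - 2 / 2 ^ n) / k" using f by (simp add: Inv_def)
    also have "\<dots> \<le> 2 / k" using k by (intro divide_right_mono) auto
    finally show "(\<integral>\<^sup>+x. ennreal (f n x) \<partial>M) \<le> ennreal (2 / k)"
      using fint f0 by (subst nn_integral_eq_integral) (auto intro: ennreal_leI)
  qed
  finally have F_fin: "(\<integral>\<^sup>+x. F x \<partial>M) < \<infinity>" by (rule le_less_trans) simp
  define f' where "f' x = enn2real (F x)" for x
  have [measurable]: "f' \<in> borel_measurable M" unfolding f'_def by measurable
  have "AE x in M. F x \<noteq> \<infinity>" using F_fin by (intro nn_integral_PInf_AE) auto
  then have F_eq: "AE x in M. F x = ennreal (f' x)"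
    by eventually_elim (simp add: f'_def less_top)
  have f'int: "integrable M f'"
  proof (rule integrableI_nonneg)
    have "(\<integral>\<^sup>+x. ennreal (f' x) \<partial>M) = (\<integral>\<^sup>+x. F x \<partial>M)"
      using F_eq by (intro nn_integral_cong_AE) (auto elim: eventually_mono)
    then show "(\<integral>\<^sup>+x. ennreal (f' x) \<partial>M) < \<infinity>" using F_fin by simp
  qed (auto simp: f'_def)
  have f_le: "AE x in M. f n x \<le> f' x" for n
    using F_eq
  proof eventually_elim
    case (elim x)
    have "ennreal (f n x) \<le> F x" unfolding F_def by (rule SUP_upper) simp
    then have "ennreal (f n x) \<le> ennreal (f' x)" using elim by simp
    then show ?case by (subst (asm) ennreal_le_iff) (simp_all add: f'_def)
  qed
  have "1 < (\<integral>x. f' x * V x \<partial>M)" if V: "V \<in> S" "AE x in M. 0 \<le> V x" for V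
  proof -
    have VL: "V \<in> Linfty M M" using V S_Linfty by auto
    obtain C where C: "AE x in M. \<bar>V x\<bar> \<le> C" using Linfty_bounded[OF VL] by blast
    \<comment> \<open>Since \<open>V\<close> is bounded, one stage \<open>n\<close> already
      separates it; since \<open>V\<close> is nonnegative, passing from \<open>f n\<close> to the
      larger \<open>f'\<close> keeps the inequality.\<close>
    obtain n where "C / k < 2 ^ n" using real_arch_pow[of 2 "C / k"] by auto
    then have "C \<le> k * 2 ^ n" using k by (simp add: field_simps)
    then have "AE x in M. 0 \<le> V x \<and> V x \<le> k * 2 ^ n"
      using C V(2) by (auto elim: AE_mp)
    then have "1 < (\<integral>x. f n x * V x \<partial>M)" using f[of n] V(1) by (simp add: Inv_def)
    also have "\<dots> \<le> (\<integral>x. f' x * V x \<partial>M)"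
    proof (rule integral_mono_AE)
      show "AE x in M. f n x * V x \<le> f' x * V x"
        using f_le[of n] V(2) by eventually_elim (rule mult_right_mono)
    qed (intro integrable_mult_Linfty fint f'int VL)+
    finally show ?thesis .
  qed
  then show ?thesis using f'int by (intro exI[of _ f']) (auto simp: f'_def)
qed

text \<open>The weight \<open>f\<close> makes the norms in L^2(N) bounded below on all of
  \<open>S\<close>: the positive part of \<open>V\<close> is again in \<open>S\<close>, so its
  integral against \<open>f\<close> exceeds 1, and a linear function is at most a multiple of the
  square plus a constant.\<close>

lemma separation:
  assumes ne: "S \<noteq> {}"
  shows "\<exists>Z \<delta>. integrable M Z \<and> (\<forall>x. 0 \<le> Z x) \<and> 0 < \<delta> \<and> (\<forall>V\<in>S. \<delta> \<le> (\<integral>x. Z x * V x \<partial>M))"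
proof -
  obtain f where f: "integrable M f" "\<And>x. 0 \<le> f x"
    and sep: "\<And>V. V \<in> S \<Longrightarrow> AE x in M. 0 \<le> V x \<Longrightarrow> 1 < (\<integral>x. f x * V x \<partial>M)"
    using separate_nonneg by blast
  have fm [measurable]: "f \<in> borel_measurable M" using f by measurable
  define N where "N = density M (\<lambda>x. ennreal (f x))"
  have sets_N [measurable_cong]: "sets N = sets M" by (simp add: N_def)
  interpret N: finite_measure N
  proof
    have "emeasure N (space N) = (\<integral>\<^sup>+x. ennreal (f x) \<partial>M)"
      unfolding N_def by (subst emeasure_density) (auto intro!: nn_integral_cong)
    then show "emeasure N (space N) \<noteq> \<infinity>"
      using f by (simp add: nn_integral_eq_integral)
  qed
  have AE_N: "AE x in N. Q x" if "AE x in M. Q x" for Q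
    using that unfolding N_def by (subst AE_density) (auto elim: eventually_mono)
  have Linfty_N: "V \<in> Linfty N N" if V: "V \<in> Linfty M M" for V
  proof -
    obtain C where "AE x in M. \<bar>V x\<bar> \<le> C" using Linfty_bounded[OF V] by blast
    moreover have "V \<in> borel_measurable N"
      using V by (simp add: Linfty_def measurable_cong_sets[OF sets_N refl])
    ultimately show ?thesis by (intro LinftyI[where C = C] AE_N)
  qed
  have SN: "sq_integrable N V" if "V \<in> S" for V
    using that S_Linfty by (intro N.sq_integrable_Linfty Linfty_N) auto
  have int_N: "(\<integral>x. g x \<partial>N) = (\<integral>x. f x * g x \<partial>M)" if "g \<in> borel_measurable M" for g :: "'a \<Rightarrow> real"
    unfolding N_def using that f by (subst integral_real_density) auto
  have meas: "V \<in> borel_measurable M" if "V \<in> S" for V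
    using that S_Linfty by (auto simp: Linfty_def)
  define J where "J V = (\<integral>x. (V x)\<^sup>2 \<partial>N)" for V :: "'a \<Rightarrow> real"
  define d where "d = Inf (J ` S)"
  have d_le: "d \<le> J V" if "V \<in> S" for V
    unfolding d_def using that by (intro cInf_lower bdd_belowI[of _ 0]) (auto simp: J_def)
  have "0 < d"
  proof -
    define c where "c = (\<integral>x. f x \<partial>M)"
    have c: "0 \<le> c" using f by (simp add: c_def)
    have "1 / (c + 1) \<le> J V" if V: "V \<in> S" for V
    proof -
      \<comment> \<open>The value for which \<open>c / (4 * a)\<close> stays below 1/2. What remains
        is \<open>1 / 2 < a * J V\<close>, that is, \<open>1 / (c + 1) < J V\<close>.\<close>
      define a where "a = (c + 1) / 2"
      have a: "0 < a" using c by (simp add: a_def)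
      have VL: "V \<in> Linfty M M" using V S_Linfty by auto
      have VpL: "(\<lambda>x. max 0 (V x)) \<in> Linfty M M" by (intro Linfty_max Linfty_const VL)
      have [measurable]: "V \<in> borel_measurable M" by (rule meas[OF V])
      have fV2: "integrable M (\<lambda>x. f x * (V x)\<^sup>2)"
        using integrable_mult_Linfty[OF integrable_mult_Linfty[OF f(1) VL] VL]
        by (simp add: power2_eq_square mult.assoc)
      have "1 < (\<integral>x. f x * max 0 (V x) \<partial>M)"
        by (intro sep S_up[OF V VpL]) auto
      also have "\<dots> \<le> (\<integral>x. a * (f x * (V x)\<^sup>2) + (1 / (4 * a)) * f x \<partial>M)"
      proof (rule integral_mono)
        fix x
        have "0 \<le> (2 * a * V x - 1)\<^sup>2 / (4 * a)" using a by simp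
        also have "\<dots> = a * (V x)\<^sup>2 + 1 / (4 * a) - V x"
          using a by (simp add: power2_eq_square field_simps)
        finally have "V x \<le> a * (V x)\<^sup>2 + 1 / (4 * a)" by simp
        then have "max 0 (V x) \<le> a * (V x)\<^sup>2 + 1 / (4 * a)" using a by simp
        from mult_left_mono[OF this f(2)]
        show "f x * max 0 (V x) \<le> a * (f x * (V x)\<^sup>2) + (1 / (4 * a)) * f x"
          by (simp add: algebra_simps)
      qed (use f fV2 integrable_mult_Linfty[OF f(1) VpL] in auto)
      also have "\<dots> = a * J V + (1 / (4 * a)) * c"
        using f fV2 by (simp add: J_def int_N c_def)
      finally have "1 - c / (4 * a) < a * J V" by simp
      moreover have "1 / 2 \<le> 1 - c / (4 * a)" using c by (simp add: a_def field_simps)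
      ultimately have "1 / 2 < a * J V" by linarith
      then have "1 < J V * (c + 1)" by (simp add: a_def field_simps)
      then show ?thesis using c by (simp add: divide_le_eq)
    qed
    then have "1 / (c + 1) \<le> d" unfolding d_def using ne by (intro cInf_greatest) auto
    moreover have "0 < 1 / (c + 1)" using c by simp
    ultimately show ?thesis by linarith
  qed
  define C where "C n = {V\<in>S. J V \<le> d + 1 / real (Suc n)}" for n
  have "\<exists>V W. (\<forall>n. V n \<in> C n) \<and> sq_integrable N W \<and> (AE x in N. (\<lambda>n. V n x) \<longlonglongrightarrow> W x) \<and>
    (\<forall>n. (\<integral>x. (V n x - W x)\<^sup>2 \<partial>N) \<le> (1/4) ^ n)"
  proof (rule N.nested_convex_limit[where B = "d + 1"])
    show "sq_integrable N v" if "v \<in> C n" for v n using that SN by (simp add: C_def)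
    show "decseq C"
      unfolding decseq_def C_def by (auto elim!: order_trans simp: frac_le)
    show "(\<lambda>x. (1/2) * u x + (1/2) * v x) \<in> C n" if uv: "u \<in> C n" "v \<in> C n" for u v n
    proof -
      have u: "u \<in> S" "J u \<le> d + 1 / real (Suc n)" and v: "v \<in> S" "J v \<le> d + 1 / real (Suc n)"
        using uv by (auto simp: C_def)
      have "0 \<le> (\<integral>x. (1 * u x + (- 1) * v x)\<^sup>2 \<partial>N)" by simp
      also have "\<dots> = J u + J v - 2 * (\<integral>x. u x * v x \<partial>N)"
        by (subst integral_sq_lincomb[OF SN SN]) (auto simp: u v J_def)
      finally have "J (\<lambda>x. (1/2) * u x + (1/2) * v x) \<le> (1/2) * J u + (1/2) * J v"
        unfolding J_def by (subst integral_sq_lincomb[OF SN SN]) (auto simp: u v J_def power2_eq_square)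
      then show ?thesis using u v S_convex[of u v "1/2"] by (simp add: C_def)
    qed
    show "\<exists>v\<in>C n. (\<integral>x. (v x)\<^sup>2 \<partial>N) \<le> d + 1" for n
    proof -
      have "\<exists>a\<in>J ` S. a < d + 1 / real (Suc n)"
        using cInf_lessD[of "J ` S" "d + 1 / real (Suc n)"] ne by (auto simp: d_def)
      then obtain v where v: "v \<in> S" "J v < d + 1 / real (Suc n)" by blast
      moreover have "1 / real (Suc n) \<le> 1" by simp
      ultimately have "J v \<le> d + 1" by linarith
      then show ?thesis using v by (auto simp: C_def J_def)
    qed
  qed
  then obtain V W where V: "\<And>n. V n \<in> C n" and W: "sq_integrable N W"
    and VW: "\<And>n. (\<integral>x. (V n x - W x)\<^sup>2 \<partial>N) \<le> (1/4) ^ n" by blast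
  have VS: "V n \<in> S" and JV: "J (V n) \<le> d + 1 / real (Suc n)" for n using V by (auto simp: C_def)
  have D: "sq_integrable N (\<lambda>x. V n x - W x)" for n by (intro sq_integrable_diff SN VS W)
  have lim4: "(\<lambda>n. (1/4 :: real) ^ n) \<longlonglongrightarrow> 0" by (rule LIMSEQ_power_zero) simp
  have JW: "J W \<le> d"
  proof (rule le_of_le_one_plus[where d = "\<lambda>n. 1 / real (Suc n)" and e = "\<lambda>n. (1/4) ^ n"])
    fix n and s :: real assume s: "0 < s"
    have "J W = (\<integral>x. (V n x + (W x - V n x))\<^sup>2 \<partial>N)" by (simp add: J_def)
    also have "\<dots> \<le> (1 + s) * J (V n) + (1 + 1 / s) * (\<integral>x. (W x - V n x)\<^sup>2 \<partial>N)"
      unfolding J_def by (intro integral_sq_add_le sq_integrable_diff SN VS W s)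
    also have "\<dots> \<le> (1 + s) * (d + 1 / real (Suc n)) + (1 + 1 / s) * (1/4) ^ n"
      using s JV[of n] VW[of n] by (intro add_mono mult_left_mono) (auto simp: power2_commute)
    finally show "J W \<le> (1 + s) * (d + 1 / real (Suc n)) + (1 + 1 / s) * (1/4) ^ n" .
  qed (use lim4 LIMSEQ_Suc[OF lim_1_over_n] in auto)
  \<comment> \<open>\<open>W\<close> need not lie in \<open>S\<close>, so the lower bound along the
    segment from \<open>W\<close> to \<open>U\<close> is first taken with \<open>V n\<close> in
    place of \<open>W\<close> and then passed to the limit. The case \<open>t = 0\<close> gives
    \<open>d \<le> J W\<close>.\<close>
  have d_le_lim: "d \<le> (\<integral>x. ((1 - t) * W x + t * U x)\<^sup>2 \<partial>N)" if U: "U \<in> S" and t: "0 \<le> t" "t < 1" for U t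
  proof (rule le_of_le_one_plus[where d = "\<lambda>n. 0" and e = "\<lambda>n. (1/4) ^ n"])
    fix n and s :: real assume s: "0 < s"
    let ?A = "\<lambda>x. (1 - t) * W x + t * U x" and ?D = "\<lambda>x. (1 - t) * (V n x - W x)"
    have A: "sq_integrable N ?A" by (intro sq_integrable_lincomb W SN U)
    have Dt: "sq_integrable N ?D" using sq_integrable_lincomb[OF D D, of "1 - t" n 0] by simp
    have "d \<le> J (\<lambda>x. (1 - t) * V n x + t * U x)" using t by (intro d_le S_convex VS U) auto
    also have "\<dots> = (\<integral>x. (?A x + ?D x)\<^sup>2 \<partial>N)" by (simp add: J_def algebra_simps)
    also have "\<dots> \<le> (1 + s) * (\<integral>x. (?A x)\<^sup>2 \<partial>N) + (1 + 1 / s) * (\<integral>x. (?D x)\<^sup>2 \<partial>N)"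
      by (rule integral_sq_add_le[OF A Dt s])
    finally have dA: "d \<le> (1 + s) * (\<integral>x. (?A x)\<^sup>2 \<partial>N) + (1 + 1 / s) * (\<integral>x. (?D x)\<^sup>2 \<partial>N)" .
    moreover have "(\<integral>x. (?D x)\<^sup>2 \<partial>N) = (1 - t)\<^sup>2 * (\<integral>x. (V n x - W x)\<^sup>2 \<partial>N)" by (simp add: power_mult_distrib)
    moreover have "\<dots> \<le> 1 * (1/4) ^ n"
      using t VW[of n] by (intro mult_mono power_le_one) auto
    ultimately have "(\<integral>x. (?D x)\<^sup>2 \<partial>N) \<le> (1/4) ^ n" by simp
    then have "(1 + 1 / s) * (\<integral>x. (?D x)\<^sup>2 \<partial>N) \<le> (1 + 1 / s) * (1/4) ^ n"
      using s by (intro mult_left_mono) auto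
    with dA show "d \<le> (1 + s) * ((\<integral>x. (?A x)\<^sup>2 \<partial>N) + 0) + (1 + 1 / s) * (1/4) ^ n" by simp
  qed (use lim4 in auto)
  have d_W: "d \<le> J W"
    using ne d_le_lim[of _ 0] by (auto simp: J_def)
  have key: "d \<le> (\<integral>x. W x * U x \<partial>N)" if U: "U \<in> S" for U
  proof -
    have "(\<integral>x. (W x)\<^sup>2 \<partial>N) \<le> (\<integral>x. W x * U x \<partial>N)"
    proof (rule first_order_condition[OF W SN[OF U]])
      fix t :: real assume "0 < t" "t < 1"
      then show "(\<integral>x. (W x)\<^sup>2 \<partial>N) \<le> (\<integral>x. ((1 - t) * W x + t * U x)\<^sup>2 \<partial>N)"
        using d_le_lim[OF U, of t] JW by (simp add: J_def)
    qed
    then show ?thesis using d_W by (simp add: J_def)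
  qed
  have [measurable]: "W \<in> borel_measurable M"
    using sq_integrable_measurable[OF W] by (simp add: measurable_cong_sets[OF sets_N refl])
  have Wint: "integrable N W" using sq_integrable_prod[OF W, of "\<lambda>_. 1"] by (simp add: sq_integrable_def)
  \<comment> \<open>\<open>S\<close> is upward closed, so \<open>key\<close> holds for
    \<open>U + m * B\<close> with \<open>B\<close> the indicator of \<open>W < 0\<close>. If
    \<integral> W B were negative, a large \<open>m\<close> would violate the bound.\<close>
  have W0: "AE x in N. 0 \<le> W x"
  proof -
    obtain U where U: "U \<in> S" using ne by auto
    have [measurable]: "U \<in> borel_measurable M" by (rule meas[OF U])
    define B where "B x = (if W x < 0 then 1 else 0 :: real)" for x
    have [measurable]: "B \<in> borel_measurable M" unfolding B_def by measurable
    have BL: "B \<in> Linfty M M" by (rule LinftyI[where C = 1]) (auto simp: B_def)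
    define b where "b = (\<integral>x. W x * B x \<partial>N)"
    have WB: "integrable N (\<lambda>x. W x * B x)" by (rule integrable_mult_Linfty[OF Wint Linfty_N[OF BL]])
    have WU: "integrable N (\<lambda>x. W x * U x)" by (rule sq_integrable_prod[OF W SN[OF U]])
    have le: "d \<le> (\<integral>x. W x * U x \<partial>N) + real m * b" for m
    proof -
      have "(\<lambda>x. 1 * U x + real m * B x) \<in> S"
      proof (rule S_up[OF U])
        show "(\<lambda>x. 1 * U x + real m * B x) \<in> Linfty M M"
          using U S_Linfty BL by (intro Linfty_lincomb) auto
      qed (auto simp: B_def)
      from key[OF this] have "d \<le> (\<integral>x. W x * U x + real m * (W x * B x) \<partial>N)"
        by (simp add: algebra_simps)
      also have "\<dots> = (\<integral>x. W x * U x \<partial>N) + real m * b" using WB WU by (simp add: b_def)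
      finally show ?thesis .
    qed
    have "0 \<le> b"
    proof (rule ccontr)
      assume "\<not> 0 \<le> b"
      then obtain m where "(\<integral>x. W x * U x \<partial>N) - d < real m * (- b)"
        using reals_Archimedean3[of "- b"] by auto
      then show False using le[of m] by simp
    qed
    moreover have nonneg: "0 \<le> - (W x * B x)" for x by (auto simp: B_def)
    moreover have "(\<integral>x. - (W x * B x) \<partial>N) = - b" by (simp add: b_def)
    ultimately have "(\<integral>x. - (W x * B x) \<partial>N) = 0"
      using Bochner_Integration.integral_nonneg[of N "\<lambda>x. - (W x * B x)"] by auto
    then have "AE x in N. - (W x * B x) = 0"
      using WB nonneg by (subst (asm) integral_nonneg_eq_0_iff_AE) auto
    then show ?thesis by eventually_elim (auto simp: B_def split: if_splits)
  qed
  \<comment> \<open>\<open>W\<close> is nonnegative only \<open>N\<close>-almost everywhere, hence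
    the truncation; the factor \<open>f\<close> is the density of \<open>N\<close>.\<close>
  define Z where "Z x = f x * max 0 (W x)" for x
  have "integrable N (\<lambda>x. max 0 (W x))" using Wint by simp
  then have "integrable M Z" unfolding N_def Z_def using f by (subst (asm) integrable_real_density) auto
  moreover have "d \<le> (\<integral>x. Z x * U x \<partial>M)" if U: "U \<in> S" for U
  proof -
    have [measurable]: "U \<in> borel_measurable M" by (rule meas[OF U])
    have "(\<integral>x. Z x * U x \<partial>M) = (\<integral>x. max 0 (W x) * U x \<partial>N)"
      by (subst int_N) (auto simp: Z_def mult.assoc)
    also have "\<dots> = (\<integral>x. W x * U x \<partial>N)"
      using W0 by (intro integral_cong_AE) (auto elim!: eventually_mono)
    finally show ?thesis using key[OF U] by simp
  qed
  ultimately show ?thesis using \<open>0 < d\<close> f(2) by (intro exI[of _ Z] exI[of _ d]) (auto simp: Z_def)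
qed

end

section \<open>Directed essential suprema and conditional expectations\<close>

lemma is_ess_sup_cong_AE:
  assumes "is_ess_sup M \<Phi> Z" "Z' \<in> borel_measurable M" "AE x in M. Z x = Z' x"
  shows "is_ess_sup M \<Phi> Z'"
  unfolding is_ess_sup_def
proof (intro conjI ballI impI)
  show "AE x in M. X x \<le> Z' x" if "X \<in> \<Phi>" for X
  proof -
    have "AE x in M. X x \<le> Z x" using assms(1) that by (auto simp: is_ess_sup_def)
    then show ?thesis using assms(3) by eventually_elim simp
  qed
  show "AE x in M. Z' x \<le> W x" if "W \<in> borel_measurable M" "\<forall>X\<in>\<Phi>. AE x in M. X x \<le> W x" for W
  proof -
    have "AE x in M. Z x \<le> W x" using assms(1) that by (auto simp: is_ess_sup_def)
    then show ?thesis using assms(3) by eventually_elim simp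
  qed
qed fact

text \<open>Composing with \<open>arctan\<close> keeps the order and makes all integrals finite.
  Directedness allows an increasing sequence whose integrals approach the supremum \<open>s\<close>
  over the family, and such a sequence already exhausts the family.\<close>

lemma (in finite_measure) directed_ess_sup_sequence:
  fixes \<Phi> :: "('a \<Rightarrow> real) set"
  assumes meas: "\<Phi> \<subseteq> borel_measurable M" and ne: "\<Phi> \<noteq> {}"
    and dir: "\<And>u v. u \<in> \<Phi> \<Longrightarrow> v \<in> \<Phi> \<Longrightarrow> \<exists>w\<in>\<Phi>. AE x in M. u x \<le> w x \<and> v x \<le> w x"
    and Z: "is_ess_sup M ((\<lambda>u x. ereal (u x)) ` \<Phi>) Z"
  shows "\<exists>u. (\<forall>n. u n \<in> \<Phi>) \<and> (\<forall>n. AE x in M. u n x \<le> u (Suc n) x) \<and>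
    (AE x in M. (\<lambda>n. ereal (u n x)) \<longlonglongrightarrow> Z x)"
proof -
  define I where "I u = (\<integral>x. arctan (u x) \<partial>M)" for u
  have arctan_le: "\<bar>arctan y\<bar> \<le> pi / 2" for y
    using arctan_lbound[of y] arctan_ubound[of y] by (auto simp: abs_le_iff)
  have bint: "integrable M g" if "g \<in> borel_measurable M" "\<And>x. \<bar>g x\<bar> \<le> pi / 2" for g :: "'a \<Rightarrow> real"
    using that by (intro integrable_const_bound[where B = "pi / 2"]) auto
  have int: "integrable M (\<lambda>x. arctan (u x))" if "u \<in> borel_measurable M" for u :: "'a \<Rightarrow> real"
    using that arctan_le by (intro bint) auto
  have I_mono: "I u \<le> I v" if "u \<in> \<Phi>" "v \<in> \<Phi>" "AE x in M. u x \<le> v x" for u v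
    unfolding I_def using that meas by (intro integral_mono_AE int) (auto simp: arctan_le_iff)
  define s where "s = (SUP u\<in>\<Phi>. I u)"
  have bdd: "bdd_above (I ` \<Phi>)"
  proof (rule bdd_aboveI2)
    fix u assume "u \<in> \<Phi>"
    then have "I u \<le> (\<integral>x. pi / 2 \<partial>M)"
      unfolding I_def using meas arctan_ubound by (intro integral_mono int) (auto intro: less_imp_le)
    then show "I u \<le> measure M (space M) * (pi / 2)" by simp
  qed
  have I_s: "I u \<le> s" if "u \<in> \<Phi>" for u
    unfolding s_def using that bdd by (rule cSUP_upper)
  have ex: "\<exists>v\<in>\<Phi>. s - 1 / real (Suc n) < I v" for n
    using less_cSUP_iff[OF ne bdd, of "s - 1 / real (Suc n)"] by (simp add: s_def)
  have "\<exists>u. \<forall>n. (u n \<in> \<Phi> \<and> s - 1 / real (Suc n) < I (u n)) \<and> (AE x in M. u n x \<le> u (Suc n) x)"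
  proof (rule dependent_nat_choice)
    show "\<exists>u. u \<in> \<Phi> \<and> s - 1 / real (Suc 0) < I u" using ex[of 0] by blast
  next
    fix u n assume u: "u \<in> \<Phi> \<and> s - 1 / real (Suc n) < I u"
    obtain v where v: "v \<in> \<Phi>" "s - 1 / real (Suc (Suc n)) < I v" using ex[of "Suc n"] by blast
    obtain w where w: "w \<in> \<Phi>" "AE x in M. u x \<le> w x \<and> v x \<le> w x" using dir u v by blast
    have "I v \<le> I w" using w by (intro I_mono v) auto
    then show "\<exists>w. (w \<in> \<Phi> \<and> s - 1 / real (Suc (Suc n)) < I w) \<and> (AE x in M. u x \<le> w x)"
      using v w by (intro exI[of _ w]) auto
  qed
  then obtain u where u: "\<And>n. u n \<in> \<Phi>" "\<And>n. s - 1 / real (Suc n) < I (u n)"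
    and incr: "\<And>n. AE x in M. u n x \<le> u (Suc n) x" by blast
  have incseq: "AE x in M. incseq (\<lambda>n. u n x)"
    using incr by (simp add: incseq_Suc_iff AE_all_countable)
  have [measurable]: "u n \<in> borel_measurable M" for n using u meas by auto
  define U where "U x = (SUP n. ereal (u n x))" for x
  have U_lim: "AE x in M. (\<lambda>n. ereal (u n x)) \<longlonglongrightarrow> U x"
    using incseq unfolding U_def by eventually_elim (intro LIMSEQ_SUP, auto simp: incseq_def)
  have Um [measurable]: "U \<in> borel_measurable M" unfolding U_def by measurable
  \<comment> \<open>The limit \<open>U\<close> may be infinite, where \<open>arctan\<close> has no
    value; the limit of the composed sequence is therefore formed as a real supremum of its
    own.\<close>
  define b where "b x = (SUP n. arctan (u n x))" for x
  have bdd_arctan: "bdd_above (range (\<lambda>n. arctan (u n x)))" for x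
    using arctan_ubound by (intro bdd_aboveI[where M = "pi / 2"]) (auto intro: less_imp_le)
  have bm [measurable]: "b \<in> borel_measurable M"
    unfolding b_def using bdd_arctan by (intro borel_measurable_cSUP) auto
  have b_up: "arctan (u n x) \<le> b x" for n x
    unfolding b_def using bdd_arctan by (rule cSUP_upper[OF UNIV_I])
  have b_bd: "\<bar>b x\<bar> \<le> pi / 2" for x
  proof -
    have "b x \<le> pi / 2"
      unfolding b_def using arctan_ubound by (intro cSUP_least) (auto intro: less_imp_le)
    moreover have "- (pi / 2) \<le> b x"
      using b_up[of 0 x] arctan_lbound[of "u 0 x"] by linarith
    ultimately show ?thesis by (auto simp: abs_le_iff)
  qed
  have b_lim: "AE x in M. (\<lambda>n. arctan (u n x)) \<longlonglongrightarrow> b x"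
    using incseq unfolding b_def
    by eventually_elim (intro LIMSEQ_incseq_SUP bdd_arctan, auto simp: incseq_def arctan_le_iff)
  have bint': "integrable M b" using b_bd by (intro bint) auto
  have s_b: "s \<le> (\<integral>x. b x \<partial>M)"
  proof -
    have "s - 1 / real (Suc n) \<le> (\<integral>x. b x \<partial>M)" for n
    proof -
      have "I (u n) \<le> (\<integral>x. b x \<partial>M)"
        unfolding I_def using b_up by (intro integral_mono int bint') auto
      then show ?thesis using u(2)[of n] by linarith
    qed
    moreover have "(\<lambda>n. s - 1 / real (Suc n)) \<longlonglongrightarrow> s - 0"
      by (intro tendsto_intros LIMSEQ_Suc[OF lim_1_over_n])
    ultimately show ?thesis by (auto intro: LIMSEQ_le_const2)
  qed
  have upper: "AE x in M. ereal (v x) \<le> U x" if v: "v \<in> \<Phi>" for v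
  proof -
    have [measurable]: "v \<in> borel_measurable M" using v meas by auto
    have mint: "integrable M (\<lambda>x. max (arctan (v x)) (g x))"
      if "g \<in> borel_measurable M" "\<And>x. \<bar>g x\<bar> \<le> pi / 2" for g :: "'a \<Rightarrow> real"
    proof (rule bint)
      show "\<bar>max (arctan (v x)) (g x)\<bar> \<le> pi / 2" for x
        using arctan_le[of "v x"] that(2)[of x] by (auto simp: max_def)
    qed (use that in measurable)
    \<comment> \<open>Directedness puts this maximum below \<open>arctan w\<close> for some
      \<open>w\<close> in the family. In the limit the maximum with \<open>b\<close> gains no
      integral over \<open>b\<close>, so \<open>v\<close> cannot exceed \<open>U\<close> on a set of
      positive measure.\<close>
    have le_s: "(\<integral>x. max (arctan (v x)) (arctan (u n x)) \<partial>M) \<le> s" for n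
    proof -
      obtain w where w: "w \<in> \<Phi>" "AE x in M. v x \<le> w x \<and> u n x \<le> w x" using dir[OF v u(1)] by blast
      have "(\<integral>x. max (arctan (v x)) (arctan (u n x)) \<partial>M) \<le> I w"
        unfolding I_def
      proof (rule integral_mono_AE)
        show "AE x in M. max (arctan (v x)) (arctan (u n x)) \<le> arctan (w x)"
          using w(2) by eventually_elim (auto simp: arctan_le_iff)
        show "integrable M (\<lambda>x. arctan (w x))" using w meas by (intro int) auto
      qed (use arctan_le in \<open>auto intro!: mint\<close>)
      then show ?thesis using I_s[OF w(1)] by simp
    qed
    have "(\<lambda>n. \<integral>x. max (arctan (v x)) (arctan (u n x)) \<partial>M) \<longlonglongrightarrow> (\<integral>x. max (arctan (v x)) (b x) \<partial>M)"
    proof (rule integral_dominated_convergence)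
      show "AE x in M. (\<lambda>n. max (arctan (v x)) (arctan (u n x))) \<longlonglongrightarrow> max (arctan (v x)) (b x)"
        using b_lim by eventually_elim (intro tendsto_intros)
      show "integrable M (\<lambda>_. pi / 2)" by simp
      show "AE x in M. norm (max (arctan (v x)) (arctan (u n x))) \<le> pi / 2" for n
        using arctan_le by (auto simp: max_def)
    qed auto
    then have "(\<integral>x. max (arctan (v x)) (b x) \<partial>M) \<le> s"
      using le_s by (auto intro: LIMSEQ_le_const2)
    moreover have mb: "integrable M (\<lambda>x. max (arctan (v x)) (b x))" using b_bd by (intro mint) auto
    ultimately have "(\<integral>x. max (arctan (v x)) (b x) - b x \<partial>M) \<le> 0"
      using s_b bint' by simp
    moreover have "0 \<le> (\<integral>x. max (arctan (v x)) (b x) - b x \<partial>M)" by (intro Bochner_Integration.integral_nonneg) auto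
    ultimately have "(\<integral>x. max (arctan (v x)) (b x) - b x \<partial>M) = 0" by simp
    then have "AE x in M. max (arctan (v x)) (b x) - b x = 0"
      using mb bint' by (subst (asm) integral_nonneg_eq_0_iff_AE) auto
    then show ?thesis
    proof eventually_elim
      case (elim x)
      show ?case
      proof (rule ccontr)
        assume *: "\<not> ereal (v x) \<le> U x"
        have up: "ereal (u n x) \<le> U x" for n unfolding U_def by (rule SUP_upper) simp
        obtain w where w: "U x = ereal w" using * up[of 0] by (cases "U x") auto
        have "b x \<le> arctan w"
          unfolding b_def using up by (intro cSUP_least) (auto simp: w arctan_le_iff)
        moreover have "arctan w < arctan (v x)" using * by (simp add: w arctan_less_iff)
        ultimately show False using elim by (simp add: max_def split: if_splits)
      qed
    qed
  qed
  have "AE x in M. Z x \<le> U x" using Z upper by (auto simp: is_ess_sup_def)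
  moreover have "AE x in M. \<forall>n. ereal (u n x) \<le> Z x"
    using Z u(1) by (auto simp: is_ess_sup_def AE_all_countable)
  ultimately have "AE x in M. U x = Z x"
    by eventually_elim (auto simp: U_def intro!: antisym SUP_least)
  with U_lim have "AE x in M. (\<lambda>n. ereal (u n x)) \<longlonglongrightarrow> Z x" by eventually_elim simp
  then show ?thesis using u(1) incr by blast
qed

text \<open>Rearranging \<open>a + b = p + c\<close> is legitimate because \<open>b\<close> and
  \<open>c\<close> are finite, even where \<open>a\<close> and \<open>p\<close> are infinite. In the
  application \<open>p\<close> and \<open>b\<close> come from the positive and negative parts of a
  function and \<open>a\<close> from the shifted function.\<close>

lemma ennreal_diff_shift:
  fixes a b p :: ennreal
  assumes "a + b = p + ennreal c" "b \<le> ennreal c" "0 \<le> c"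
  shows "enn2ereal p - enn2ereal b = enn2ereal a - ereal c"
proof -
  have "b < top" using assms(2) by (rule le_less_trans) simp
  then obtain b' where b: "b = ennreal b'" "0 \<le> b'" by (cases b) auto
  show ?thesis
  proof (cases p)
    case (real p')
    then have "a < top" using assms(1) by (metis ennreal_add_less_top ennreal_less_top less_top add_eq_0_iff_both_eq_0 ennreal_add_eq_top top.not_eq_extremum)
    then obtain a' where a: "a = ennreal a'" "0 \<le> a'" by (cases a) auto
    have "ennreal (a' + b') = ennreal (p' + c)" using assms(1,3) a b real by simp
    then have "a' + b' = p' + c" using a b real assms(3) by (subst (asm) ennreal_inj) auto
    then show ?thesis using a b real by simp
  next
    case top
    then have "a = top" using assms(1) b by (simp add: top_add ennreal_add_eq_top)
    then show ?thesis using top b by simp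
  qed
qed

section \<open>Conditional expectation of extended real functions\<close>

context sigma_finite_subalgebra
begin

lemma nn_cond_exp_const: "AE x in M. nn_cond_exp M F (\<lambda>_. c) x = c"
  using nn_cond_exp_F_meas[of "\<lambda>_. c"] by (auto elim: eventually_mono)

text \<open>Monotone convergence, applied on both sides of the identity for integrals over sets of
  \<open>F\<close>, shows that the supremum of the conditional expectations has the characterising
  property of the one of \<open>g\<close>.\<close>

lemma nn_cond_exp_monotone_convergence:
  assumes [measurable]: "\<And>n. f n \<in> borel_measurable M" "g \<in> borel_measurable M"
    and mono: "\<And>n. AE x in M. f n x \<le> f (Suc n) x"
    and lim: "AE x in M. (\<lambda>n. f n x) \<longlonglongrightarrow> g x"
  shows "AE x in M. (\<lambda>n. nn_cond_exp M F (f n) x) \<longlonglongrightarrow> nn_cond_exp M F g x"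
proof -
  have inc: "AE x in M. incseq (\<lambda>n. f n x)" using mono by (simp add: incseq_Suc_iff AE_all_countable)
  have nn_mono: "AE x in M. nn_cond_exp M F (f n) x \<le> nn_cond_exp M F (f (Suc n)) x" for n
    by (rule nn_cond_exp_mono[OF mono]) auto
  have "AE x in M. (SUP n. nn_cond_exp M F (f n) x) = nn_cond_exp M F g x"
  proof (rule nn_cond_exp_charact)
    fix A assume A: "A \<in> sets F"
    then have [measurable]: "A \<in> sets M" using subalg by (auto simp: subalgebra_def)
    have "(\<integral>\<^sup>+x\<in>A. g x \<partial>M) = (\<integral>\<^sup>+x. (SUP n. f n x * indicator A x) \<partial>M)"
    proof (rule nn_integral_cong_AE)
      show "AE x in M. g x * indicator A x = (SUP n. f n x * indicator A x)"
        using inc lim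
      proof eventually_elim
        case (elim x)
        then have "g x = (SUP n. f n x)" using LIMSEQ_unique LIMSEQ_SUP by blast
        then show ?case by (auto simp: indicator_def)
      qed
    qed
    also have "\<dots> = (SUP n. \<integral>\<^sup>+x. f n x * indicator A x \<partial>M)"
    proof (rule nn_integral_monotone_convergence_SUP_AE)
      show "AE x in M. f n x * indicator A x \<le> f (Suc n) x * indicator A x" for n
        using mono[of n] by eventually_elim (rule mult_right_mono, auto)
    qed auto
    also have "\<dots> = (SUP n. \<integral>\<^sup>+x. nn_cond_exp M F (f n) x * indicator A x \<partial>M)"
      using nn_cond_exp_intg[of "indicator A"] A by (simp add: mult.commute)
    also have "\<dots> = (\<integral>\<^sup>+x. (SUP n. nn_cond_exp M F (f n) x * indicator A x) \<partial>M)"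
    proof (rule nn_integral_monotone_convergence_SUP_AE[symmetric])
      show "AE x in M. nn_cond_exp M F (f n) x * indicator A x \<le> nn_cond_exp M F (f (Suc n)) x * indicator A x" for n
        using nn_mono[of n] by eventually_elim (rule mult_right_mono, auto)
    qed auto
    also have "\<dots> = (\<integral>\<^sup>+x\<in>A. (SUP n. nn_cond_exp M F (f n) x) \<partial>M)"
      by (intro nn_integral_cong) (auto simp: indicator_def)
    finally show "(\<integral>\<^sup>+x\<in>A. g x \<partial>M) = (\<integral>\<^sup>+x\<in>A. (SUP n. nn_cond_exp M F (f n) x) \<partial>M)" .
  qed auto
  moreover have "AE x in M. incseq (\<lambda>n. nn_cond_exp M F (f n) x)"
    using nn_mono by (simp add: incseq_Suc_iff AE_all_countable)
  ultimately show ?thesis by eventually_elim (metis LIMSEQ_SUP)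
qed

lemma ereal_cond_exp_mono:
  assumes [measurable]: "Z \<in> borel_measurable M" "W \<in> borel_measurable M"
    and le: "AE x in M. Z x \<le> W x"
  shows "AE x in M. ereal_cond_exp M F Z x \<le> ereal_cond_exp M F W x"
proof -
  have "AE x in M. nn_cond_exp M F (\<lambda>x. e2ennreal (Z x)) x \<le> nn_cond_exp M F (\<lambda>x. e2ennreal (W x)) x"
    using le by (intro nn_cond_exp_mono) (auto elim!: eventually_mono intro: e2ennreal_mono)
  moreover have "AE x in M. nn_cond_exp M F (\<lambda>x. e2ennreal (- W x)) x \<le> nn_cond_exp M F (\<lambda>x. e2ennreal (- Z x)) x"
    using le by (intro nn_cond_exp_mono) (auto elim!: eventually_mono intro: e2ennreal_mono)
  ultimately show ?thesis
    unfolding ereal_cond_exp_def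
    by eventually_elim (intro ereal_minus_mono, auto simp: less_eq_ennreal.rep_eq)
qed

text \<open>The shift by \<open>c\<close> turns \<^const>\<open>ereal_cond_exp\<close> into a single nonnegative conditional expectation.\<close>

lemma ereal_cond_exp_shift:
  assumes [measurable]: "Z \<in> borel_measurable M" and c: "0 \<le> c" "AE x in M. ereal (- c) \<le> Z x"
  shows "AE x in M. ereal_cond_exp M F Z x = enn2ereal (nn_cond_exp M F (\<lambda>x. e2ennreal (Z x + ereal c)) x) - ereal c"
proof -
  define p where "p x = e2ennreal (Z x)" for x
  define m where "m x = e2ennreal (- Z x)" for x
  define q where "q x = e2ennreal (Z x + ereal c)" for x
  have [measurable]: "p \<in> borel_measurable M" "m \<in> borel_measurable M" "q \<in> borel_measurable M"
    unfolding p_def m_def q_def by measurable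
  have eq: "AE x in M. q x + m x = p x + ennreal c" and le: "AE x in M. m x \<le> ennreal c"
  proof -
    show "AE x in M. q x + m x = p x + ennreal c" using c(2)
    proof eventually_elim
      case (elim x)
      show ?case
      proof (cases "Z x")
        case (real z)
        then have "ennreal (z + c) + ennreal (- z) = ennreal z + ennreal c"
          using elim c(1) by (cases "0 \<le> z") (auto simp: ennreal_neg simp flip: ennreal_plus)
        then show ?thesis using real by (simp add: p_def m_def q_def)
      qed (use elim in \<open>auto simp: p_def m_def q_def e2ennreal_neg\<close>)
    qed
    show "AE x in M. m x \<le> ennreal c" using c(2)
    proof eventually_elim
      case (elim x)
      then have "- Z x \<le> ereal c" by (metis ereal_uminus_le_reorder uminus_ereal.simps(1))
      then have "e2ennreal (- Z x) \<le> e2ennreal (ereal c)" by (rule e2ennreal_mono)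
      then show ?case by (simp add: m_def)
    qed
  qed
  have "AE x in M. nn_cond_exp M F q x + nn_cond_exp M F m x = nn_cond_exp M F (\<lambda>x. q x + m x) x"
    by (rule nn_cond_exp_sum) auto
  moreover have "AE x in M. nn_cond_exp M F (\<lambda>x. q x + m x) x = nn_cond_exp M F (\<lambda>x. p x + ennreal c) x"
    by (rule nn_cond_exp_cong[OF eq]) auto
  moreover have "AE x in M. nn_cond_exp M F p x + nn_cond_exp M F (\<lambda>_. ennreal c) x = nn_cond_exp M F (\<lambda>x. p x + ennreal c) x"
    by (rule nn_cond_exp_sum) auto
  moreover have "AE x in M. nn_cond_exp M F m x \<le> nn_cond_exp M F (\<lambda>_. ennreal c) x"
    by (rule nn_cond_exp_mono[OF le]) auto
  ultimately show ?thesis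
    using nn_cond_exp_const[of "ennreal c"] unfolding ereal_cond_exp_def p_def[symmetric] m_def[symmetric] q_def[symmetric]
  proof eventually_elim
    case (elim x)
    show ?case by (rule ennreal_diff_shift) (use elim c(1) in simp_all)
  qed
qed

lemma ereal_cond_exp_real:
  assumes u: "integrable M u"
  shows "AE x in M. ereal_cond_exp M F (\<lambda>x. ereal (u x)) x = ereal (real_cond_exp M F u x)"
proof -
  have [measurable]: "u \<in> borel_measurable M" using u by measurable
  \<comment> \<open>\<open>real_cond_exp\<close> uses \<open>enn2real\<close>, which sends infinity
    to 0, so the two notions agree only where both parts are finite.\<close>
  have fin: "AE x in M. nn_cond_exp M F (\<lambda>x. ennreal (v x)) x \<noteq> \<infinity>" if v: "integrable M v" for v
  proof (rule nn_integral_PInf_AE)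
    have [measurable]: "v \<in> borel_measurable M" using v by measurable
    have "(\<integral>\<^sup>+x. nn_cond_exp M F (\<lambda>x. ennreal (v x)) x \<partial>M) = (\<integral>\<^sup>+x. ennreal (v x) \<partial>M)"
      using nn_cond_exp_intg[of "\<lambda>_. 1" "\<lambda>x. ennreal (v x)"] by simp
    also have "\<dots> \<noteq> \<infinity>" using v by (simp add: real_integrable_def)
    finally show "(\<integral>\<^sup>+x. nn_cond_exp M F (\<lambda>x. ennreal (v x)) x \<partial>M) \<noteq> \<infinity>" .
  qed measurable
  have diff: "enn2ereal a - enn2ereal b = ereal (enn2real a - enn2real b)" if "a \<noteq> \<infinity>" "b \<noteq> \<infinity>" for a b
    using that by (cases a; cases b) auto
  have "AE x in M. nn_cond_exp M F (\<lambda>x. ennreal (- u x)) x \<noteq> \<infinity>" using u by (intro fin) auto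
  then show ?thesis
    using fin[OF u] unfolding ereal_cond_exp_def real_cond_exp_def
    by eventually_elim (unfold e2ennreal_ereal uminus_ereal.simps, rule diff)
qed

text \<open>All \<open>u n\<close> inherit the lower bound of \<open>u 0\<close>, so one shift makes
  them nonnegative. The limit \<open>Z\<close> may be infinite.\<close>

lemma ereal_cond_exp_monotone_convergence:
  fixes u :: "nat \<Rightarrow> 'a \<Rightarrow> real"
  assumes u: "\<And>n. integrable M (u n)" and [measurable]: "Z \<in> borel_measurable M"
    and incr: "\<And>n. AE x in M. u n x \<le> u (Suc n) x"
    and bd: "AE x in M. \<bar>u 0 x\<bar> \<le> c"
    and lim: "AE x in M. (\<lambda>n. ereal (u n x)) \<longlonglongrightarrow> Z x"
  shows "AE x in M. (\<lambda>n. ereal (real_cond_exp M F (u n) x)) \<longlonglongrightarrow> ereal_cond_exp M F Z x"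
proof -
  have [measurable]: "u n \<in> borel_measurable M" for n using u by measurable
  define d where "d = max 0 c"
  have d: "0 \<le> d" by (simp add: d_def)
  have inc: "AE x in M. incseq (\<lambda>n. u n x)" using incr by (simp add: incseq_Suc_iff AE_all_countable)
  have low: "AE x in M. ereal (- d) \<le> ereal (u n x)" for n
    using inc bd
  proof eventually_elim
    case (elim x)
    have "u 0 x \<le> u n x" using elim(1) by (auto dest: incseqD)
    then show ?case using elim(2) by (auto simp: d_def)
  qed
  have "AE x in M. \<forall>n. ereal (- d) \<le> ereal (u n x)" using low by (simp add: AE_all_countable)
  then have lowZ: "AE x in M. ereal (- d) \<le> Z x"
    using lim by eventually_elim (auto intro: LIMSEQ_le_const)
  have "AE x in M. (\<lambda>n. nn_cond_exp M F (\<lambda>x. e2ennreal (ereal (u n x) + ereal d)) x) \<longlonglongrightarrow>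
    nn_cond_exp M F (\<lambda>x. e2ennreal (Z x + ereal d)) x"
  proof (rule nn_cond_exp_monotone_convergence)
    show "AE x in M. e2ennreal (ereal (u n x) + ereal d) \<le> e2ennreal (ereal (u (Suc n) x) + ereal d)" for n
      using incr[of n] by eventually_elim (intro e2ennreal_mono add_right_mono, simp)
    show "AE x in M. (\<lambda>n. e2ennreal (ereal (u n x) + ereal d)) \<longlonglongrightarrow> e2ennreal (Z x + ereal d)"
      using lim
    proof eventually_elim
      case (elim x)
      then have "(\<lambda>n. ereal (u n x) + ereal d) \<longlonglongrightarrow> Z x + ereal d"
        by (intro tendsto_add_ereal_general1) auto
      then show ?case
        by (rule continuous_on_tendsto_compose[OF continuous_on_e2ennreal[of UNIV]]) auto
    qed
  qed measurable
  moreover have "AE x in M. ereal_cond_exp M F Z x = enn2ereal (nn_cond_exp M F (\<lambda>x. e2ennreal (Z x + ereal d)) x) - ereal d"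
    by (rule ereal_cond_exp_shift[OF _ d lowZ]) measurable
  moreover have "AE x in M. \<forall>n. ereal (real_cond_exp M F (u n) x) =
    enn2ereal (nn_cond_exp M F (\<lambda>x. e2ennreal (ereal (u n x) + ereal d)) x) - ereal d"
    unfolding AE_all_countable
  proof
    fix n
    have "AE x in M. ereal_cond_exp M F (\<lambda>x. ereal (u n x)) x =
      enn2ereal (nn_cond_exp M F (\<lambda>x. e2ennreal (ereal (u n x) + ereal d)) x) - ereal d"
      by (rule ereal_cond_exp_shift[OF _ d low]) measurable
    then show "AE x in M. ereal (real_cond_exp M F (u n) x) =
      enn2ereal (nn_cond_exp M F (\<lambda>x. e2ennreal (ereal (u n x) + ereal d)) x) - ereal d"
      using ereal_cond_exp_real[OF u[of n]] by eventually_elim simp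
  qed
  ultimately show ?thesis
  proof eventually_elim
    case (elim x)
    have "(\<lambda>n. enn2ereal (nn_cond_exp M F (\<lambda>x. e2ennreal (ereal (u n x) + ereal d)) x) - ereal d) \<longlonglongrightarrow>
      enn2ereal (nn_cond_exp M F (\<lambda>x. e2ennreal (Z x + ereal d)) x) - ereal d"
      by (intro tendsto_diff_ereal_general tendsto_enn2erealI elim) auto
    then show ?case using elim by simp
  qed
qed

end

lemma (in prob_space) sigma_finite_subalgebraI:
  assumes "subalgebra M G" shows "sigma_finite_subalgebra M G"
proof -
  interpret finite_measure_subalgebra M G by unfold_locales (rule assms)
  show ?thesis by unfold_locales
qed

section \<open>Conditional risk measures\<close>

lemma Linfty_subalgebra: "subalgebra A B \<Longrightarrow> X \<in> Linfty M B \<Longrightarrow> X \<in> Linfty M A"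
  by (auto simp: Linfty_def intro: measurable_from_subalg)

lemma subalgebra_trans: "subalgebra A B \<Longrightarrow> subalgebra B C \<Longrightarrow> subalgebra A C"
  by (auto simp: subalgebra_def)

text \<open>Indicators of sets of \<open>G\<close> can be taken out of the conditional expectation.
  Together with \<open>r_local\<close> this lets penalty terms be pasted along such sets.\<close>

lemma real_cond_exp_minus_if:
  assumes "sigma_finite_subalgebra Q G" "A \<in> sets G" "integrable Q X" "integrable Q Y"
  shows "AE x in Q. real_cond_exp Q G (\<lambda>x. - (if x \<in> A then X x else Y x)) x =
    (if x \<in> A then real_cond_exp Q G (\<lambda>x. - X x) x else real_cond_exp Q G (\<lambda>x. - Y x) x)"
proof -
  interpret sigma_finite_subalgebra Q G by fact
  have sp: "space G = space Q" and AQ [measurable]: "A \<in> sets Q" using subalg assms(2) by (auto simp: subalgebra_def)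
  have [measurable]: "A \<in> sets G" by fact
  define B where "B = space G - A"
  have [measurable]: "B \<in> sets G" unfolding B_def by measurable
  have BQ [measurable]: "B \<in> sets Q" using subalg by (auto simp: subalgebra_def)
  have i1: "integrable Q (\<lambda>x. indicator A x * - X x)" using integrable_mult_indicator[OF AQ, of "\<lambda>x. - X x"] assms(3) by simp
  have i2: "integrable Q (\<lambda>x. indicator B x * - Y x)" using integrable_mult_indicator[OF BQ, of "\<lambda>x. - Y x"] assms(4) by simp
  have [measurable]: "X \<in> borel_measurable Q" "Y \<in> borel_measurable Q" using assms by auto
  have "AE x in Q. real_cond_exp Q G (\<lambda>x. - (if x \<in> A then X x else Y x)) x =
    real_cond_exp Q G (\<lambda>x. indicator A x * - X x + indicator B x * - Y x) x"
    by (intro real_cond_exp_cong AE_I2) (auto simp: B_def sp)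
  moreover have "AE x in Q. real_cond_exp Q G (\<lambda>x. indicator A x * - X x + indicator B x * - Y x) x =
    real_cond_exp Q G (\<lambda>x. indicator A x * - X x) x + real_cond_exp Q G (\<lambda>x. indicator B x * - Y x) x"
    by (rule real_cond_exp_add[OF i1 i2])
  moreover have "AE x in Q. real_cond_exp Q G (\<lambda>x. indicator A x * - X x) x = indicator A x * real_cond_exp Q G (\<lambda>x. - X x) x"
    by (rule real_cond_exp_mult[OF _ _ i1]) auto
  moreover have "AE x in Q. real_cond_exp Q G (\<lambda>x. indicator B x * - Y x) x = indicator B x * real_cond_exp Q G (\<lambda>x. - Y x) x"
    by (rule real_cond_exp_mult[OF _ _ i2]) auto
  moreover have "AE x in Q. x \<in> space Q" by simp
  ultimately show ?thesis by eventually_elim (auto simp: B_def sp)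
qed

section \<open>Dominated probability measures and penalties\<close>

definition dominated_prob :: "'a measure \<Rightarrow> 'a measure \<Rightarrow> bool"
  where "dominated_prob M Q \<longleftrightarrow> prob_space Q \<and> sets Q = sets M \<and> absolutely_continuous M Q"

lemma dominated_prob_AE: "dominated_prob M Q \<Longrightarrow> AE x in M. P x \<Longrightarrow> AE x in Q. P x"
  by (auto simp: dominated_prob_def intro: absolutely_continuous_AE)

lemma dominated_prob_Linfty:
  assumes "dominated_prob M Q" "subalgebra M H" "X \<in> Linfty M H"
  shows "X \<in> Linfty Q Q"
proof -
  obtain C where "AE x in M. \<bar>X x\<bar> \<le> C" using Linfty_bounded[OF assms(3)] by blast
  moreover have "sets Q = sets M" using assms(1) by (simp add: dominated_prob_def)
  then have "X \<in> borel_measurable Q"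
    using Linfty_subalgebra[OF assms(2,3)] by (simp add: Linfty_def measurable_cong_sets[OF _ refl, of Q M])
  ultimately show ?thesis by (rule LinftyI[OF _ dominated_prob_AE[OF assms(1)], rotated])
qed

lemma dominated_prob_integrable:
  assumes "dominated_prob M Q" "subalgebra M H" "X \<in> Linfty M H"
  shows "integrable Q X"
proof -
  interpret prob_space Q using assms by (simp add: dominated_prob_def)
  show ?thesis by (rule integrable_Linfty[OF dominated_prob_Linfty[OF assms]])
qed

lemma dominated_prob_subalgebra:
  assumes "dominated_prob M Q" "subalgebra M G"
  shows "subalgebra Q G" "sigma_finite_subalgebra Q G"
proof -
  show "subalgebra Q G"
    using assms sets_eq_imp_space_eq[of Q M] by (auto simp: dominated_prob_def subalgebra_def)
  then show "sigma_finite_subalgebra Q G"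
    using assms by (intro prob_space.sigma_finite_subalgebraI) (auto simp: dominated_prob_def)
qed

definition penalty_term :: "'a measure \<Rightarrow> 'a measure \<Rightarrow> (('a \<Rightarrow> real) \<Rightarrow> 'a \<Rightarrow> real) \<Rightarrow> ('a \<Rightarrow> real) \<Rightarrow> 'a \<Rightarrow> real"
  where "penalty_term Q G r X = (\<lambda>\<omega>. real_cond_exp Q G (\<lambda>\<omega>. - X \<omega>) \<omega> - r X \<omega>)"

text \<open>A relation, because the penalty is fixed only up to \<open>Q\<close>-null sets: the
  equivalence with (iii) needs one function to serve as the penalty of two risk measures.\<close>

definition is_penalty ::
  "'a measure \<Rightarrow> 'a measure \<Rightarrow> 'a measure \<Rightarrow> (('a \<Rightarrow> real) \<Rightarrow> 'a \<Rightarrow> real) \<Rightarrow> 'a measure \<Rightarrow> ('a \<Rightarrow> ereal) \<Rightarrow> bool"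
  where "is_penalty M H G r Q a \<longleftrightarrow>
    is_ess_sup Q ((\<lambda>u \<omega>. ereal (u \<omega>)) ` penalty_term Q G r ` Linfty M H) a"

text \<open>Positions are \<open>H\<close>-measurable and their risks \<open>G\<close>-measurable,
  but null sets are those of \<open>M\<close>. Sharing \<open>M\<close>, the risk measures for the
  three pairs of stopping times can be composed.\<close>

locale cond_risk = prob_space M for M :: "'a measure" +
  fixes H G :: "'a measure" and r :: "('a \<Rightarrow> real) \<Rightarrow> 'a \<Rightarrow> real"
  assumes sub_H: "subalgebra M H" and sub_G: "subalgebra H G"
    and r_closed: "\<And>X. X \<in> Linfty M H \<Longrightarrow> r X \<in> Linfty M G"
    and r_mono: "\<And>X Y. X \<in> Linfty M H \<Longrightarrow> Y \<in> Linfty M H \<Longrightarrow> AE x in M. X x \<le> Y x \<Longrightarrow> AE x in M. r Y x \<le> r X x"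
    and r_trans: "\<And>X Z. X \<in> Linfty M H \<Longrightarrow> Z \<in> Linfty M G \<Longrightarrow> AE x in M. r (\<lambda>x. X x + Z x) x = r X x - Z x"
    and r_convex: "\<And>X Y l. X \<in> Linfty M H \<Longrightarrow> Y \<in> Linfty M H \<Longrightarrow> 0 \<le> l \<Longrightarrow> l \<le> 1 \<Longrightarrow>
      AE x in M. r (\<lambda>x. l * X x + (1 - l) * Y x) x \<le> l * r X x + (1 - l) * r Y x"
begin

lemma sub_MG: "subalgebra M G"
  by (rule subalgebra_trans[OF sub_H sub_G])

lemma LG_LH: "X \<in> Linfty M G \<Longrightarrow> X \<in> Linfty M H"
  by (rule Linfty_subalgebra[OF sub_G])

lemma r_LH: "X \<in> Linfty M H \<Longrightarrow> r X \<in> Linfty M H"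
  by (rule LG_LH[OF r_closed])

lemma r_cong:
  assumes "X \<in> Linfty M H" "Y \<in> Linfty M H" "AE x in M. X x = Y x"
  shows "AE x in M. r X x = r Y x"
proof -
  have "AE x in M. X x \<le> Y x" "AE x in M. Y x \<le> X x" using assms(3) by (auto elim: eventually_mono)
  from r_mono[OF assms(1,2) this(1)] r_mono[OF assms(2,1) this(2)]
  show ?thesis by eventually_elim simp
qed

lemma r_add_r: "X \<in> Linfty M H \<Longrightarrow> AE x in M. r (\<lambda>x. X x + r X x) x = 0"
  using r_trans[of X "r X"] r_closed[of X] by (auto elim: eventually_mono)

lemma Linfty_if:
  assumes "A \<in> sets H" "X \<in> Linfty M H" "Y \<in> Linfty M H"
  shows "(\<lambda>x. if x \<in> A then X x else Y x) \<in> Linfty M H"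
proof -
  obtain C where C: "AE x in M. \<bar>X x\<bar> \<le> C" using Linfty_bounded[OF assms(2)] by blast
  obtain D where D: "AE x in M. \<bar>Y x\<bar> \<le> D" using Linfty_bounded[OF assms(3)] by blast
  show ?thesis
  proof (rule LinftyI)
    show "AE x in M. \<bar>if x \<in> A then X x else Y x\<bar> \<le> max C D"
      using C D by eventually_elim auto
    show "(\<lambda>x. if x \<in> A then X x else Y x) \<in> borel_measurable H"
      using assms by (intro measurable_If_set) (auto simp: Linfty_def)
  qed
qed

text \<open>Add a \<open>G\<close>-measurable \<open>B\<close> that vanishes on \<open>A\<close> and
  is large enough elsewhere for \<open>X + B\<close> to dominate \<open>Y\<close>. By monotonicity
  and translation invariance \<open>r X - B \<le> r Y\<close>, and on \<open>A\<close> the term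
  \<open>B\<close> disappears.\<close>

lemma r_local_le:
  assumes A: "A \<in> sets G" and X: "X \<in> Linfty M H" and Y: "Y \<in> Linfty M H"
    and eq: "\<And>x. x \<in> A \<Longrightarrow> X x = Y x"
  shows "AE x in M. x \<in> A \<longrightarrow> r X x \<le> r Y x"
proof -
  obtain C where C: "AE x in M. \<bar>X x\<bar> \<le> C" using Linfty_bounded[OF X] by blast
  obtain D where D: "AE x in M. \<bar>Y x\<bar> \<le> D" using Linfty_bounded[OF Y] by blast
  have [measurable]: "A \<in> sets G" by fact
  define B where "B x = (if x \<in> A then 0 else C + D)" for x
  have "B \<in> borel_measurable G" unfolding B_def by measurable
  then have BG: "B \<in> Linfty M G"
    by (rule LinftyI[where C = "\<bar>C + D\<bar>"]) (auto simp: B_def)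
  have "AE x in M. Y x \<le> X x + B x" using C D by eventually_elim (auto simp: B_def eq)
  from r_mono[OF Y Linfty_add[OF X LG_LH[OF BG]] this]
  show ?thesis using r_trans[OF X BG] by eventually_elim (auto simp: B_def)
qed

lemma r_local:
  assumes A: "A \<in> sets G" and X: "X \<in> Linfty M H" and Y: "Y \<in> Linfty M H"
  shows "AE x in M. r (\<lambda>x. if x \<in> A then X x else Y x) x = (if x \<in> A then r X x else r Y x)"
proof -
  let ?W = "\<lambda>x. if x \<in> A then X x else Y x"
  have W: "?W \<in> Linfty M H"
    using A sub_G by (intro Linfty_if X Y) (auto simp: subalgebra_def)
  have B: "space G - A \<in> sets G" using A by auto
  have sp: "space G = space M" using sub_MG by (simp add: subalgebra_def)
  have "AE x in M. x \<in> A \<longrightarrow> r ?W x \<le> r X x" "AE x in M. x \<in> A \<longrightarrow> r X x \<le> r ?W x"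
    "AE x in M. x \<in> space G - A \<longrightarrow> r ?W x \<le> r Y x" "AE x in M. x \<in> space G - A \<longrightarrow> r Y x \<le> r ?W x"
    by (intro r_local_le[OF A] r_local_le[OF B] W X Y; simp)+
  moreover have "AE x in M. x \<in> space M" by simp
  ultimately show ?thesis by eventually_elim (auto simp: sp)
qed

lemma penalty_term_measurable:
  assumes "dominated_prob M Q" "X \<in> Linfty M H"
  shows "penalty_term Q G r X \<in> borel_measurable Q"
proof -
  have "r X \<in> borel_measurable Q"
    using dominated_prob_Linfty[OF assms(1) sub_MG r_closed[OF assms(2)]] by (simp add: Linfty_def)
  then show ?thesis unfolding penalty_term_def by measurable
qed

lemma penalty_term_integrable:
  assumes "dominated_prob M Q" "X \<in> Linfty M H"
  shows "integrable Q (penalty_term Q G r X)"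
proof -
  interpret sigma_finite_subalgebra Q G by (rule dominated_prob_subalgebra[OF assms(1) sub_MG])
  have "integrable Q (real_cond_exp Q G (\<lambda>x. - X x))"
    using dominated_prob_integrable[OF assms(1) sub_H assms(2)] by (intro real_cond_exp_int) auto
  then show ?thesis
    unfolding penalty_term_def
    using dominated_prob_integrable[OF assms(1) sub_MG r_closed[OF assms(2)]] by auto
qed

lemma penalty_term_bounded:
  assumes Q: "dominated_prob M Q" and X: "X \<in> Linfty M H"
  shows "\<exists>c. AE x in Q. \<bar>penalty_term Q G r X x\<bar> \<le> c"
proof -
  interpret sigma_finite_subalgebra Q G by (rule dominated_prob_subalgebra[OF Q sub_MG])
  have mX: "integrable Q (\<lambda>x. - X x)" using dominated_prob_integrable[OF Q sub_H X] by simp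
  obtain C where "AE x in M. \<bar>X x\<bar> \<le> C" using Linfty_bounded[OF X] by blast
  then have C: "AE x in Q. \<bar>X x\<bar> \<le> C" by (rule dominated_prob_AE[OF Q])
  obtain D where "AE x in M. \<bar>r X x\<bar> \<le> D" using Linfty_bounded[OF r_closed[OF X]] by blast
  then have "AE x in Q. \<bar>r X x\<bar> \<le> D" by (rule dominated_prob_AE[OF Q])
  moreover have "AE x in Q. real_cond_exp Q G (\<lambda>x. - X x) x \<le> C"
    using C by (intro real_cond_exp_le_c mX) (auto elim: eventually_mono)
  moreover have "AE x in Q. - C \<le> real_cond_exp Q G (\<lambda>x. - X x) x"
    using C by (intro real_cond_exp_ge_c mX) (auto elim: eventually_mono)
  ultimately have "AE x in Q. \<bar>penalty_term Q G r X x\<bar> \<le> C + D"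
    by eventually_elim (auto simp: penalty_term_def)
  then show ?thesis by blast
qed

text \<open>Take \<open>X\<close> where its term is the larger one and \<open>Y\<close> elsewhere.
  Both terms have \<open>G\<close>-measurable versions, so the set \<open>A\<close> is in
  \<open>G\<close>, and on sets of \<open>G\<close> both the conditional expectation and
  \<open>r\<close> are local.\<close>

lemma penalty_term_directed:
  assumes Q: "dominated_prob M Q" and X: "X \<in> Linfty M H" and Y: "Y \<in> Linfty M H"
  shows "\<exists>W\<in>Linfty M H. AE x in Q. penalty_term Q G r X x \<le> penalty_term Q G r W x \<and>
    penalty_term Q G r Y x \<le> penalty_term Q G r W x"
proof -
  have [measurable]: "r X \<in> borel_measurable G" "r Y \<in> borel_measurable G"
    using r_closed X Y by (auto simp: Linfty_def)
  define A where "A = {x\<in>space G. penalty_term Q G r Y x \<le> penalty_term Q G r X x}"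
  have A: "A \<in> sets G" unfolding A_def penalty_term_def by measurable
  let ?W = "\<lambda>x. if x \<in> A then X x else Y x"
  have W: "?W \<in> Linfty M H"
    using A sub_G by (intro Linfty_if X Y) (auto simp: subalgebra_def)
  have sp: "space G = space Q"
    using dominated_prob_subalgebra(1)[OF Q sub_MG] by (simp add: subalgebra_def)
  have "AE x in Q. r ?W x = (if x \<in> A then r X x else r Y x)"
    by (rule dominated_prob_AE[OF Q r_local[OF A X Y]])
  moreover have "AE x in Q. real_cond_exp Q G (\<lambda>x. - ?W x) x =
    (if x \<in> A then real_cond_exp Q G (\<lambda>x. - X x) x else real_cond_exp Q G (\<lambda>x. - Y x) x)"
    by (intro real_cond_exp_minus_if dominated_prob_subalgebra[OF Q sub_MG] A dominated_prob_integrable[OF Q sub_H] X Y)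
  moreover have "AE x in Q. x \<in> space Q" by simp
  ultimately have "AE x in Q. penalty_term Q G r X x \<le> penalty_term Q G r ?W x \<and>
    penalty_term Q G r Y x \<le> penalty_term Q G r ?W x"
    by eventually_elim (auto simp: penalty_term_def A_def sp)
  then show ?thesis using W by blast
qed

lemma is_penalty_sequence:
  assumes Q: "dominated_prob M Q" and a: "is_penalty M H G r Q a"
  shows "\<exists>X. (\<forall>n. X n \<in> Linfty M H) \<and>
    (\<forall>n. AE x in Q. penalty_term Q G r (X n) x \<le> penalty_term Q G r (X (Suc n)) x) \<and>
    (AE x in Q. (\<lambda>n. ereal (penalty_term Q G r (X n) x)) \<longlonglongrightarrow> a x)"
proof -
  interpret Q: prob_space Q using Q by (simp add: dominated_prob_def)
  have "\<exists>u. (\<forall>n. u n \<in> penalty_term Q G r ` Linfty M H) \<and> (\<forall>n. AE x in Q. u n x \<le> u (Suc n) x) \<and>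
    (AE x in Q. (\<lambda>n. ereal (u n x)) \<longlonglongrightarrow> a x)"
  proof (rule Q.directed_ess_sup_sequence)
    show "penalty_term Q G r ` Linfty M H \<noteq> {}" using Linfty_const by blast
  qed (use a penalty_term_measurable[OF Q] penalty_term_directed[OF Q] in \<open>auto simp: is_penalty_def\<close>)
  then obtain u where u: "\<And>n. u n \<in> penalty_term Q G r ` Linfty M H"
    "\<And>n. AE x in Q. u n x \<le> u (Suc n) x" "AE x in Q. (\<lambda>n. ereal (u n x)) \<longlonglongrightarrow> a x" by blast
  from u(1) have "\<forall>n. \<exists>X\<in>Linfty M H. u n = penalty_term Q G r X" by blast
  then obtain X where "\<And>n. X n \<in> Linfty M H" "\<And>n. u n = penalty_term Q G r (X n)" by metis
  then show ?thesis using u by (intro exI[of _ X]) auto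
qed

lemma is_penalty_exists:
  assumes Q: "dominated_prob M Q"
  shows "\<exists>a. is_penalty M H G r Q a"
proof -
  interpret Q: prob_space Q using Q by (simp add: dominated_prob_def)
  show ?thesis
    unfolding is_penalty_def using penalty_term_measurable[OF Q] by (intro Q.is_ess_sup_exists) auto
qed

end

lemma is_penalty_upper:
  "is_penalty M H G r Q a \<Longrightarrow> X \<in> Linfty M H \<Longrightarrow> AE x in Q. ereal (penalty_term Q G r X x) \<le> a x"
  by (auto simp: is_penalty_def is_ess_sup_def)

lemma is_penalty_least:
  assumes "is_penalty M H G r Q a" "W \<in> borel_measurable Q"
    "\<And>X. X \<in> Linfty M H \<Longrightarrow> AE x in Q. ereal (penalty_term Q G r X x) \<le> W x"
  shows "AE x in Q. a x \<le> W x"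
  using assms by (auto simp: is_penalty_def is_ess_sup_def)

lemma is_penalty_measurable: "is_penalty M H G r Q a \<Longrightarrow> a \<in> borel_measurable Q"
  by (simp add: is_penalty_def is_ess_sup_def)

text \<open>The tower property splits the term of \<open>X\<close> under \<open>r1\<close> into the
  term of \<open>- r3 X\<close> under \<open>r2\<close> and the conditional expectation of the term
  of \<open>X\<close> under \<open>r3\<close>, which gives one inequality. For the other, the
  position at the intermediate stage and the acceptable remainder can be chosen independently of
  each other.\<close>

lemma penalty_cocycle:
  assumes r1: "cond_risk M K G r1" and r2: "cond_risk M H G r2" and r3: "cond_risk M K H r3"
    and tc: "\<And>X. X \<in> Linfty M K \<Longrightarrow> AE x in M. r1 X x = r2 (\<lambda>x. - r3 X x) x"
    and Q: "dominated_prob M Q"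
    and a1: "is_penalty M K G r1 Q a1" and a2: "is_penalty M H G r2 Q a2" and a3: "is_penalty M K H r3 Q a3"
  shows "AE x in Q. a1 x = a2 x + ereal_cond_exp Q G a3 x"
proof -
  interpret r1: cond_risk M K G r1 by fact
  interpret r2: cond_risk M H G r2 by fact
  interpret r3: cond_risk M K H r3 by fact
  interpret QG: sigma_finite_subalgebra Q G by (rule dominated_prob_subalgebra[OF Q r1.sub_MG])
  note [measurable] = is_penalty_measurable[OF a1] is_penalty_measurable[OF a2] is_penalty_measurable[OF a3]
  note AEQ = dominated_prob_AE[OF Q]
  note intK = dominated_prob_integrable[OF Q r3.sub_H]
  note intH = dominated_prob_integrable[OF Q r2.sub_H]
  have subQH: "subalgebra Q H" by (rule dominated_prob_subalgebra[OF Q r2.sub_H])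
  interpret QH: sigma_finite_subalgebra Q H by (rule dominated_prob_subalgebra[OF Q r2.sub_H])
  have tower: "AE x in Q. real_cond_exp Q G (\<lambda>x. - X x) x =
    real_cond_exp Q G (penalty_term Q H r3 X) x + real_cond_exp Q G (r3 X) x" if X: "X \<in> Linfty M K" for X
  proof -
    have mX: "integrable Q (\<lambda>x. - X x)" using intK[OF X] by simp
    have rX: "integrable Q (r3 X)" by (rule intH[OF r3.r_closed[OF X]])
    have eX: "integrable Q (real_cond_exp Q H (\<lambda>x. - X x))" by (rule QH.real_cond_exp_int[OF mX])
    have "AE x in Q. real_cond_exp Q G (penalty_term Q H r3 X) x =
      real_cond_exp Q G (real_cond_exp Q H (\<lambda>x. - X x)) x - real_cond_exp Q G (r3 X) x"
      unfolding penalty_term_def by (rule QG.real_cond_exp_diff[OF eX rX])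
    moreover have "AE x in Q. real_cond_exp Q G (real_cond_exp Q H (\<lambda>x. - X x)) x = real_cond_exp Q G (\<lambda>x. - X x) x"
      by (rule QG.real_cond_exp_nested_subalg[OF subQH r2.sub_G mX])
    ultimately show ?thesis by eventually_elim simp
  qed
  have le: "AE x in Q. a1 x \<le> a2 x + ereal_cond_exp Q G a3 x"
  proof (rule is_penalty_least[OF a1])
    show "(\<lambda>x. a2 x + ereal_cond_exp Q G a3 x) \<in> borel_measurable Q"
      unfolding ereal_cond_exp_def by measurable
    fix X assume X: "X \<in> Linfty M K"
    have rX: "r3 X \<in> Linfty M H" by (rule r3.r_closed[OF X])
    have int: "integrable Q (penalty_term Q H r3 X)" by (rule r3.penalty_term_integrable[OF Q X])
    have "AE x in Q. ereal (penalty_term Q G r2 (\<lambda>x. - r3 X x) x) \<le> a2 x"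
      by (rule is_penalty_upper[OF a2 Linfty_minus[OF rX]])
    moreover have "AE x in Q. ereal_cond_exp Q G (\<lambda>x. ereal (penalty_term Q H r3 X x)) x \<le> ereal_cond_exp Q G a3 x"
      using int by (intro QG.ereal_cond_exp_mono is_penalty_upper[OF a3 X]) auto
    ultimately show "AE x in Q. ereal (penalty_term Q G r1 X x) \<le> a2 x + ereal_cond_exp Q G a3 x"
      using tower[OF X] AEQ[OF tc[OF X]] QG.ereal_cond_exp_real[OF int]
    proof eventually_elim
      case (elim x)
      have "penalty_term Q G r1 X x = penalty_term Q G r2 (\<lambda>x. - r3 X x) x + real_cond_exp Q G (penalty_term Q H r3 X) x"
        unfolding penalty_term_def[of Q G] using elim by simp
      then have "ereal (penalty_term Q G r1 X x) =
        ereal (penalty_term Q G r2 (\<lambda>x. - r3 X x) x) + ereal (real_cond_exp Q G (penalty_term Q H r3 X) x)" by simp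
      also have "\<dots> \<le> a2 x + ereal_cond_exp Q G a3 x" using elim by (intro add_mono) auto
      finally show ?case .
    qed
  qed
  obtain X where X: "\<And>n. X n \<in> Linfty M K"
    and incr: "\<And>n. AE x in Q. penalty_term Q H r3 (X n) x \<le> penalty_term Q H r3 (X (Suc n)) x"
    and lim: "AE x in Q. (\<lambda>n. ereal (penalty_term Q H r3 (X n) x)) \<longlonglongrightarrow> a3 x"
    using r3.is_penalty_sequence[OF Q a3] by blast
  define v where "v n = real_cond_exp Q G (penalty_term Q H r3 (X n))" for n
  have [measurable]: "v n \<in> borel_measurable Q" for n unfolding v_def by measurable
  have upper: "AE x in Q. a2 x + ereal (v n x) \<le> a1 x" for n
  proof -
    \<comment> \<open>As \<open>v n\<close> is real it can change sides, and the leastness of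
      \<open>a2\<close> applies for each \<open>n\<close> separately, before the limit is
      taken.\<close>
    have "AE x in Q. a2 x \<le> a1 x - ereal (v n x)"
    proof (rule is_penalty_least[OF a2])
      fix Y assume Y: "Y \<in> Linfty M H"
      have YK: "Y \<in> Linfty M K" by (rule r3.LG_LH[OF Y])
      have rX: "r3 (X n) \<in> Linfty M H" by (rule r3.r_closed[OF X])
      \<comment> \<open>\<open>X n + r3 (X n)\<close> has risk 0 under \<open>r3\<close>, so
        \<open>- r3 W = Y\<close> almost surely and the term of \<open>W\<close> under
        \<open>r1\<close> is the term of \<open>Y\<close> under \<open>r2\<close> plus
        \<open>v n\<close>.\<close>
      define W where "W x = (X n x + r3 (X n) x) + Y x" for x
      have XrK: "(\<lambda>x. X n x + r3 (X n) x) \<in> Linfty M K" by (intro Linfty_add X r3.r_LH)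
      have WK: "W \<in> Linfty M K" unfolding W_def by (intro Linfty_add[OF XrK YK])
      have "AE x in M. - r3 W x = Y x"
        using r3.r_trans[OF XrK Y] r3.r_add_r[OF X[of n]] unfolding W_def by eventually_elim simp
      then have "AE x in M. r2 (\<lambda>x. - r3 W x) x = r2 Y x"
        by (intro r2.r_cong Linfty_minus r3.r_closed WK Y)
      with tc[OF WK] have r1W: "AE x in M. r1 W x = r2 Y x" by eventually_elim simp
      have mX: "integrable Q (\<lambda>x. - X n x)" using intK[OF X] by simp
      have rXi: "integrable Q (r3 (X n))" by (rule intH[OF rX])
      have mY: "integrable Q (\<lambda>x. - Y x)" using intH[OF Y] by simp
      have "AE x in Q. real_cond_exp Q G (\<lambda>x. (- X n x - r3 (X n) x) + (- Y x)) x =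
        real_cond_exp Q G (\<lambda>x. - X n x - r3 (X n) x) x + real_cond_exp Q G (\<lambda>x. - Y x) x"
        by (rule QG.real_cond_exp_add) (use mX rXi mY in auto)
      moreover have "AE x in Q. real_cond_exp Q G (\<lambda>x. - X n x - r3 (X n) x) x =
        real_cond_exp Q G (\<lambda>x. - X n x) x - real_cond_exp Q G (r3 (X n)) x"
        by (rule QG.real_cond_exp_diff[OF mX rXi])
      moreover have "(\<lambda>x. (- X n x - r3 (X n) x) + (- Y x)) = (\<lambda>x. - W x)" by (auto simp: W_def)
      ultimately have eW: "AE x in Q. real_cond_exp Q G (\<lambda>x. - W x) x = v n x + real_cond_exp Q G (\<lambda>x. - Y x) x"
        using tower[OF X[of n]] unfolding v_def by simp (elim AE_mp, auto intro!: AE_I2)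
      show "AE x in Q. ereal (penalty_term Q G r2 Y x) \<le> a1 x - ereal (v n x)"
        using is_penalty_upper[OF a1 WK] eW AEQ[OF r1W]
      proof eventually_elim
        case (elim x)
        then have "ereal (penalty_term Q G r2 Y x + v n x) \<le> a1 x"
          by (simp add: penalty_term_def algebra_simps)
        then show ?case by (cases "a1 x") auto
      qed
    qed measurable
    then show ?thesis by eventually_elim (simp add: ereal_le_minus)
  qed
  have "AE x in Q. (\<lambda>n. ereal (v n x)) \<longlonglongrightarrow> ereal_cond_exp Q G a3 x"
  proof -
    obtain c where "AE x in Q. \<bar>penalty_term Q H r3 (X 0) x\<bar> \<le> c"
      using r3.penalty_term_bounded[OF Q X] by blast
    then show ?thesis
      unfolding v_def using r3.penalty_term_integrable[OF Q X] incr lim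
      by (intro QG.ereal_cond_exp_monotone_convergence) auto
  qed
  moreover have "AE x in Q. \<forall>n. a2 x + ereal (v n x) \<le> a1 x" using upper by (simp add: AE_all_countable)
  \<comment> \<open>This excludes the value -\<infinity> of \<open>a2\<close>. The value \<infinity>
    is settled without a limit, and for a real value addition is continuous.\<close>
  moreover have "AE x in Q. ereal (penalty_term Q G r2 (\<lambda>_. 0) x) \<le> a2 x"
    by (rule is_penalty_upper[OF a2 Linfty_const])
  ultimately have "AE x in Q. a2 x + ereal_cond_exp Q G a3 x \<le> a1 x"
  proof eventually_elim
    case (elim x)
    show ?case
    proof (cases "a2 x")
      case PInf
      then show ?thesis using elim(2) by auto
    next
      case (real b)
      have "(\<lambda>n. a2 x + ereal (v n x)) \<longlonglongrightarrow> a2 x + ereal_cond_exp Q G a3 x"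
        using elim(1) real by (intro tendsto_add_ereal_general2) auto
      then show ?thesis using elim(2) by (auto intro: LIMSEQ_le_const2)
    qed (use elim in auto)
  qed
  with le show ?thesis by eventually_elim simp
qed

section \<open>A conditional risk measure is determined by its penalties\<close>

locale cond_risk_cfa = cond_risk +
  assumes cont: "\<And>X Y. (\<And>n. X n \<in> Linfty M H) \<Longrightarrow> Y \<in> Linfty M H \<Longrightarrow>
      (\<And>n. AE x in M. X (Suc n) x \<le> X n x) \<Longrightarrow> AE x in M. (\<lambda>n::nat. X n x) \<longlonglongrightarrow> Y x \<Longrightarrow>
      AE x in M. (\<lambda>n. r (X n) x) \<longlonglongrightarrow> r Y x"
begin

text \<open>The suprema \<open>B n\<close> over the tails decrease to \<open>Y\<close> and dominate
  \<open>X n\<close>. So they are acceptable, and continuity from above applies to them.\<close>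

lemma fatou:
  assumes X: "\<And>n. X n \<in> Linfty M H" and Y: "Y \<in> Linfty M H"
    and bd: "\<And>n::nat. AE x in M. \<bar>X n x\<bar> \<le> C"
    and lim: "AE x in M. (\<lambda>n. X n x) \<longlonglongrightarrow> Y x"
    and acc: "\<And>n. AE x in M. r (X n) x \<le> 0"
  shows "AE x in M. r Y x \<le> 0"
proof -
  \<comment> \<open>Truncation makes the tails bounded at every point, not just almost everywhere;
    this keeps the real suprema meaningful and \<open>B n\<close> measurable.\<close>
  define T where "T n x = max (- C) (min C (X n x))" for n x
  define B where "B n x = (SUP m\<in>{n..}. T m x)" for n x
  have [measurable]: "X n \<in> borel_measurable H" for n using X by (simp add: Linfty_def)
  have [measurable]: "T n \<in> borel_measurable H" for n unfolding T_def by measurable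
  have Tb: "\<bar>T n x\<bar> \<le> \<bar>C\<bar>" for n x by (auto simp: T_def)
  have bdd: "bdd_above ((\<lambda>m. T m x) ` {n..})" for n x
    using Tb[of _ x] by (intro bdd_aboveI2[where M = "\<bar>C\<bar>"]) (auto simp: abs_le_iff)
  have [measurable]: "B n \<in> borel_measurable H" for n
    unfolding B_def using bdd by (intro borel_measurable_cSUP) auto
  have T_le_B: "T m x \<le> B n x" if "n \<le> m" for n m x
    unfolding B_def using that bdd by (intro cSUP_upper) auto
  have B_le: "B n x \<le> c" if "\<And>m. n \<le> m \<Longrightarrow> T m x \<le> c" for n x c
    unfolding B_def using that by (intro cSUP_least) auto
  have BL: "B n \<in> Linfty M H" for n
  proof (rule LinftyI)
    have "\<bar>B n x\<bar> \<le> \<bar>C\<bar>" for x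
    proof -
      have "B n x \<le> \<bar>C\<bar>" using Tb[of _ x] by (intro B_le) (auto simp: abs_le_iff)
      moreover have "- \<bar>C\<bar> \<le> B n x" using T_le_B[of n n x] Tb[of n x] by (auto simp: abs_le_iff)
      ultimately show ?thesis by (auto simp: abs_le_iff)
    qed
    then show "AE x in M. \<bar>B n x\<bar> \<le> \<bar>C\<bar>" by simp
  qed measurable
  have TX: "AE x in M. \<forall>n. T n x = X n x"
    unfolding AE_all_countable
  proof
    fix n show "AE x in M. T n x = X n x" using bd[of n] by eventually_elim (auto simp: T_def)
  qed
  have "AE x in M. (\<lambda>n. r (B n) x) \<longlonglongrightarrow> r Y x"
  proof (rule cont[OF BL Y])
    show "AE x in M. B (Suc n) x \<le> B n x" for n
      using T_le_B by (intro AE_I2 B_le) auto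
    show "AE x in M. (\<lambda>n. B n x) \<longlonglongrightarrow> Y x"
      using TX lim
    proof eventually_elim
      case (elim x)
      show ?case
      proof (rule LIMSEQ_I)
        fix e :: real assume "0 < e"
        then obtain N where N: "\<And>n. N \<le> n \<Longrightarrow> norm (X n x - Y x) < e / 2"
          using LIMSEQ_D[OF elim(2), of "e / 2"] by auto
        have "norm (B n x - Y x) < e" if n: "N \<le> n" for n
        proof -
          have "B n x \<le> Y x + e / 2"
          proof (rule B_le)
            fix m assume "n \<le> m"
            then have "\<bar>X m x - Y x\<bar> < e / 2" using N[of m] n by simp
            then have "X m x \<le> Y x + e / 2" by linarith
            then show "T m x \<le> Y x + e / 2" using elim(1) by simp
          qed
          moreover have "\<bar>X n x - Y x\<bar> < e / 2" using N[OF n] by simp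
          then have "Y x - e / 2 \<le> X n x" by linarith
          then have "Y x - e / 2 \<le> B n x"
            using T_le_B[of n n x] elim(1) by simp
          ultimately have "\<bar>B n x - Y x\<bar> < e" using \<open>0 < e\<close> by linarith
          then show ?thesis by simp
        qed
        then show "\<exists>N. \<forall>n\<ge>N. norm (B n x - Y x) < e" by blast
      qed
    qed
  qed
  moreover have "AE x in M. \<forall>n. r (B n) x \<le> 0"
    unfolding AE_all_countable
  proof
    fix n
    have "AE x in M. X n x \<le> B n x"
      using TX
    proof eventually_elim
      case (elim x)
      then show ?case using T_le_B[of n n x] by simp
    qed
    from r_mono[OF X BL this] acc[of n] show "AE x in M. r (B n) x \<le> 0"
      by eventually_elim simp
  qed
  ultimately show ?thesis by eventually_elim (auto intro: LIMSEQ_le_const2)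
qed

text \<open>\<open>S\<close> is the acceptance set translated by \<open>- X\<close>; it misses 0
  since \<open>X\<close> is not acceptable, and its closedness is \<open>fatou\<close>. The
  functional obtained from \<open>separation\<close> is normalised to a probability density.\<close>

lemma acceptance_separation:
  assumes H: "sets H = sets M" and X: "X \<in> Linfty M H" and nacc: "\<not> (AE x in M. r X x \<le> 0)"
  shows "\<exists>Q e. dominated_prob M Q \<and> 0 < e \<and>
    (\<forall>Y\<in>Linfty M H. (AE x in M. r Y x \<le> 0) \<longrightarrow> (\<integral>x. X x \<partial>Q) + e \<le> (\<integral>x. Y x \<partial>Q))"
proof -
  have LHM: "Linfty M H = Linfty M M" by (simp add: Linfty_def measurable_cong_sets[OF H refl])
  define S where "S = {V \<in> Linfty M M. AE x in M. r (\<lambda>x. X x + V x) x \<le> 0}"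
  have XV: "(\<lambda>x. X x + V x) \<in> Linfty M H" if "V \<in> Linfty M M" for V
    using that X by (intro Linfty_add) (simp_all add: LHM)
  interpret bounded_upset M S
  proof
    show "S \<subseteq> Linfty M M" by (auto simp: S_def)
    show "(\<lambda>x. (1 - t) * u x + t * v x) \<in> S" if uv: "u \<in> S" "v \<in> S" and t: "0 \<le> t" "t \<le> 1" for u v and t :: real
    proof -
      have L: "u \<in> Linfty M M" "v \<in> Linfty M M" using uv by (auto simp: S_def)
      have eq: "(\<lambda>x. (1 - t) * (X x + u x) + (1 - (1 - t)) * (X x + v x)) = (\<lambda>x. X x + ((1 - t) * u x + t * v x))"
        by (auto simp: algebra_simps)
      have "AE x in M. r (\<lambda>x. (1 - t) * (X x + u x) + (1 - (1 - t)) * (X x + v x)) x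
        \<le> (1 - t) * r (\<lambda>x. X x + u x) x + (1 - (1 - t)) * r (\<lambda>x. X x + v x) x"
        using t by (intro r_convex XV L) auto
      moreover have "AE x in M. r (\<lambda>x. X x + u x) x \<le> 0" "AE x in M. r (\<lambda>x. X x + v x) x \<le> 0"
        using uv by (auto simp: S_def)
      ultimately have "AE x in M. r (\<lambda>x. X x + ((1 - t) * u x + t * v x)) x \<le> 0"
        unfolding eq
      proof eventually_elim
        case (elim x)
        have "(1 - t) * r (\<lambda>x. X x + u x) x \<le> 0" "t * r (\<lambda>x. X x + v x) x \<le> 0"
          using elim t by (auto intro: mult_nonneg_nonpos)
        then show ?case using elim(1) by simp
      qed
      then show ?thesis using Linfty_lincomb[OF L] by (simp add: S_def)
    qed
    show "v \<in> S" if "u \<in> S" "v \<in> Linfty M M" "AE x in M. u x \<le> v x" for u v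
    proof -
      have "AE x in M. r (\<lambda>x. X x + v x) x \<le> r (\<lambda>x. X x + u x) x"
        using that by (intro r_mono XV) (auto simp: S_def)
      moreover have "AE x in M. r (\<lambda>x. X x + u x) x \<le> 0" using that by (simp add: S_def)
      ultimately have "AE x in M. r (\<lambda>x. X x + v x) x \<le> 0" by eventually_elim simp
      then show ?thesis using that by (simp add: S_def)
    qed
    show "W \<in> S" if V: "\<And>n. V n \<in> S" "\<And>n. AE x in M. \<bar>V n x\<bar> \<le> C" and W: "W \<in> borel_measurable M"
      and lim: "AE x in M. (\<lambda>n::nat. V n x) \<longlonglongrightarrow> W x" for V W C
    proof -
      have VL: "V n \<in> Linfty M M" for n using V(1) by (auto simp: S_def)
      have "AE x in M. \<forall>n. \<bar>V n x\<bar> \<le> C" using V(2) by (simp add: AE_all_countable)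
      then have "AE x in M. \<bar>W x\<bar> \<le> C" using lim
      proof eventually_elim
        case (elim x)
        then show ?case using tendsto_rabs[OF elim(2)] by (auto intro: LIMSEQ_le_const2)
      qed
      with W have WL: "W \<in> Linfty M M" by (rule LinftyI)
      obtain D where D: "AE x in M. \<bar>X x\<bar> \<le> D" using Linfty_bounded[OF X] by blast
      have "AE x in M. r (\<lambda>x. X x + W x) x \<le> 0"
      proof (rule fatou[OF XV[OF VL] XV[OF WL]])
        show "AE x in M. \<bar>X x + V n x\<bar> \<le> D + C" for n
          using D V(2)[of n] by eventually_elim auto
        show "AE x in M. (\<lambda>n. X x + V n x) \<longlonglongrightarrow> X x + W x"
          using lim by eventually_elim (intro tendsto_intros)
        show "AE x in M. r (\<lambda>x. X x + V n x) x \<le> 0" for n using V(1)[of n] by (simp add: S_def)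
      qed
      then show ?thesis using WL by (simp add: S_def)
    qed
    show "(\<lambda>_. 0) \<notin> S" using nacc by (simp add: S_def)
  qed
  have rX: "r X \<in> Linfty M M" using r_LH[OF X] by (simp add: LHM)
  \<comment> \<open>Adding its own risk makes \<open>X\<close> acceptable, so \<open>S\<close> is
    not empty. This also excludes a vanishing \<open>Z\<close> below, whose integrals could not be
    at least \<delta>.\<close>
  have rXS: "r X \<in> S" using r_add_r[OF X] rX by (auto simp: S_def elim: eventually_mono)
  then obtain Z \<delta> where Z: "integrable M Z" "\<And>x. 0 \<le> Z x" and \<delta>: "0 < \<delta>"
    and sep: "\<And>V. V \<in> S \<Longrightarrow> \<delta> \<le> (\<integral>x. Z x * V x \<partial>M)"
    using separation by blast
  have [measurable]: "Z \<in> borel_measurable M" using Z by measurable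
  define c where "c = (\<integral>x. Z x \<partial>M)"
  have c: "0 < c"
  proof -
    have "c \<noteq> 0"
    proof
      assume "c = 0"
      then have "AE x in M. Z x = 0" using Z by (simp add: c_def integral_nonneg_eq_0_iff_AE)
      then have "AE x in M. Z x * r X x = 0" by eventually_elim simp
      then have "(\<integral>x. Z x * r X x \<partial>M) = 0" by (rule integral_eq_zero_AE)
      then show False using sep[OF rXS] \<delta> by simp
    qed
    then show ?thesis using Z by (simp add: c_def less_le)
  qed
  define Q where "Q = density M (\<lambda>x. ennreal (Z x / c))"
  have Q: "dominated_prob M Q"
    unfolding dominated_prob_def
  proof (intro conjI)
    have "emeasure Q (space Q) = (\<integral>\<^sup>+x. ennreal (Z x / c) \<partial>M)"
      unfolding Q_def by (subst emeasure_density) (auto intro!: nn_integral_cong)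
    also have "\<dots> = 1" using Z c by (subst nn_integral_eq_integral) (auto simp: c_def)
    finally show "prob_space Q" by (rule prob_spaceI)
    show "absolutely_continuous M Q" unfolding Q_def by (rule absolutely_continuousI_density) measurable
  qed (simp add: Q_def)
  have int_Q: "(\<integral>x. Y x \<partial>Q) = (\<integral>x. Z x * Y x \<partial>M) / c" if "Y \<in> Linfty M M" for Y
  proof -
    have "(\<integral>x. Y x \<partial>Q) = (\<integral>x. Z x / c * Y x \<partial>M)"
      unfolding Q_def using that Z c by (subst integral_real_density) (auto simp: Linfty_def)
    then show ?thesis by simp
  qed
  have "(\<integral>x. X x \<partial>Q) + \<delta> / c \<le> (\<integral>x. Y x \<partial>Q)" if Y: "Y \<in> Linfty M H" "AE x in M. r Y x \<le> 0" for Y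
  proof -
    have XM: "X \<in> Linfty M M" and YM: "Y \<in> Linfty M M" using X Y LHM by auto
    have "(\<lambda>x. Y x - X x) \<in> S" using Y Linfty_diff[OF YM XM] by (simp add: S_def)
    from sep[OF this] have "\<delta> \<le> (\<integral>x. Z x * Y x - Z x * X x \<partial>M)" by (simp add: right_diff_distrib)
    also have "\<dots> = (\<integral>x. Z x * Y x \<partial>M) - (\<integral>x. Z x * X x \<partial>M)"
      using Z XM YM by (intro Bochner_Integration.integral_diff integrable_mult_Linfty)
    finally have "\<delta> / c \<le> (\<integral>x. Z x * Y x \<partial>M) / c - (\<integral>x. Z x * X x \<partial>M) / c"
      using c by (simp add: field_simps)
    then show ?thesis by (simp add: int_Q[OF XM] int_Q[OF YM])
  qed
  then show ?thesis using Q \<delta> c by (intro exI[of _ Q] exI[of _ "\<delta> / c"]) auto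
qed

end

text \<open>A measure \<open>Q\<close> that separates an \<open>r1\<close>-acceptable position from
  the acceptance set of \<open>r2\<close> gives that position a penalty term under \<open>r1\<close>
  whose \<open>Q\<close>-expectation exceeds those of all terms under \<open>r2\<close> by a fixed
  amount. The common penalty \<open>a\<close> is a limit of the latter and dominates the former, a
  contradiction.\<close>

lemma penalty_determines_le:
  assumes r1: "cond_risk M K G r1" and r2: "cond_risk_cfa M K G r2" and K: "sets K = sets M"
    and pen: "\<And>Q. dominated_prob M Q \<Longrightarrow> \<exists>a. is_penalty M K G r1 Q a \<and> is_penalty M K G r2 Q a"
    and X: "X \<in> Linfty M K"
  shows "AE x in M. r2 X x \<le> r1 X x"
proof (rule ccontr)
  assume neg: "\<not> ?thesis"
  interpret r1: cond_risk M K G r1 by fact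
  interpret r2: cond_risk_cfa M K G r2 by fact
  \<comment> \<open>The translate with \<open>r1\<close>-risk 0; if \<open>r2\<close> accepted it,
    translation invariance would give \<open>r2 X \<le> r1 X\<close>.\<close>
  define X' where "X' x = X x + r1 X x" for x
  have X': "X' \<in> Linfty M K" unfolding X'_def by (intro Linfty_add X r1.r_LH)
  have r1X': "AE x in M. r1 X' x = 0" unfolding X'_def by (rule r1.r_add_r[OF X])
  have "\<not> (AE x in M. r2 X' x \<le> 0)"
  proof
    assume "AE x in M. r2 X' x \<le> 0"
    with r2.r_trans[OF X r1.r_closed[OF X]] have "AE x in M. r2 X x \<le> r1 X x"
      unfolding X'_def by eventually_elim simp
    with neg show False by simp
  qed
  then obtain Q e where Q: "dominated_prob M Q" and e: "0 < e"
    and sep: "\<And>Y. Y \<in> Linfty M K \<Longrightarrow> AE x in M. r2 Y x \<le> 0 \<Longrightarrow> (\<integral>x. X' x \<partial>Q) + e \<le> (\<integral>x. Y x \<partial>Q)"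
    using r2.acceptance_separation[OF K X'] by blast
  interpret QG: sigma_finite_subalgebra Q G by (rule dominated_prob_subalgebra[OF Q r1.sub_MG])
  obtain a where a1: "is_penalty M K G r1 Q a" and a2: "is_penalty M K G r2 Q a" using pen[OF Q] by blast
  obtain Y where Y: "\<And>n. Y n \<in> Linfty M K"
    and incr: "\<And>n. AE x in Q. penalty_term Q G r2 (Y n) x \<le> penalty_term Q G r2 (Y (Suc n)) x"
    and lim: "AE x in Q. (\<lambda>n. ereal (penalty_term Q G r2 (Y n) x)) \<longlonglongrightarrow> a x"
    using r2.is_penalty_sequence[OF Q a2] by blast
  define u where "u n = penalty_term Q G r2 (Y n)" for n
  have u: "integrable Q (u n)" for n unfolding u_def by (rule r2.penalty_term_integrable[OF Q Y])
  define w where "w = penalty_term Q G r1 X'"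
  have w: "integrable Q w" unfolding w_def by (rule r1.penalty_term_integrable[OF Q X'])
  note intK = dominated_prob_integrable[OF Q r1.sub_H]
  note intG = dominated_prob_integrable[OF Q r1.sub_MG]
  have int_term: "(\<integral>x. penalty_term Q G r V x \<partial>Q) = - (\<integral>x. V x + r V x \<partial>Q)"
    if "V \<in> Linfty M K" "r V \<in> Linfty M G" for r V
  proof -
    have mV: "integrable Q (\<lambda>x. - V x)" using intK[OF that(1)] by simp
    have "(\<integral>x. penalty_term Q G r V x \<partial>Q) = (\<integral>x. real_cond_exp Q G (\<lambda>x. - V x) x \<partial>Q) - (\<integral>x. r V x \<partial>Q)"
      unfolding penalty_term_def by (intro Bochner_Integration.integral_diff QG.real_cond_exp_int mV intG that)
    also have "(\<integral>x. real_cond_exp Q G (\<lambda>x. - V x) x \<partial>Q) = - (\<integral>x. V x \<partial>Q)"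
      by (simp add: QG.real_cond_exp_int(2)[OF mV])
    finally show ?thesis using intK[OF that(1)] intG[OF that(2)] by simp
  qed
  \<comment> \<open>\<open>Y n + r2 (Y n)\<close> is accepted by \<open>r2\<close>, and the
    expectation of the term of \<open>Y n\<close> is minus the expectation of this position, so the
    separation applies to it.\<close>
  have int_u: "(\<integral>x. u n x \<partial>Q) \<le> (\<integral>x. w x \<partial>Q) - e" for n
  proof -
    have "(\<integral>x. X' x \<partial>Q) + e \<le> (\<integral>x. Y n x + r2 (Y n) x \<partial>Q)"
      using r2.r_add_r[OF Y[of n]] by (intro sep Linfty_add Y r2.r_LH) (auto elim: eventually_mono)
    moreover have "(\<integral>x. u n x \<partial>Q) = - (\<integral>x. Y n x + r2 (Y n) x \<partial>Q)"
      unfolding u_def by (intro int_term r2.r_closed Y)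
    moreover have "(\<integral>x. w x \<partial>Q) = - (\<integral>x. X' x + r1 X' x \<partial>Q)"
      unfolding w_def by (intro int_term r1.r_closed X')
    moreover have "(\<integral>x. X' x + r1 X' x \<partial>Q) = (\<integral>x. X' x \<partial>Q)"
      using dominated_prob_AE[OF Q r1X'] intK[OF X'] intG[OF r1.r_closed[OF X']]
      by (intro integral_cong_AE) (auto elim: eventually_mono)
    ultimately show ?thesis by simp
  qed
  have "AE x in Q. \<forall>n. u n x \<le> u (Suc n) x" using incr by (simp add: u_def AE_all_countable)
  then have inc: "AE x in Q. incseq (\<lambda>n. u n x)" by (simp add: incseq_Suc_iff)
  have wa: "AE x in Q. ereal (w x) \<le> a x" unfolding w_def by (rule is_penalty_upper[OF a1 X'])
  \<comment> \<open>The limit \<open>a\<close> of \<open>u n\<close> may be infinite or not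
    integrable. Cutting at \<open>w\<close>, which lies below \<open>a\<close>, gives a dominated
    sequence with limit \<open>w\<close>.\<close>
  have "(\<lambda>n. \<integral>x. min (u n x) (w x) \<partial>Q) \<longlonglongrightarrow> (\<integral>x. w x \<partial>Q)"
  proof (rule integral_dominated_convergence)
    show "integrable Q (\<lambda>x. \<bar>u 0 x\<bar> + \<bar>w x\<bar>)" using u w by auto
    show "AE x in Q. norm (min (u n x) (w x)) \<le> \<bar>u 0 x\<bar> + \<bar>w x\<bar>" for n
      using inc
    proof eventually_elim
      case (elim x)
      have "u 0 x \<le> u n x" using elim by (auto dest: incseqD)
      then show ?case by (auto simp: min_def)
    qed
    show "AE x in Q. (\<lambda>n. min (u n x) (w x)) \<longlonglongrightarrow> w x"
      using lim wa
    proof eventually_elim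
      case (elim x)
      then have "(\<lambda>n. min (ereal (u n x)) (ereal (w x))) \<longlonglongrightarrow> min (a x) (ereal (w x))"
        unfolding u_def by (intro tendsto_min tendsto_const)
      then show ?case using elim(2) by (simp add: min_absorb2 flip: ereal_min)
    qed
  qed (use u w in auto)
  moreover have "(\<integral>x. min (u n x) (w x) \<partial>Q) \<le> (\<integral>x. w x \<partial>Q) - e" for n
  proof -
    have "(\<integral>x. min (u n x) (w x) \<partial>Q) \<le> (\<integral>x. u n x \<partial>Q)" using u w by (intro integral_mono) auto
    then show ?thesis using int_u[of n] by simp
  qed
  ultimately have "(\<integral>x. w x \<partial>Q) \<le> (\<integral>x. w x \<partial>Q) - e" by (blast intro: LIMSEQ_le_const2)
  then show False using e by simp
qed

section \<open>Time consistency\<close>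

text \<open>The minus sign makes the inner map increasing and concave, which is what monotonicity
  and convexity of \<open>r2\<close> need, and decreasing sequences of positions stay decreasing
  inside.\<close>

lemma cond_risk_cfa_compose:
  assumes r2: "cond_risk_cfa M H G r2" and r3: "cond_risk_cfa M K H r3"
  shows "cond_risk_cfa M K G (\<lambda>X. r2 (\<lambda>x. - r3 X x))"
proof -
  interpret r2: cond_risk_cfa M H G r2 by fact
  interpret r3: cond_risk_cfa M K H r3 by fact
  have m: "(\<lambda>x. - r3 X x) \<in> Linfty M H" if "X \<in> Linfty M K" for X
    by (intro Linfty_minus r3.r_closed that)
  show ?thesis
  proof
    show "subalgebra M K" by (rule r3.sub_H)
    show "subalgebra K G" by (rule subalgebra_trans[OF r3.sub_G r2.sub_G])
    show "r2 (\<lambda>x. - r3 X x) \<in> Linfty M G" if "X \<in> Linfty M K" for X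
      by (intro r2.r_closed m that)
    show "AE x in M. r2 (\<lambda>x. - r3 Y x) x \<le> r2 (\<lambda>x. - r3 X x) x"
      if "X \<in> Linfty M K" "Y \<in> Linfty M K" "AE x in M. X x \<le> Y x" for X Y
      using r3.r_mono[OF that] by (intro r2.r_mono m that) auto
    show "AE x in M. r2 (\<lambda>x. - r3 (\<lambda>x. X x + Z x) x) x = r2 (\<lambda>x. - r3 X x) x - Z x"
      if X: "X \<in> Linfty M K" and Z: "Z \<in> Linfty M G" for X Z
    proof -
      have ZH: "Z \<in> Linfty M H" by (rule r2.LG_LH[OF Z])
      have "AE x in M. r2 (\<lambda>x. - r3 (\<lambda>x. X x + Z x) x) x = r2 (\<lambda>x. - r3 X x + Z x) x"
      proof (rule r2.r_cong)
        show "(\<lambda>x. - r3 (\<lambda>x. X x + Z x) x) \<in> Linfty M H"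
          by (intro m Linfty_add X r3.LG_LH[OF ZH])
        show "(\<lambda>x. - r3 X x + Z x) \<in> Linfty M H" by (intro Linfty_add m X ZH)
        show "AE x in M. - r3 (\<lambda>x. X x + Z x) x = - r3 X x + Z x"
          using r3.r_trans[OF X ZH] by eventually_elim simp
      qed
      with r2.r_trans[OF m[OF X] Z] show ?thesis by eventually_elim simp
    qed
    show "AE x in M. r2 (\<lambda>x. - r3 (\<lambda>x. l * X x + (1 - l) * Y x) x) x
        \<le> l * r2 (\<lambda>x. - r3 X x) x + (1 - l) * r2 (\<lambda>x. - r3 Y x) x"
      if X: "X \<in> Linfty M K" and Y: "Y \<in> Linfty M K" and l: "0 \<le> l" "l \<le> 1" for X Y and l :: real
    proof -
      have "AE x in M. r2 (\<lambda>x. - r3 (\<lambda>x. l * X x + (1 - l) * Y x) x) x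
        \<le> r2 (\<lambda>x. l * (- r3 X x) + (1 - l) * (- r3 Y x)) x"
      proof (rule r2.r_mono)
        show "AE x in M. l * (- r3 X x) + (1 - l) * (- r3 Y x) \<le> - r3 (\<lambda>x. l * X x + (1 - l) * Y x) x"
          using r3.r_convex[OF X Y l] by eventually_elim simp
      qed (intro Linfty_lincomb m X Y)+
      with r2.r_convex[OF m[OF X] m[OF Y] l] show ?thesis by eventually_elim simp
    qed
    show "AE x in M. (\<lambda>n. r2 (\<lambda>x. - r3 (X n) x) x) \<longlonglongrightarrow> r2 (\<lambda>x. - r3 Y x) x"
      if X: "\<And>n. X n \<in> Linfty M K" and Y: "Y \<in> Linfty M K"
      and dec: "\<And>n. AE x in M. X (Suc n) x \<le> X n x" and lim: "AE x in M. (\<lambda>n::nat. X n x) \<longlonglongrightarrow> Y x" for X Y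
    proof (rule r2.cont[OF m[OF X] m[OF Y]])
      show "AE x in M. - r3 (X (Suc n)) x \<le> - r3 (X n) x" for n
        using r3.r_mono[OF X X dec[of n]] by eventually_elim simp
      show "AE x in M. (\<lambda>n. - r3 (X n) x) \<longlonglongrightarrow> - r3 Y x"
        using r3.cont[OF X Y dec lim] by eventually_elim (rule tendsto_minus)
    qed
  qed
qed

lemma time_consistent_iff_cocycle:
  assumes r1: "cond_risk_cfa M K G r1" and r2: "cond_risk_cfa M H G r2" and r3: "cond_risk_cfa M K H r3"
    and K: "sets K = sets M"
    and a1: "\<And>Q. dominated_prob M Q \<Longrightarrow> is_penalty M K G r1 Q (a1 Q)"
    and a2: "\<And>Q. dominated_prob M Q \<Longrightarrow> is_penalty M H G r2 Q (a2 Q)"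
    and a3: "\<And>Q. dominated_prob M Q \<Longrightarrow> is_penalty M K H r3 Q (a3 Q)"
  shows "(\<forall>X\<in>Linfty M K. AE x in M. r1 X x = r2 (\<lambda>x. - r3 X x) x) \<longleftrightarrow>
    (\<forall>Q. dominated_prob M Q \<longrightarrow> (AE x in Q. a1 Q x = a2 Q x + ereal_cond_exp Q G (a3 Q) x))"
    (is "?TC \<longleftrightarrow> ?CC")
proof -
  interpret r1: cond_risk_cfa M K G r1 by fact
  interpret r2: cond_risk_cfa M H G r2 by fact
  interpret r3: cond_risk_cfa M K H r3 by fact
  let ?R = "\<lambda>X. r2 (\<lambda>x. - r3 X x)"
  have R_cfa: "cond_risk_cfa M K G ?R" by (rule cond_risk_cfa_compose[OF r2 r3])
  interpret R: cond_risk_cfa M K G ?R by fact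
  show ?thesis
  proof
    assume ?TC
    then show ?CC
      using penalty_cocycle[OF r1.cond_risk_axioms r2.cond_risk_axioms r3.cond_risk_axioms] a1 a2 a3 by blast
  next
    assume CC: ?CC
    have pen: "\<exists>a. is_penalty M K G r1 Q a \<and> is_penalty M K G ?R Q a" if Q: "dominated_prob M Q" for Q
    proof -
      obtain b where b: "is_penalty M K G ?R Q b" using R.is_penalty_exists[OF Q] by blast
      \<comment> \<open>For the composition, the time consistency hypothesis of
        \<open>penalty_cocycle\<close> is reflexivity.\<close>
      have "AE x in Q. b x = a2 Q x + ereal_cond_exp Q G (a3 Q) x"
        by (rule penalty_cocycle[OF R.cond_risk_axioms r2.cond_risk_axioms r3.cond_risk_axioms _ Q b a2[OF Q] a3[OF Q]]) simp
      moreover have "AE x in Q. a1 Q x = a2 Q x + ereal_cond_exp Q G (a3 Q) x" using CC Q by blast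
      ultimately have "AE x in Q. b x = a1 Q x" by eventually_elim simp
      then have "is_penalty M K G ?R Q (a1 Q)"
        unfolding is_penalty_def
        by (rule is_ess_sup_cong_AE[OF b[unfolded is_penalty_def] is_penalty_measurable[OF a1[OF Q]]])
      then show ?thesis using a1[OF Q] by blast
    qed
    show ?TC
    proof
      fix X assume X: "X \<in> Linfty M K"
      have "AE x in M. ?R X x \<le> r1 X x"
        by (rule penalty_determines_le[OF r1.cond_risk_axioms R_cfa K pen X])
      moreover have "AE x in M. r1 X x \<le> ?R X x"
        by (rule penalty_determines_le[OF R.cond_risk_axioms r1 K _ X]) (use pen in blast)
      ultimately show "AE x in M. r1 X x = ?R X x" by eventually_elim simp
    qed
  qed
qed

lemma time_consistent_iff_acceptance:
  assumes r1: "cond_risk M K G r1" and r2: "cond_risk M H G r2" and r3: "cond_risk M K H r3"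
  shows "(\<forall>X\<in>Linfty M K. AE x in M. r1 X x = r2 (\<lambda>x. - r3 X x) x) \<longleftrightarrow>
    (\<forall>Q. dominated_prob M Q \<longrightarrow> {X \<in> Linfty M K. AE x in Q. r1 X x \<le> 0} =
      {\<lambda>x. Y x + Z x | Y Z. Y \<in> {Y \<in> Linfty M H. AE x in Q. r2 Y x \<le> 0} \<and> Z \<in> {Z \<in> Linfty M K. AE x in M. r3 Z x \<le> 0}})"
    (is "?TC \<longleftrightarrow> (\<forall>Q. _ \<longrightarrow> ?L Q = ?R Q)")
proof -
  interpret r1: cond_risk M K G r1 by fact
  interpret r2: cond_risk M H G r2 by fact
  interpret r3: cond_risk M K H r3 by fact
  have m: "(\<lambda>x. - r3 X x) \<in> Linfty M H" if "X \<in> Linfty M K" for X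
    by (intro Linfty_minus r3.r_closed that)
  have sum_mem: "(\<lambda>x. Y x + Z x) \<in> ?R Q"
    if "Y \<in> Linfty M H" "AE x in Q. r2 Y x \<le> 0" "Z \<in> Linfty M K" "AE x in M. r3 Z x \<le> 0" for Y Z Q
    using that by blast
  \<comment> \<open>Seen from the intermediate time, adding an acceptable \<open>Z\<close> to
    \<open>Y\<close> leaves a value of at least \<open>Y\<close>.\<close>
  have r3_sum: "AE x in M. Y x \<le> - r3 (\<lambda>x. Y x + Z x) x"
    if Y: "Y \<in> Linfty M H" and Z: "Z \<in> Linfty M K" "AE x in M. r3 Z x \<le> 0" for Y Z
  proof -
    have "AE x in M. r3 (\<lambda>x. Z x + Y x) x = r3 Z x - Y x" by (rule r3.r_trans[OF Z(1) Y])
    with Z(2) show ?thesis by eventually_elim (simp add: add.commute)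
  qed
  show ?thesis
  proof (intro iffI allI impI)
    fix Q assume TC: ?TC and Q: "dominated_prob M Q"
    show "?L Q = ?R Q"
    proof (intro set_eqI iffI)
      fix X assume "X \<in> ?L Q"
      then have X: "X \<in> Linfty M K" and acc: "AE x in Q. r1 X x \<le> 0" by auto
      have "AE x in Q. r1 X x = r2 (\<lambda>x. - r3 X x) x"
        using TC X by (intro dominated_prob_AE[OF Q]) auto
      with acc have "AE x in Q. r2 (\<lambda>x. - r3 X x) x \<le> 0" by eventually_elim simp
      moreover have "AE x in M. r3 (\<lambda>x. X x + r3 X x) x \<le> 0"
        using r3.r_add_r[OF X] by (auto elim: eventually_mono)
      moreover have "X = (\<lambda>x. - r3 X x + (X x + r3 X x))" by auto
      ultimately show "X \<in> ?R Q"
        using sum_mem[OF m[OF X] _ Linfty_add[OF X r3.r_LH[OF X]], of Q] by simp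
    next
      fix X assume "X \<in> ?R Q"
      then obtain Y Z where eq: "X = (\<lambda>x. Y x + Z x)"
        and Y: "Y \<in> Linfty M H" "AE x in Q. r2 Y x \<le> 0" and Z: "Z \<in> Linfty M K" "AE x in M. r3 Z x \<le> 0"
        by auto
      have X: "X \<in> Linfty M K" unfolding eq by (intro Linfty_add Z r3.LG_LH[OF Y(1)])
      have "AE x in M. r2 (\<lambda>x. - r3 X x) x \<le> r2 Y x"
        using r3_sum[OF Y(1) Z] by (intro r2.r_mono m X Y) (simp add: eq)
      then have "AE x in Q. r2 (\<lambda>x. - r3 X x) x \<le> r2 Y x" by (rule dominated_prob_AE[OF Q])
      moreover have "AE x in Q. r1 X x = r2 (\<lambda>x. - r3 X x) x"
        using TC X by (intro dominated_prob_AE[OF Q]) auto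
      ultimately have "AE x in Q. r1 X x \<le> 0" using Y(2) by eventually_elim simp
      then show "X \<in> ?L Q" using X by simp
    qed
  next
    assume "\<forall>Q. dominated_prob M Q \<longrightarrow> ?L Q = ?R Q"
    moreover have "dominated_prob M M"
      using r1.prob_space_axioms by (simp add: dominated_prob_def absolutely_continuous_def)
    ultimately have LR: "?L M = ?R M" by blast
    show ?TC
    proof
      fix X assume X: "X \<in> Linfty M K"
      \<comment> \<open>This position has \<open>r1\<close>-risk 0. Splitting it bounds the composed
        risk by \<open>r1 X\<close>; the reverse bound uses the other inclusion.\<close>
      let ?rX = "\<lambda>x. X x + r1 X x"
      have "?rX \<in> ?L M"
        using r1.r_add_r[OF X] Linfty_add[OF X r1.r_LH[OF X]] by (auto elim: eventually_mono)
      then have "?rX \<in> ?R M" using LR by simp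
      then obtain Y Z where eq: "?rX = (\<lambda>x. Y x + Z x)"
        and Y: "Y \<in> Linfty M H" "AE x in M. r2 Y x \<le> 0" and Z: "Z \<in> Linfty M K" "AE x in M. r3 Z x \<le> 0"
        by auto
      have r1H: "r1 X \<in> Linfty M H" by (rule r2.LG_LH[OF r1.r_closed[OF X]])
      have "AE x in M. Y x \<le> - r3 ?rX x" unfolding eq by (rule r3_sum[OF Y(1) Z])
      with r3.r_trans[OF X r1H] have "AE x in M. Y x \<le> - r3 X x + r1 X x" by eventually_elim simp
      then have "AE x in M. r2 (\<lambda>x. - r3 X x + r1 X x) x \<le> r2 Y x"
        by (intro r2.r_mono Y Linfty_add m X r1H)
      with Y(2) r2.r_trans[OF m[OF X] r1.r_closed[OF X]]
      have le: "AE x in M. r2 (\<lambda>x. - r3 X x) x \<le> r1 X x" by eventually_elim simp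
      \<comment> \<open>\<open>- r3 X + ?c\<close> is acceptable at the first stage and
        \<open>X + r3 X\<close> at the second. Their sum is \<open>X + ?c\<close>, so its
        \<open>r1\<close>-acceptability says \<open>r1 X \<le> ?c\<close>.\<close>
      let ?c = "r2 (\<lambda>x. - r3 X x)"
      have c: "?c \<in> Linfty M G" by (intro r2.r_closed m X)
      have "(\<lambda>x. (- r3 X x + ?c x) + (X x + r3 X x)) \<in> ?R M"
      proof -
        have "AE x in M. r2 (\<lambda>x. - r3 X x + ?c x) x \<le> 0"
          using r2.r_add_r[OF m[OF X]] by (auto elim: eventually_mono)
        moreover have "AE x in M. r3 (\<lambda>x. X x + r3 X x) x \<le> 0"
          using r3.r_add_r[OF X] by (auto elim: eventually_mono)
        ultimately show ?thesis
          by (intro sum_mem Linfty_add m X r2.LG_LH[OF c] r3.r_LH)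
      qed
      moreover have "(\<lambda>x. (- r3 X x + ?c x) + (X x + r3 X x)) = (\<lambda>x. X x + ?c x)" by auto
      ultimately have "(\<lambda>x. X x + ?c x) \<in> ?L M" using LR by simp
      then have "AE x in M. r1 (\<lambda>x. X x + ?c x) x \<le> 0" by simp
      with r1.r_trans[OF X c] le show "AE x in M. r1 X x = r2 (\<lambda>x. - r3 X x) x"
        by eventually_elim simp
    qed
  qed
qed

section \<open>Stopped sigma-algebras and their null sets\<close>

context filtered_prob_space
begin

lemma sets_pre_sigma_imp_sets: "A \<in> sets (pre_sigma \<tau>) \<Longrightarrow> stopping_time F \<tau> \<Longrightarrow> A \<in> sets P"
  using sets_pre_sigmaD[of \<tau> A \<top>] sets_F_top by simp

lemma subalgebra_pre_sigma: "stopping_time F \<tau> \<Longrightarrow> subalgebra P (pre_sigma \<tau>)"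
  by (auto simp: subalgebra_def space_pre_sigma intro: sets_pre_sigma_imp_sets)

lemma null_sets_pre_sigma:
  assumes \<tau>: "stopping_time F \<tau>" shows "null_sets P \<subseteq> sets (pre_sigma \<tau>)"
proof
  fix A assume A: "A \<in> null_sets P"
  show "A \<in> sets (pre_sigma \<tau>)"
  proof (rule sets_pre_sigmaI[OF \<tau>])
    fix t
    have "{\<omega>\<in>space (F t). \<tau> \<omega> \<le> t} \<in> sets (F t)" using stopping_timeD[OF \<tau>] by (simp add: pred_def)
    then have "{\<omega>\<in>space (F t). \<tau> \<omega> \<le> t} \<in> sets P" using sets_F_mono[of t \<top>] sets_F_top by auto
    then have "A \<inter> {\<omega>\<in>space (F t). \<tau> \<omega> \<le> t} \<in> null_sets P" using A by (intro null_set_Int2)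
    moreover have "A \<subseteq> space P" using A sets.sets_into_space by blast
    then have "A \<inter> {\<omega>\<in>space (F t). \<tau> \<omega> \<le> t} = {\<omega>\<in>A. \<tau> \<omega> \<le> t}" by (auto simp: space_F)
    ultimately have "{\<omega>\<in>A. \<tau> \<omega> \<le> t} \<in> null_sets P" by simp
    then have "{\<omega>\<in>A. \<tau> \<omega> \<le> t} \<in> sets (F 0)" by (auto simp: sets_F_0)
    then show "{\<omega>\<in>A. \<tau> \<omega> \<le> t} \<in> sets (F t)" using sets_F_mono[of 0 t] by auto
  qed
qed

text \<open>Restricting a measure can lose null sets, but here all of them lie in the stopped
  sigma-algebra, because they are in \<open>F 0\<close>. So the equivalence holds for arbitrary
  predicates, measurable or not.\<close>

lemma AE_stopped:
  assumes \<tau>: "stopping_time F \<tau>"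
  shows "(AE x in restr_to_subalg P (pre_sigma \<tau>). Q x) \<longleftrightarrow> (AE x in P. Q x)"
proof -
  have "null_sets (restr_to_subalg P (pre_sigma \<tau>)) = null_sets P"
    using null_sets_restr_to_subalg[OF subalgebra_pre_sigma[OF \<tau>]] null_sets_pre_sigma[OF \<tau>] by auto
  then show ?thesis by (simp add: eventually_ae_filter space_restr_to_subalg)
qed

lemma ordered_subalgebra:
  assumes "ordered_stopping_times P F \<sigma> \<tau>"
  shows "subalgebra (pre_sigma \<tau>) (pre_sigma \<sigma>)"
  using assms mono_pre_sigma[of \<sigma> \<tau>] by (auto simp: subalgebra_def space_pre_sigma ordered_stopping_times_def)

end

theorem theorem1p6:
  fixes P :: "'a measure" and F :: "ennreal \<Rightarrow> 'a measure"
    and \<rho> :: "'a risk_family" and \<nu> \<sigma> \<tau> :: "'a \<Rightarrow> ennreal"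
  assumes "filtered_prob_space P F"
    and "dynamic_risk_measure P F \<rho>"
    and "continuous_from_above P F \<rho>"
    and "ordered_stopping_times P F \<nu> \<sigma>"
    and "ordered_stopping_times P F \<sigma> \<tau>"
  shows "(time_consistent P F \<rho> \<nu> \<sigma> \<tau> \<longleftrightarrow> acceptance_decomposition P F \<rho> \<nu> \<sigma> \<tau>) \<and>
         (acceptance_decomposition P F \<rho> \<nu> \<sigma> \<tau> \<longleftrightarrow> cocycle_condition P F \<rho> \<nu> \<sigma> \<tau>)"
proof -
  interpret filtered_prob_space P F by fact
  note drm = assms(2)[unfolded dynamic_risk_measure_def, rule_format]
  note cfa = assms(3)[unfolded continuous_from_above_def, rule_format]
  have st: "stopping_time F \<tau>" using assms(5) by (simp add: ordered_stopping_times_def)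
  have ord_\<nu>\<tau>: "ordered_stopping_times P F \<nu> \<tau>"
    using assms(4,5) by (auto simp: ordered_stopping_times_def intro: order_trans)
  have ord_\<tau>\<tau>: "ordered_stopping_times P F \<tau> \<tau>" using st by (simp add: ordered_stopping_times_def)
  define S where "S = stopped_sigma P F"
  \<comment> \<open>The measures \<open>Q\<close> live on the stopped sigma-algebra of \<tau>, so
    \<open>P\<close> is restricted to it as well; on \<open>M\<close> they become dominated measures
    with the same sets.\<close>
  define M where "M = restr_to_subalg P (S \<tau>)"
  have subP: "subalgebra P (S \<tau>)" unfolding S_def by (rule subalgebra_pre_sigma[OF st])
  have sets_M: "sets M = sets (S \<tau>)" unfolding M_def by (rule sets_restr_to_subalg[OF subP])
  have ae: "(AE x in M. Q x) \<longleftrightarrow> (AE x in P. Q x)" for Q unfolding M_def S_def by (rule AE_stopped[OF st])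
  have Linf_eq: "Linf P F \<upsilon> = Linfty M (S \<upsilon>)" for \<upsilon>
    by (simp add: Linf_def Linfty_def ae S_def)
  have ac_eq: "ac_prob_measures P F \<tau> = {Q. dominated_prob M Q}"
    by (simp add: ac_prob_measures_def dominated_prob_def sets_M flip: S_def M_def)
  have prob_M: "prob_space M"
    unfolding M_def by (rule prob_space_restr_to_subalg[OF subP]) unfold_locales
  have risk: "cond_risk_cfa M (S \<tau>') (S \<sigma>') (\<rho> \<sigma>' \<tau>')"
    if ord: "ordered_stopping_times P F \<sigma>' \<tau>'" and ord': "ordered_stopping_times P F \<tau>' \<tau>" for \<sigma>' \<tau>'
  proof -
    interpret M: prob_space M by (rule prob_M)
    show ?thesis
    proof (unfold_locales, goal_cases)
      case 1
      show ?case
        using ordered_subalgebra[OF ord'] sets_eq_imp_space_eq[OF sets_M] by (simp add: subalgebra_def sets_M S_def)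
    next
      case 2
      show ?case using ordered_subalgebra[OF ord] by (simp add: S_def)
    next
      case (3 X)
      then show ?case using drm[OF ord] by (auto simp: Linf_eq)
    next
      case (4 X Y)
      then show ?case using drm[OF ord] by (auto simp: Linf_eq ae)
    next
      case (5 X Z)
      then show ?case using drm[OF ord] by (auto simp: Linf_eq ae)
    next
      case (6 X Y l)
      then show ?case using drm[OF ord] by (auto simp: Linf_eq ae)
    next
      case (7 X Y)
      then show ?case using cfa[OF ord, of Y X] by (auto simp: Linf_eq ae)
    qed
  qed
  have penalty: "is_penalty M (S \<tau>') (S \<sigma>') (\<rho> \<sigma>' \<tau>') Q (min_penalty P F \<rho> \<sigma>' \<tau>' Q)"
    if ord: "ordered_stopping_times P F \<sigma>' \<tau>'" and ord': "ordered_stopping_times P F \<tau>' \<tau>" and Q: "dominated_prob M Q" for \<sigma>' \<tau>' Q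
  proof -
    interpret R: cond_risk_cfa M "S \<tau>'" "S \<sigma>'" "\<rho> \<sigma>' \<tau>'" by (rule risk[OF ord ord'])
    have "min_penalty P F \<rho> \<sigma>' \<tau>' Q =
      ess_sup Q ((\<lambda>u \<omega>. ereal (u \<omega>)) ` penalty_term Q (S \<sigma>') (\<rho> \<sigma>' \<tau>') ` Linfty M (S \<tau>'))"
      unfolding min_penalty_def by (rule arg_cong[where f = "ess_sup Q"]) (auto simp: penalty_term_def Linf_eq S_def)
    \<comment> \<open>\<open>ess_sup\<close> is a choice by \<open>SOME\<close>; the existence of an
      essential supremum is what gives it the defining property.\<close>
    then show ?thesis
      using R.is_penalty_exists[OF Q] unfolding is_penalty_def ess_sup_def by (simp add: someI_ex)
  qed
  note r1 = risk[OF ord_\<nu>\<tau> ord_\<tau>\<tau>] and r2 = risk[OF assms(4,5)] and r3 = risk[OF assms(5) ord_\<tau>\<tau>]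
  have "time_consistent P F \<rho> \<nu> \<sigma> \<tau> \<longleftrightarrow> acceptance_decomposition P F \<rho> \<nu> \<sigma> \<tau>"
    using time_consistent_iff_acceptance[OF r1[THEN cond_risk_cfa.axioms(1)] r2[THEN cond_risk_cfa.axioms(1)] r3[THEN cond_risk_cfa.axioms(1)]]
    unfolding time_consistent_def acceptance_decomposition_def acceptance_set_def ac_eq Linf_eq ae by simp
  moreover have "time_consistent P F \<rho> \<nu> \<sigma> \<tau> \<longleftrightarrow> cocycle_condition P F \<rho> \<nu> \<sigma> \<tau>"
    using time_consistent_iff_cocycle[OF r1 r2 r3 sets_M[symmetric] penalty[OF ord_\<nu>\<tau> ord_\<tau>\<tau>] penalty[OF assms(4,5)] penalty[OF assms(5) ord_\<tau>\<tau>]]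
    unfolding time_consistent_def cocycle_condition_def ac_eq Linf_eq ae S_def by simp
  ultimately show ?thesis by simp
qed

end
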